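(* There is an algorithm that, given a Markov decision process $G=((V,E),(V_1,V_P),\delta)$ with $n=|V|$ states, a target vertex $s\in V$, and a tree decomposition of width $k$ of the MDP graph $(V,E)$ (edges treated as undirected), computes the almost-sure reachability set for $s$ in $O(n\cdot 2^k\cdot k^{2.38})$ time.
   Context: A Markov decision process (MDP) $G=((V,E),(V_1,V_P),\delta)$ consists of a finite directed graph $(V,E)$ (the MDP graph), a partition $(V_1,V_P)$ of $V$, and a probabilistic transition function $\delta: V_P\to\mathcal D(V)$ (probability distributions on $V$) such that for $u\in V_P$, $v\in V$, $uv\in E$ iff $\delta(u)(v)>0$. Edges $uv$ with $u\in V_1$ are player-1 edges. The almost-sure reachability set for a target vertex $s$ is the unique maximal (w.r.t. inclusion) set $Q\subseteq V$ such that (global condition) every $q\in Q$ has a path to $s$ using only vertices of $Q$, and (local condition) for every $uv\in E$ with $u\in Q\cap V_P$ we have $v\in Q$. A tree decomposition of an undirected graph $(V,E)$ is a pair $(B,T)$ where $B$ is a family of subsets (bags) of $V$ and $T$ is a tree whose nodes are the bags, such that the bags cover $V$, every edge has both endpoints in some bag, and for every vertex the bags containing it form a connected subtree of $T$; its width is the maximum bag size minus one. *)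

theory Defs
  imports "HOL-Probability.Probability_Mass_Function"
begin

section \<open>Markov decision processes and almost-sure reachability\<close>

record 'a mdp =
  verts :: "'a set"
  edges :: "('a \<times> 'a) set"
  player :: "'a set"
  prob :: "'a set"
  trans_fun :: "'a \<Rightarrow> 'a pmf"

text \<open>The values of \<^term>\<open>trans_fun G\<close> outside \<^term>\<open>prob G\<close> are irrelevant.\<close>

definition is_mdp :: "'a mdp \<Rightarrow> bool" where
  "is_mdp G \<longleftrightarrow>
     finite (verts G) \<and> edges G \<subseteq> verts G \<times> verts G \<and>
     player G \<union> prob G = verts G \<and> player G \<inter> prob G = {} \<and>
     (\<forall>u\<in>prob G. set_pmf (trans_fun G u) \<subseteq> verts G) \<and>
     (\<forall>u\<in>prob G. \<forall>v\<in>verts G. (u, v) \<in> edges G \<longleftrightarrow> pmf (trans_fun G u) v > 0)"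

definition almost_sure_closed :: "'a mdp \<Rightarrow> 'a \<Rightarrow> 'a set \<Rightarrow> bool" where
  "almost_sure_closed G s Q \<longleftrightarrow>
     Q \<subseteq> verts G \<and>
     (\<forall>q\<in>Q. s \<in> Q \<and> (q, s) \<in> (edges G \<inter> Q \<times> Q)\<^sup>*) \<and>
     (\<forall>u v. (u, v) \<in> edges G \<longrightarrow> u \<in> Q \<inter> prob G \<longrightarrow> v \<in> Q)"

definition almost_sure_reach :: "'a mdp \<Rightarrow> 'a \<Rightarrow> 'a set" where
  "almost_sure_reach G s =
     (THE Q. almost_sure_closed G s Q \<and>
        (\<forall>Q'. almost_sure_closed G s Q' \<longrightarrow> Q \<subseteq> Q' \<longrightarrow> Q' = Q))"

lemma almost_sure_closed_Union:
  assumes "\<And>Q. Q \<in> C \<Longrightarrow> almost_sure_closed G s Q"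
  shows "almost_sure_closed G s (\<Union>C)"
proof -
  have "s \<in> \<Union>C \<and> (q, s) \<in> (edges G \<inter> \<Union>C \<times> \<Union>C)\<^sup>*" if "Q \<in> C" "q \<in> Q" for Q q
  proof -
    have "s \<in> Q" "(q, s) \<in> (edges G \<inter> Q \<times> Q)\<^sup>*"
      using assms[OF that(1)] that(2) unfolding almost_sure_closed_def by auto
    moreover have "(edges G \<inter> Q \<times> Q)\<^sup>* \<subseteq> (edges G \<inter> \<Union>C \<times> \<Union>C)\<^sup>*"
      using that(1) by (intro rtrancl_mono) auto
    ultimately show ?thesis using that(1) by auto
  qed
  moreover have "\<Union>C \<subseteq> verts G"
    using assms unfolding almost_sure_closed_def by blast
  moreover have "v \<in> \<Union>C" if "(u, v) \<in> edges G" "u \<in> \<Union>C \<inter> prob G" for u v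
    using assms that unfolding almost_sure_closed_def by (metis IntD1 IntD2 IntI UnionE UnionI)
  ultimately show ?thesis
    unfolding almost_sure_closed_def by blast
qed

lemma almost_sure_reach_unique:
  "\<exists>!Q. almost_sure_closed G s Q \<and>
     (\<forall>Q'. almost_sure_closed G s Q' \<longrightarrow> Q \<subseteq> Q' \<longrightarrow> Q' = Q)"
proof -
  have "almost_sure_closed G s (\<Union>{Q. almost_sure_closed G s Q})"
    by (rule almost_sure_closed_Union) auto
  then show ?thesis
    by (intro ex1I[of _ "\<Union>{Q. almost_sure_closed G s Q}"]) blast+
qed


section \<open>Tree decompositions\<close>

text \<open>Undirected graphs are given by a vertex set and a set of edges, each edge being the set
  of its endpoints.\<close>

definition connected_graph :: "'a set \<Rightarrow> 'a set set \<Rightarrow> bool" where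
  "connected_graph N F \<longleftrightarrow>
     (\<forall>x\<in>N. \<forall>y\<in>N. (x, y) \<in> {(a, b). a \<in> N \<and> b \<in> N \<and> {a, b} \<in> F}\<^sup>*)"

definition is_cycle :: "'a set set \<Rightarrow> 'a list \<Rightarrow> bool" where
  "is_cycle F xs \<longleftrightarrow>
     3 \<le> length xs \<and> distinct xs \<and>
     (\<forall>i<length xs. {xs ! i, xs ! (Suc i mod length xs)} \<in> F)"

definition is_tree :: "'a set \<Rightarrow> 'a set set \<Rightarrow> bool" where
  "is_tree N F \<longleftrightarrow>
     finite N \<and> N \<noteq> {} \<and> (\<forall>e\<in>F. \<exists>x\<in>N. \<exists>y\<in>N. x \<noteq> y \<and> e = {x, y}) \<and>
     connected_graph N F \<and> (\<nexists>xs. is_cycle F xs)"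

definition undirected :: "('a \<times> 'a) set \<Rightarrow> 'a set set" where
  "undirected E = {{u, v} | u v. (u, v) \<in> E}"

definition tree_decomposition ::
  "'a set \<Rightarrow> 'a set set \<Rightarrow> 'a set set \<Rightarrow> 'a set set set \<Rightarrow> bool" where
  "tree_decomposition V E B F \<longleftrightarrow>
     (\<forall>b\<in>B. b \<subseteq> V) \<and> is_tree B F \<and>
     \<Union>B = V \<and>
     (\<forall>e\<in>E. \<exists>b\<in>B. e \<subseteq> b) \<and>
     (\<forall>v\<in>V. connected_graph {b \<in> B. v \<in> b} F)"

definition td_width :: "'a set set \<Rightarrow> nat" where
  "td_width B = Max (card ` B) - 1"


section \<open>Word RAM\<close>

text \<open>
  Algorithms are programs of a unit-cost random access machine with structured control flow.
  A state consists of the registers and the memory. Both hold words of \<open>w\<close> bits, represented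
  as natural numbers; results of operations are truncated to \<open>w\<close> bits. Subtraction is cut off
  at 0, and division by 0 is as in HOL.
\<close>

type_synonym state = "(nat \<Rightarrow> nat) \<times> (nat \<Rightarrow> nat)"

datatype binop = Add | Sub | Mul | Div | Mod | And | Or | Xor | Shl | Shr | Less | Equal

fun eval_binop :: "binop \<Rightarrow> nat \<Rightarrow> nat \<Rightarrow> nat" where
  "eval_binop Add a b = a + b"
| "eval_binop Sub a b = a - b"
| "eval_binop Mul a b = a * b"
| "eval_binop Div a b = a div b"
| "eval_binop Mod a b = a mod b"
| "eval_binop And a b = Bit_Operations.and a b"
| "eval_binop Or a b = Bit_Operations.or a b"
| "eval_binop Xor a b = Bit_Operations.xor a b"
| "eval_binop Shl a b = push_bit b a"
| "eval_binop Shr a b = drop_bit b a"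
| "eval_binop Less a b = of_bool (a < b)"
| "eval_binop Equal a b = of_bool (a = b)"

text \<open>In \<open>Op f x y z\<close>, \<open>Load x y\<close> and \<open>Store x y\<close> all of \<open>x\<close>, \<open>y\<close>, \<open>z\<close> are register numbers:
  \<open>x := f y z\<close>, \<open>x := mem[y]\<close> and \<open>mem[x] := y\<close>.\<close>

datatype com =
    Const nat nat
  | Op binop nat nat nat
  | Load nat nat
  | Store nat nat
  | Seq com com
  | IfNZ nat com com
  | WhileNZ nat com

text \<open>\<open>exec w c \<sigma> t \<tau>\<close>: with \<open>w\<close>-bit words, \<open>c\<close> started in \<open>\<sigma>\<close> halts in \<open>\<tau>\<close> after \<open>t\<close> steps. Each
  elementary command and each test of a register against 0 counts as one step.\<close>

inductive exec :: "nat \<Rightarrow> com \<Rightarrow> state \<Rightarrow> nat \<Rightarrow> state \<Rightarrow> bool" for w :: nat where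
  Const: "exec w (Const x a) (R, M) 1 (R(x := take_bit w a), M)"
| Op: "exec w (Op f x y z) (R, M) 1 (R(x := take_bit w (eval_binop f (R y) (R z))), M)"
| Load: "exec w (Load x y) (R, M) 1 (R(x := M (R y)), M)"
| Store: "exec w (Store x y) (R, M) 1 (R, M(R x := R y))"
| Seq: "exec w c1 \<sigma> t1 \<rho> \<Longrightarrow> exec w c2 \<rho> t2 \<tau> \<Longrightarrow> exec w (Seq c1 c2) \<sigma> (t1 + t2) \<tau>"
| IfTrue: "R x \<noteq> 0 \<Longrightarrow> exec w c1 (R, M) t \<tau> \<Longrightarrow> exec w (IfNZ x c1 c2) (R, M) (1 + t) \<tau>"
| IfFalse: "R x = 0 \<Longrightarrow> exec w c2 (R, M) t \<tau> \<Longrightarrow> exec w (IfNZ x c1 c2) (R, M) (1 + t) \<tau>"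
| WhileTrue: "R x \<noteq> 0 \<Longrightarrow> exec w c (R, M) t1 \<rho> \<Longrightarrow> exec w (WhileNZ x c) \<rho> t2 \<tau> \<Longrightarrow>
    exec w (WhileNZ x c) (R, M) (1 + t1 + t2) \<tau>"
| WhileFalse: "R x = 0 \<Longrightarrow> exec w (WhileNZ x c) (R, M) 1 (R, M)"

lemma exec_deterministic:
  "exec w c \<sigma> t \<tau> \<Longrightarrow> exec w c \<sigma> t' \<tau>' \<Longrightarrow> t' = t \<and> \<tau>' = \<tau>"
proof (induction arbitrary: t' \<tau>' rule: exec.induct)
  case (WhileTrue R x c M t1 \<rho> t2 \<tau>)
  from WhileTrue.prems WhileTrue.hyps(1) obtain u1 \<rho>' u2
    where "exec w c (R, M) u1 \<rho>'" "exec w (WhileNZ x c) \<rho>' u2 \<tau>'" "t' = 1 + u1 + u2"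
    by cases auto
  then show ?case using WhileTrue.IH by metis
next
  case (Seq c1 \<sigma> t1 \<rho> c2 t2 \<tau>)
  from Seq.prems obtain u1 \<rho>' u2
    where "exec w c1 \<sigma> u1 \<rho>'" "exec w c2 \<rho>' u2 \<tau>'" "t' = u1 + u2"
    by cases auto
  then show ?case using Seq.IH by metis
next
  case (IfTrue R x c1 M t \<tau> c2)
  from IfTrue.prems IfTrue.hyps(1) obtain u where "exec w c1 (R, M) u \<tau>'" "t' = 1 + u"
    by cases auto
  then show ?case using IfTrue.IH by metis
next
  case (IfFalse R x c2 M t \<tau> c1)
  from IfFalse.prems IfFalse.hyps(1) obtain u where "exec w c2 (R, M) u \<tau>'" "t' = 1 + u"
    by cases auto
  then show ?case using IfFalse.IH by metis
qed (erule exec.cases; simp; fail)+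

text \<open>The input occupies the memory cells from address 0 on; all other cells and all registers
  are initially 0.\<close>

definition init_state :: "nat list \<Rightarrow> state" where
  "init_state xs = ((\<lambda>_. 0), (\<lambda>i. if i < length xs then xs ! i else 0))"


section \<open>Input format\<close>

text \<open>
  The vertices are numbered \<open>0, ..., n - 1\<close>. The input lists, in arbitrary order and without
  repetitions, the edges of the MDP graph, the bags, the vertices of each bag (preceded by their
  number), and the edges of the decomposition tree as pairs of positions in the list of bags.
  The probabilities are not part of the input: besides the graph and the partition, the
  algorithm has no access to the transition function.
\<close>

definition flatten_pairs :: "(nat \<times> nat) list \<Rightarrow> nat list" where
  "flatten_pairs ps = concat (map (\<lambda>(u, v). [u, v]) ps)"

definition encodes_instance ::
  "nat list \<Rightarrow> nat mdp \<Rightarrow> nat \<Rightarrow> nat set set \<Rightarrow> nat set set set \<Rightarrow> bool" where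
  "encodes_instance xs G s B F \<longleftrightarrow>
     (\<exists>n es bs ts.
        verts G = {..<n} \<and>
        distinct es \<and> set es = edges G \<and>
        (\<forall>b\<in>set bs. distinct b) \<and> distinct (map set bs) \<and> set (map set bs) = B \<and>
        (\<forall>(i, j)\<in>set ts. i < length bs \<and> j < length bs) \<and>
        distinct (map (\<lambda>(i, j). {i, j}) ts) \<and>
        set (map (\<lambda>(i, j). {set (bs ! i), set (bs ! j)}) ts) = F \<and>
        xs = [n, s, length es, length bs, length ts]
             @ map (\<lambda>u. of_bool (u \<in> prob G)) [0..<n]
             @ flatten_pairs es
             @ concat (map (\<lambda>b. length b # b) bs)
             @ flatten_pairs ts)"

end

theory Submission
  imports Defs
begin

text \<open>
  A breadth-first search of the decomposition tree orders the vertices such that each vertex \<open>v\<close>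
  together with its earlier neighbours (in the graph with fill-in edges) lies in a single bag.
  Adding \<open>s\<close> to all bags, \<open>k + 2\<close> colours suffice to make each of these sets rainbow coloured, so that its
  subsets are represented by words of \<open>k + 2\<close> bits. The vertices are then eliminated in reverse order.
  For each subset \<open>Y\<close> of the bag of \<open>v\<close>, a table stores whether there is a set \<open>Q\<close> of vertices that
  meets the bag in \<open>Y\<close>, satisfies the local condition, and all of whose eliminated vertices reach \<open>Y\<close>;
  it also stores the reachability relation that the largest such \<open>Q\<close> induces on \<open>Y\<close>. Since these
  sets are closed under union, it is optimal to add \<open>v\<close> whenever this is possible. Eliminating \<open>v\<close> takes
  time \<open>O(2\<^sup>k k)\<close>, because it only bridges the paths through \<open>v\<close>. A top-down pass recovers the set.

  There may be exponentially many bags in \<open>k\<close>, but every bag is contained in the topmost bag of one of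
  its vertices, so there are \<open>O(n 2\<^sup>k)\<close> bags, and reading the input takes time \<open>O(n 2\<^sup>k k)\<close>.
\<close>

section \<open>Search orders of trees\<close>

text \<open>For the vertices, the tree matters only through the running intersection property of a
  search order: an earlier vertex that shares any bag with \<open>v\<close> lies in the topmost bag
  of \<open>v\<close>. The counts of bags and edges, the elimination order and the colouring all
  rest on this. Colours belong to vertices, not to positions in a bag. So a subset keeps its mask
  when it passes from the bag of a vertex to that of its parent: restriction is a bitwise
  conjunction, without renumbering. Table indices have to fit into words, but words are only known
  to hold polynomials in the input length, and \<open>2 ^ k\<close> need not be one. Hence a case
  split: for \<open>n * n < 2 ^ k\<close> a naive polynomial algorithm is affordable, and otherwise
  masks are polynomial in \<open>n\<close>. Correctness and time are proved for an array language in
  which each statement and test counts as one step; compilation to the RAM costs a constant number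
  of machine steps per source step. The bound reached is quadratic in \<open>k\<close>: the search
  for a free colour costs \<open>O(k)\<close> at each position of a bag, while elimination is linear
  in \<open>k\<close>. The square is weakened to the exponent 2.38 only at the very end.\<close>

lemma nth_notin_take:
  assumes "distinct xs" "i < length xs"
  shows "xs ! i \<notin> set (take i xs)"
proof
  assume "xs ! i \<in> set (take i xs)"
  then obtain j where "j < i" "xs ! j = xs ! i"
    using assms(2) nth_image[of i xs] by (metis atLeastLessThan_iff imageE less_imp_le)
  then show False using assms nth_eq_iff_index_eq[of xs j i] by simp
qed

lemma rtrancl_distinct_path:
  assumes "(x, y) \<in> r\<^sup>*"
  shows "\<exists>p. p \<noteq> [] \<and> hd p = x \<and> last p = y \<and> distinct p \<and> (\<forall>i. Suc i < length p \<longrightarrow> (p ! i, p ! Suc i) \<in> r)"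
  using assms
proof (induction rule: converse_rtrancl_induct)
  case base
  show ?case by (intro exI[of _ "[y]"]) auto
next
  case (step x z)
  then obtain p where p: "p \<noteq> []" "hd p = z" "last p = y" "distinct p"
    "\<forall>i. Suc i < length p \<longrightarrow> (p ! i, p ! Suc i) \<in> r" by blast
  show ?case
  proof (cases "x \<in> set p")
    case True
    then obtain k where k: "k < length p" "p ! k = x" by (metis in_set_conv_nth)
    show ?thesis
      by (intro exI[of _ "drop k p"]) (use p k in \<open>auto simp: hd_drop_conv_nth\<close>)
  next
    case False
    have "((x # p) ! i, (x # p) ! Suc i) \<in> r" if "Suc i < length (x # p)" for i
      using that p step(1) by (cases i) (auto simp: hd_conv_nth)
    then show ?thesis using p False by (intro exI[of _ "x # p"]) auto
  qed
qed

text \<open>A path that bypasses the edge between its ends closes up to a cycle. It has at least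
  three vertices: one is excluded by \<open>x \<noteq> y\<close>, two because the path avoids the
  edge itself. Acyclicity of the decomposition tree is always applied in this form.\<close>

lemma acyclic_bridge:
  assumes "\<nexists>xs. is_cycle F xs" "{x, y} \<in> F" "x \<noteq> y"
    and path: "(x, y) \<in> r\<^sup>*" and r: "\<And>a b. (a, b) \<in> r \<Longrightarrow> {a, b} \<in> F \<and> {a, b} \<noteq> {x, y}"
  shows False
proof -
  obtain p where p: "p \<noteq> []" "hd p = x" "last p = y" "distinct p"
    "\<forall>i. Suc i < length p \<longrightarrow> (p ! i, p ! Suc i) \<in> r"
    using rtrancl_distinct_path[OF path] by blast
  have h: "p ! 0 = x" "p ! (length p - 1) = y" using p by (auto simp: hd_conv_nth last_conv_nth)
  have "length p \<noteq> 1" using h \<open>x \<noteq> y\<close> by auto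
  moreover have "length p \<noteq> 2"
  proof
    assume "length p = 2"
    then have "(x, y) \<in> r" using p(5) h by (metis diff_Suc_1 lessI numeral_2_eq_2)
    then show False using r by blast
  qed
  ultimately have l: "3 \<le> length p" using p(1) by (cases p; cases "tl p"; cases "tl (tl p)") auto
  have "{p ! i, p ! (Suc i mod length p)} \<in> F" if "i < length p" for i
  proof (cases "Suc i < length p")
    case True
    then show ?thesis using p(5) r by auto
  next
    case False
    then have "Suc i = length p" using that by simp
    then show ?thesis using h assms(2) by (metis diff_Suc_1 mod_self insert_commute)
  qed
  then have "is_cycle F p" unfolding is_cycle_def using l p(4) by blast
  then show False using assms(1) by blast
qed

text \<open>Covers every graph search, not just the breadth-first one: each element but the first
  has some earlier neighbour.\<close>

definition search_order :: "'a set set \<Rightarrow> 'a list \<Rightarrow> bool" where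
  "search_order F qs \<longleftrightarrow> distinct qs \<and> (\<forall>i<length qs. 0 < i \<longrightarrow> (\<exists>p<i. {qs ! p, qs ! i} \<in> F))"

text \<open>Following earlier neighbours leads from every position to the first one without leaving
  the prefix. The relation is symmetric, so two such walks compose.\<close>

lemma search_order_connected:
  assumes so: "search_order F qs" and ij: "i < m" "j < m" "m \<le> length qs"
  shows "(qs ! i, qs ! j) \<in> {(a, b). {a, b} \<in> F \<and> a \<in> set (take m qs) \<and> b \<in> set (take m qs)}\<^sup>*"
    (is "_ \<in> ?r\<^sup>*")
proof -
  have mem: "qs ! i \<in> set (take m qs)" if "i < m" for i
    using that ij(3) by (metis length_take min.absorb2 nth_mem nth_take)
  have root: "(qs ! i, qs ! 0) \<in> ?r\<^sup>*" if "i < m" for i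
    using that
  proof (induction i rule: less_induct)
    case (less i)
    show ?case
    proof (cases "i = 0")
      case False
      then obtain p where p: "p < i" "{qs ! p, qs ! i} \<in> F"
        using so less.prems ij(3) unfolding search_order_def by (metis gr0I less_le_trans)
      have "(qs ! i, qs ! p) \<in> ?r" using p less.prems mem by (auto simp: insert_commute)
      then show ?thesis using less.IH[OF p(1)] p less.prems by (meson converse_rtrancl_into_rtrancl less_trans)
    qed simp
  qed
  have "sym ?r" by (auto simp: sym_def insert_commute)
  then have "sym (?r\<^sup>*)" by (rule sym_rtrancl)
  then show ?thesis using root[OF ij(1)] root[OF ij(2)] by (meson rtrancl_trans symD)
qed

text \<open>Two earlier neighbours are joined inside the prefix before \<open>i\<close>. This path,
  continued by the edge from one of them to \<open>qs ! i\<close>, bypasses the edge from the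
  other.\<close>

lemma search_order_parent_unique:
  assumes ac: "\<nexists>xs. is_cycle F xs" and so: "search_order F qs"
    and i: "i < length qs" "p < i" "p' < i" "{qs ! p, qs ! i} \<in> F" "{qs ! p', qs ! i} \<in> F"
  shows "p = p'"
proof (rule ccontr)
  assume ne: "p \<noteq> p'"
  have d: "distinct qs" using so unfolding search_order_def by blast
  have neq: "qs ! a \<noteq> qs ! b" if "a \<noteq> b" "a \<le> i" "b \<le> i" for a b
    using that d i(1) by (auto simp: nth_eq_iff_index_eq)
  let ?r = "{(a, b). {a, b} \<in> F \<and> {a, b} \<noteq> {qs ! p, qs ! i}}"
  have "qs ! i \<notin> set (take i qs)"
    by (rule nth_notin_take[OF d i(1)])
  then have "{(a, b). {a, b} \<in> F \<and> a \<in> set (take i qs) \<and> b \<in> set (take i qs)} \<subseteq> ?r"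
    by (auto simp: doubleton_eq_iff)
  then have "(qs ! p, qs ! p') \<in> ?r\<^sup>*"
    using search_order_connected[OF so i(2,3)] i(1) by (meson less_imp_le rtrancl_mono subsetD)
  moreover have "(qs ! p', qs ! i) \<in> ?r"
    using i ne neq[of p p'] neq[of p' i] by (auto simp: doubleton_eq_iff)
  ultimately have "(qs ! p, qs ! i) \<in> ?r\<^sup>*" by (rule rtrancl_into_rtrancl)
  moreover have "qs ! p \<noteq> qs ! i" using neq[of p i] i(2) by simp
  ultimately show False by (elim acyclic_bridge[OF ac i(4), rotated]) blast+
qed

text \<open>Connectedness provides an edge that leaves any proper nonempty subset, so the list can
  grow until it exhausts \<open>N\<close>. This order serves the counting bounds; the program
  computes its own.\<close>

lemma search_order_exists:
  assumes "finite N" "N \<noteq> {}" "connected_graph N F"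
  shows "\<exists>qs. search_order F qs \<and> set qs = N"
proof -
  have "\<exists>qs. search_order F qs \<and> set qs \<subseteq> N \<and> length qs = m" if "1 \<le> m" "m \<le> card N" for m
    using that
  proof (induction m rule: dec_induct)
    case base
    obtain x where "x \<in> N" using assms(2) by blast
    then show ?case by (intro exI[of _ "[x]"]) (auto simp: search_order_def)
  next
    case (step m)
    then obtain qs where qs: "search_order F qs" "set qs \<subseteq> N" "length qs = m" by auto
    then have "card (set qs) = m" by (auto simp: search_order_def distinct_card)
    then obtain y where y: "y \<in> N" "y \<notin> set qs"
      using step.prems qs(2) by (metis Suc_n_not_le_n subsetI subset_antisym)
    obtain x where x: "x \<in> set qs" using qs(3) step by (cases qs) auto
    have "(x, y) \<in> {(a, b). a \<in> N \<and> b \<in> N \<and> {a, b} \<in> F}\<^sup>*"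
      using assms(3) x y qs(2) unfolding connected_graph_def by blast
    then have "\<exists>a b. a \<in> set qs \<and> b \<in> N \<and> b \<notin> set qs \<and> {a, b} \<in> F"
      using x y(2) by (induction rule: converse_rtrancl_induct) auto
    then obtain a b where ab: "a \<in> set qs" "b \<in> N" "b \<notin> set qs" "{a, b} \<in> F" by blast
    then obtain k where k: "k < length qs" "qs ! k = a" by (metis in_set_conv_nth)
    have "search_order F (qs @ [b])"
      unfolding search_order_def
    proof (intro conjI allI impI)
      show "distinct (qs @ [b])" using qs(1) ab unfolding search_order_def by simp
      fix i assume i: "i < length (qs @ [b])" "0 < i"
      show "\<exists>p<i. {(qs @ [b]) ! p, (qs @ [b]) ! i} \<in> F"
      proof (cases "i < length qs")
        case True
        then obtain p where "p < i" "{qs ! p, qs ! i} \<in> F" using qs(1) i unfolding search_order_def by blast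
        then show ?thesis using True by (intro exI[of _ p]) (simp add: nth_append)
      next
        case False
        then have "i = length qs" using i by simp
        then show ?thesis using ab k by (intro exI[of _ k]) (simp add: nth_append)
      qed
    qed
    then show ?case using ab qs by (intro exI[of _ "qs @ [b]"]) auto
  qed
  from this[of "card N"] obtain qs where qs: "search_order F qs" "set qs \<subseteq> N" "length qs = card N"
    using assms by (metis card_gt_0_iff One_nat_def Suc_leI order_refl)
  then have "set qs = N"
    using assms(1) by (metis card_subset_eq distinct_card search_order_def)
  then show ?thesis using qs(1) by blast
qed

text \<open>Each edge is charged to its later endpoint, from which it can be recovered because the
  earlier neighbour is unique. The value of \<open>f\<close> at the first element is arbitrary,
  which is harmless since only an inclusion is claimed.\<close>

lemma card_tree_edges:
  assumes t: "is_tree N F"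
  shows "finite F \<and> card F \<le> card N"
proof -
  have N: "finite N" "N \<noteq> {}" "connected_graph N F" and ac: "\<nexists>xs. is_cycle F xs"
    and e: "\<forall>e\<in>F. \<exists>x\<in>N. \<exists>y\<in>N. x \<noteq> y \<and> e = {x, y}"
    using t unfolding is_tree_def by auto
  obtain qs where qs: "search_order F qs" "set qs = N" using search_order_exists[OF N] by blast
  have d: "distinct qs" using qs(1) unfolding search_order_def by blast
  define f where "f i = {qs ! (SOME p. p < i \<and> {qs ! p, qs ! i} \<in> F), qs ! i}" for i
  have "F \<subseteq> f ` {..<length qs}"
  proof
    fix x assume x: "x \<in> F"
    obtain a b where ab: "a \<in> N" "b \<in> N" "a \<noteq> b" "x = {a, b}" using e x by blast
    obtain i j where ij: "i < length qs" "j < length qs" "qs ! i = a" "qs ! j = b"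
      using ab(1,2) qs(2) by (metis in_set_conv_nth)
    have "\<exists>i j. i < j \<and> j < length qs \<and> x = {qs ! i, qs ! j}"
    proof (cases "i < j")
      case False
      then have "j < i" using ij ab(3) by (metis nat_neq_iff)
      then show ?thesis using ij ab(4) by (intro exI[of _ j] exI[of _ i]) auto
    qed (use ij ab in auto)
    then obtain i j where k: "i < j" "j < length qs" "x = {qs ! i, qs ! j}" by blast
    let ?p = "SOME p. p < j \<and> {qs ! p, qs ! j} \<in> F"
    have "?p < j \<and> {qs ! ?p, qs ! j} \<in> F" by (rule someI[of _ i]) (use k x in auto)
    then have "?p = i"
      using search_order_parent_unique[OF ac qs(1) k(2) _ k(1)] k(3) x by blast
    then show "x \<in> f ` {..<length qs}" using k unfolding f_def by auto
  qed
  moreover have "card (f ` {..<length qs}) \<le> card N"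
    using card_image_le[of "{..<length qs}" f] distinct_card[OF d] qs(2) by simp
  ultimately show ?thesis by (meson card_mono finite_imageI finite_lessThan finite_subset order_trans)
qed

section \<open>Running intersection property\<close>

definition rip :: "'a set list \<Rightarrow> bool" where
  "rip bs \<longleftrightarrow> (\<forall>i<length bs. 0 < i \<longrightarrow> (\<exists>p<i. bs ! i \<inter> \<Union>(set (take i bs)) \<subseteq> bs ! p))"

text \<open>Suppose \<open>x\<close> lies in bag \<open>i\<close> and in an earlier bag
  \<open>j\<close>, but not in the parent \<open>p\<close> of \<open>i\<close>. The bags containing
  \<open>x\<close> are connected, which leads from \<open>i\<close> to \<open>j\<close> without
  touching \<open>p\<close>, and the prefix leads on from \<open>j\<close> to \<open>p\<close>
  without touching \<open>i\<close>. Together they bypass the tree edge between \<open>i\<close> and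
  \<open>p\<close>.\<close>

lemma tree_decomposition_rip:
  assumes td: "tree_decomposition V E B F" and so: "search_order F qs" and qs: "set qs = B"
  shows "rip qs"
  unfolding rip_def
proof (intro allI impI)
  fix i assume i: "i < length qs" "0 < i"
  have ac: "\<nexists>xs. is_cycle F xs" using td unfolding tree_decomposition_def is_tree_def by simp
  have d: "distinct qs" using so unfolding search_order_def by blast
  obtain p where p: "p < i" "{qs ! p, qs ! i} \<in> F" using so i unfolding search_order_def by blast
  have "x \<in> qs ! p" if x: "x \<in> qs ! i" "x \<in> \<Union>(set (take i qs))" for x
  proof (rule ccontr)
    assume xp: "x \<notin> qs ! p"
    obtain j where j: "j < i" "x \<in> qs ! j" using x(2) by (auto simp: in_set_conv_nth)
    let ?r = "{(a, b). {a, b} \<in> F \<and> {a, b} \<noteq> {qs ! i, qs ! p}}"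
    let ?Bx = "{b \<in> B. x \<in> b}"
    have "qs ! i \<notin> set (take i qs)"
      by (rule nth_notin_take[OF d i(1)])
    then have "{(a, b). {a, b} \<in> F \<and> a \<in> set (take i qs) \<and> b \<in> set (take i qs)} \<subseteq> ?r"
      by (auto simp: doubleton_eq_iff)
    then have 1: "(qs ! j, qs ! p) \<in> ?r\<^sup>*"
      using search_order_connected[OF so j(1) p(1)] i(1) by (meson less_imp_le rtrancl_mono subsetD)
    have V: "x \<in> V" using td x i qs unfolding tree_decomposition_def by (metis UnionI nth_mem)
    have "(qs ! i, qs ! j) \<in> {(a, b). a \<in> ?Bx \<and> b \<in> ?Bx \<and> {a, b} \<in> F}\<^sup>*"
    proof -
      have "connected_graph ?Bx F" using td V unfolding tree_decomposition_def by blast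
      moreover have "qs ! i \<in> ?Bx" "qs ! j \<in> ?Bx" using x(1) j i qs by auto
      ultimately show ?thesis unfolding connected_graph_def by blast
    qed
    moreover have "{(a, b). a \<in> ?Bx \<and> b \<in> ?Bx \<and> {a, b} \<in> F} \<subseteq> ?r"
      using xp by (auto simp: doubleton_eq_iff)
    ultimately have "(qs ! i, qs ! j) \<in> ?r\<^sup>*" by (meson rtrancl_mono subsetD)
    then have "(qs ! i, qs ! p) \<in> ?r\<^sup>*" using 1 by simp
    moreover have "qs ! i \<noteq> qs ! p" using d i p by (simp add: nth_eq_iff_index_eq)
    moreover have "{qs ! i, qs ! p} \<in> F" using p(2) by (simp add: insert_commute)
    ultimately show False by (elim acyclic_bridge[OF ac, rotated 2]) blast+
  qed
  then show "\<exists>p<i. qs ! i \<inter> \<Union>(set (take i qs)) \<subseteq> qs ! p" using p(1) by blast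
qed

text \<open>As long as bag \<open>i\<close> is not the first bag of \<open>v\<close>, both vertices
  occur in bags before \<open>i\<close>, so the running intersection property moves both into one
  earlier bag. The descent can only end in the first bag of \<open>v\<close>.\<close>

lemma rip_first:
  assumes "rip bs" "i < length bs" "u \<in> bs ! i" "v \<in> bs ! i"
    and fu: "fu < length bs" "u \<in> bs ! fu" and fv: "v \<in> bs ! fv" "fu \<le> fv"
    and first: "\<And>j. j < fv \<Longrightarrow> v \<notin> bs ! j"
  shows "u \<in> bs ! fv"
  using assms(2-4)
proof (induction i rule: less_induct)
  case (less i)
  have "fv \<le> i" using first less.prems by (meson not_le)
  show ?case
  proof (cases "i = fv")
    case False
    then have lt: "fv < i" using \<open>fv \<le> i\<close> by simp
    then obtain p where p: "p < i" "bs ! i \<inter> \<Union>(set (take i bs)) \<subseteq> bs ! p"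
      using assms(1) less.prems(1) unfolding rip_def by (metis gr0I not_less0)
    have "bs ! j \<subseteq> \<Union>(set (take i bs))" if "j < i" for j
      using that less.prems(1) by (metis Union_upper in_set_conv_nth length_take min.absorb4 nth_take)
    then have "u \<in> bs ! p" "v \<in> bs ! p" using p(2) less.prems fu fv lt by (meson IntI le_less_trans subsetD)+
    then show ?thesis using less.IH[OF p(1)] p less.prems by simp
  qed (use less in simp)
qed

lemma finite_first_index:
  assumes "x \<in> \<Union>(set bs)"
  shows "\<exists>f<length bs. x \<in> bs ! f \<and> (\<forall>j<f. x \<notin> bs ! j)"
proof -
  have ex: "\<exists>f. f < length bs \<and> x \<in> bs ! f" using assms by (auto simp: in_set_conv_nth)
  let ?f = "LEAST f. f < length bs \<and> x \<in> bs ! f"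
  have "?f < length bs \<and> x \<in> bs ! ?f" by (rule LeastI_ex[OF ex])
  moreover have "x \<notin> bs ! j" if "j < ?f" for j
    using not_less_Least[OF that] that calculation by auto
  ultimately show ?thesis by blast
qed

text \<open>The vertex of the bag whose first occurrence comes last will do: all other members occur
  no later and share this bag with it, so they lie in its first bag.\<close>

lemma rip_bag_subset:
  assumes "rip bs" "i < length bs" "bs ! i \<noteq> {}" "finite (bs ! i)"
  shows "\<exists>v\<in>bs ! i. \<exists>f<length bs. v \<in> bs ! f \<and> (\<forall>j<f. v \<notin> bs ! j) \<and> bs ! i \<subseteq> bs ! f"
proof -
  define f where "f x = (LEAST f. f < length bs \<and> x \<in> bs ! f)" for x
  have f: "f x < length bs" "x \<in> bs ! f x" "\<And>j. j < f x \<Longrightarrow> x \<notin> bs ! j" if "x \<in> bs ! i" for x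
  proof -
    have ex: "\<exists>f. f < length bs \<and> x \<in> bs ! f" using assms(2) that by auto
    show *: "f x < length bs" "x \<in> bs ! f x" unfolding f_def using LeastI_ex[OF ex] by auto
    show "\<And>j. j < f x \<Longrightarrow> x \<notin> bs ! j" using not_less_Least * unfolding f_def by (metis order.strict_trans)
  qed
  have "\<exists>v\<in>bs ! i. \<forall>u\<in>bs ! i. f u \<le> f v"
    using assms(3,4) Max_in[of "f ` (bs ! i)"] Max_ge[of "f ` (bs ! i)"] by fastforce
  then obtain v where v: "v \<in> bs ! i" "\<forall>u\<in>bs ! i. f u \<le> f v" by blast
  have "bs ! i \<subseteq> bs ! f v"
  proof
    fix u assume u: "u \<in> bs ! i"
    show "u \<in> bs ! f v"
      by (rule rip_first[OF assms(1,2) u v(1) f(1)[OF u] f(2)[OF u] f(2)[OF v(1)]])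
        (use v u f(3)[OF v(1)] in auto)
  qed
  then show ?thesis using v f by blast
qed

lemma tree_decomposition_search_order:
  assumes "tree_decomposition V E B F"
  shows "\<exists>qs. search_order F qs \<and> set qs = B \<and> rip qs"
  using assms search_order_exists[of B F] tree_decomposition_rip[OF assms]
  unfolding tree_decomposition_def is_tree_def by metis

lemma card_bags:
  assumes td: "tree_decomposition V E B F" and fin: "finite V" and K: "\<And>b. b \<in> B \<Longrightarrow> card b \<le> K"
  shows "card B \<le> card V * 2 ^ K + 1"
proof -
  obtain qs where so: "search_order F qs" and qs: "set qs = B" and rip: "rip qs"
    using tree_decomposition_search_order[OF td] by blast
  have sub: "b \<subseteq> V" if "b \<in> B" for b using td that unfolding tree_decomposition_def by blast
  define h where "h v = (SOME b. b \<in> B \<and> (\<exists>f<length qs. b = qs ! f \<and> v \<in> qs ! f \<and> (\<forall>j<f. v \<notin> qs ! j)))" for v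
  have UB: "\<Union>B = V" using td unfolding tree_decomposition_def by blast
  have h: "h v \<in> B \<and> (\<exists>f<length qs. h v = qs ! f \<and> v \<in> qs ! f \<and> (\<forall>j<f. v \<notin> qs ! j))" if v: "v \<in> V" for v
  proof -
    obtain f where "f < length qs" "v \<in> qs ! f" "\<forall>j<f. v \<notin> qs ! j"
      using finite_first_index[of v qs] UB qs v by auto
    then have "\<exists>b. b \<in> B \<and> (\<exists>f<length qs. b = qs ! f \<and> v \<in> qs ! f \<and> (\<forall>j<f. v \<notin> qs ! j))"
      using qs nth_mem by blast
    from someI_ex[OF this] show ?thesis unfolding h_def .
  qed
  have fh: "finite (h v)" if "v \<in> V" for v
    using h[OF that] sub[of "h v"] fin by (meson finite_subset)
  \<comment> \<open>The empty bag has no vertex to be charged to; it is the \<open>+ 1\<close> of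
    the bound.\<close>
  have "B \<subseteq> insert {} (\<Union>v\<in>V. Pow (h v))"
  proof
    fix b assume b: "b \<in> B"
    show "b \<in> insert {} (\<Union>v\<in>V. Pow (h v))"
    proof (cases "b = {}")
      case False
      obtain i where i: "i < length qs" "qs ! i = b" using b qs by (metis in_set_conv_nth)
      obtain v f where v: "v \<in> b" "f < length qs" "v \<in> qs ! f" "\<forall>j<f. v \<notin> qs ! j" "b \<subseteq> qs ! f"
        using rip_bag_subset[OF rip i(1)] i(2) False finite_subset[OF sub[OF b] fin] by auto
      have vV: "v \<in> V" using v sub b by blast
      obtain f' where f': "h v = qs ! f'" "v \<in> qs ! f'" "\<forall>j<f'. v \<notin> qs ! j" using h[OF vV] by blast
      have "f' = f" using f' v by (metis linorder_neqE_nat)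
      then have "b \<subseteq> h v" using v(5) f'(1) by simp
      then show ?thesis using vV by blast
    qed simp
  qed
  moreover have "finite (insert {} (\<Union>v\<in>V. Pow (h v)))"
    using fin fh by simp
  ultimately have "card B \<le> card (insert {} (\<Union>v\<in>V. Pow (h v)))" by (meson card_mono)
  also have "\<dots> \<le> card (\<Union>v\<in>V. Pow (h v)) + 1" by (cases "finite (\<Union>v\<in>V. Pow (h v))") (auto simp: card_insert_if)
  also have "card (\<Union>v\<in>V. Pow (h v)) \<le> (\<Sum>v\<in>V. card (Pow (h v)))" by (rule card_UN_le[OF fin])
  also have "\<dots> \<le> (\<Sum>v\<in>V. 2 ^ K)"
  proof (rule sum_mono)
    fix v assume "v \<in> V"
    then have "h v \<in> B" "finite (h v)" using h fh by blast+
    then show "card (Pow (h v)) \<le> 2 ^ K"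
      using K[of "h v"] by (simp add: card_Pow power_increasing)
  qed
  finally show ?thesis by simp
qed

text \<open>Both endpoints share a bag, so the one with the earlier topmost bag also lies in the
  topmost bag of the other. Every edge thus occurs in \<open>Sigma V h\<close> in one of its two
  orientations, which explains the factor 2.\<close>

lemma card_edges:
  assumes td: "tree_decomposition V (undirected E) B F" and fin: "finite V" and E: "E \<subseteq> V \<times> V"
    and K: "\<And>b. b \<in> B \<Longrightarrow> card b \<le> K"
  shows "card E \<le> 2 * card V * K"
proof -
  obtain qs where so: "search_order F qs" and qs: "set qs = B" and rip: "rip qs"
    using tree_decomposition_search_order[OF td] by blast
  have sub: "b \<subseteq> V" if "b \<in> B" for b using td that unfolding tree_decomposition_def by blast
  have UB: "\<Union>B = V" using td unfolding tree_decomposition_def by blast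
  have ex: "\<exists>b\<in>B. v \<in> b \<and> (\<exists>f<length qs. b = qs ! f \<and> (\<forall>j<f. v \<notin> qs ! j))" if v: "v \<in> V" for v
    using finite_first_index[of v qs] UB qs v by auto
  define h where "h v = (SOME b. b \<in> B \<and> v \<in> b \<and> (\<exists>f<length qs. b = qs ! f \<and> (\<forall>j<f. v \<notin> qs ! j)))" for v
  have h: "h v \<in> B \<and> v \<in> h v \<and> (\<exists>f<length qs. h v = qs ! f \<and> (\<forall>j<f. v \<notin> qs ! j))" if v: "v \<in> V" for v
    unfolding h_def by (rule someI_ex) (use ex[OF v] in blast)
  have cl: "(u, v) \<in> Sigma V h \<or> (v, u) \<in> Sigma V h" if e: "(u, v) \<in> E" for u v
  proof -
    have V: "u \<in> V" "v \<in> V" using e E by auto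
    obtain fu fv where f: "fu < length qs" "h u = qs ! fu" "\<forall>j<fu. u \<notin> qs ! j"
      "fv < length qs" "h v = qs ! fv" "\<forall>j<fv. v \<notin> qs ! j"
      using h[OF V(1)] h[OF V(2)] by blast
    have "{u, v} \<in> undirected E" unfolding undirected_def using e by blast
    then obtain b where b: "b \<in> B" "u \<in> b" "v \<in> b"
      using td unfolding tree_decomposition_def by (metis insert_subset)
    then obtain i where i: "i < length qs" "qs ! i = b" using qs by (metis in_set_conv_nth)
    show ?thesis
    proof (cases "fu \<le> fv")
      case True
      have "u \<in> qs ! fv"
        by (rule rip_first[OF rip i(1), of u v fu]) (use b i f True h[OF V(1)] h[OF V(2)] in auto)
      then show ?thesis using f V by auto
    next
      case False
      have "v \<in> qs ! fu"
        by (rule rip_first[OF rip i(1), of v u fv]) (use b i f False h[OF V(1)] h[OF V(2)] in auto)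
      then show ?thesis using f V by auto
    qed
  qed
  have fh: "finite (h v)" if "v \<in> V" for v
    using h[OF that] sub[of "h v"] fin by (meson finite_subset)
  have finS: "finite (Sigma V h)" using fin fh by (intro finite_SigmaI)
  have "E \<subseteq> Sigma V h \<union> (Sigma V h)\<inverse>" using cl by auto
  then have "card E \<le> card (Sigma V h \<union> (Sigma V h)\<inverse>)"
    using finS by (intro card_mono) auto
  also have "\<dots> \<le> card (Sigma V h) + card ((Sigma V h)\<inverse>)" by (rule card_Un_le)
  also have "\<dots> = 2 * card (Sigma V h)" by simp
  also have "card (Sigma V h) = (\<Sum>v\<in>V. card (h v))"
    using fin fh by (intro card_SigmaI) auto
  also have "\<dots> \<le> (\<Sum>v\<in>V. K)" by (rule sum_mono) (use h K in blast)
  finally show ?thesis by simp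
qed

section \<open>Vertex elimination\<close>

lemma closed_maximal_reach:
  assumes "almost_sure_closed G s Q" "\<And>Q'. almost_sure_closed G s Q' \<Longrightarrow> Q' \<subseteq> Q"
  shows "almost_sure_reach G s = Q"
  unfolding almost_sure_reach_def
  by (rule the_equality) (use assms in blast)+

definition prob_closed :: "('a \<times> 'a) set \<Rightarrow> 'a set \<Rightarrow> 'a set \<Rightarrow> bool" where
  "prob_closed E Pr Q \<longleftrightarrow> (\<forall>u v. (u, v) \<in> E \<longrightarrow> u \<in> Q \<inter> Pr \<longrightarrow> v \<in> Q)"

text \<open>Removes \<open>v\<close> and bridges the paths through it.\<close>

definition elim :: "'a \<Rightarrow> ('a \<times> 'a) set \<Rightarrow> ('a \<times> 'a) set" where
  "elim v r = {(a, b). a \<noteq> v \<and> b \<noteq> v \<and> ((a, b) \<in> r \<or> (a, v) \<in> r \<and> (v, b) \<in> r)}"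

text \<open>A path that starts in \<open>v\<close> has no counterpart in \<open>elim v r\<close>.
  For such a path the statement keeps the step by which it leaves \<open>v\<close>, so that the
  induction can bridge \<open>v\<close> when one more vertex is put in front.\<close>

lemma elim_rtrancl:
  assumes "(a, b) \<in> r\<^sup>*" "b \<noteq> v"
  shows "if a = v then \<exists>c. c \<noteq> v \<and> (v, c) \<in> r \<and> (c, b) \<in> (elim v r)\<^sup>* else (a, b) \<in> (elim v r)\<^sup>*"
  using assms(1)
proof (induction rule: converse_rtrancl_induct)
  case base
  then show ?case using assms(2) by simp
next
  case (step a c)
  show ?case
  proof (cases "a = v")
    case True
    then show ?thesis using step by (cases "c = v") auto
  next
    case False
    show ?thesis
    proof (cases "c = v")
      case True
      then obtain d where d: "d \<noteq> v" "(v, d) \<in> r" "(d, b) \<in> (elim v r)\<^sup>*" using step by auto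
      then have "(a, d) \<in> elim v r" using False step True unfolding elim_def by auto
      then show ?thesis using False d by (auto intro: converse_rtrancl_into_rtrancl)
    next
      case c: False
      then have "(a, c) \<in> elim v r" using False step unfolding elim_def by auto
      then show ?thesis using False c step by (auto intro: converse_rtrancl_into_rtrancl)
    qed
  qed
qed

text \<open>\<open>X v\<close> collects the neighbours of \<open>v\<close>, in the graph with fill-in edges, that precede \<open>v\<close> in \<open>vs\<close>.\<close>

locale elimination =
  fixes E :: "('a \<times> 'a) set" and Pr :: "'a set" and vs :: "'a list"
    and X :: "'a \<Rightarrow> 'a set" and par :: "'a \<Rightarrow> 'a"
  assumes dist: "distinct vs" and ne: "vs \<noteq> []"
    and X_earlier: "\<And>i. i < length vs \<Longrightarrow> X (vs ! i) \<subseteq> set (take i vs)"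
    and par_in: "\<And>i. i < length vs \<Longrightarrow> 0 < i \<Longrightarrow> par (vs ! i) \<in> X (vs ! i)"
    and par_sub: "\<And>i. i < length vs \<Longrightarrow> 0 < i \<Longrightarrow> X (vs ! i) \<subseteq> insert (par (vs ! i)) (X (par (vs ! i)))"
    and E_sub: "E \<subseteq> set vs \<times> set vs"
    and E_X: "\<And>u v. (u, v) \<in> E \<Longrightarrow> u \<noteq> v \<Longrightarrow> u \<in> X v \<or> v \<in> X u"
begin

definition Xc :: "'a \<Rightarrow> 'a set" where
  "Xc v = insert v (X v)"

definition n :: nat where
  "n = length vs"

definition nxt :: "nat \<Rightarrow> 'a" where
  "nxt d = vs ! (n - 1 - d)"

definition rest :: "nat \<Rightarrow> 'a set" where
  "rest d = set (take (n - d) vs)"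

text \<open>An edge belongs to its later endpoint, so the initial tables share out the edges without
  overlap. Loops belong to no table: they impose no closure condition and do not change
  reachability.\<close>

definition owned :: "'a \<Rightarrow> 'a \<Rightarrow> 'a \<Rightarrow> bool" where
  "owned z u v \<longleftrightarrow> u = z \<and> v \<in> X z \<or> v = z \<and> u \<in> X z"

definition T0 :: "('a \<times> 'a) set \<Rightarrow> 'a \<Rightarrow> 'a set \<Rightarrow> bool \<times> ('a \<times> 'a) set" where
  "T0 F z Y = (\<forall>u v. (u, v) \<in> F \<longrightarrow> owned z u v \<longrightarrow> u \<in> Y \<inter> Pr \<longrightarrow> v \<in> Y,
     {(u, v). (u, v) \<in> F \<and> owned z u v \<and> u \<in> Y \<and> v \<in> Y})"

text \<open>Feasibility with \<open>v\<close> added is not enough: once eliminated, \<open>v\<close>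
  must be known to reach \<open>Y\<close>. A single step suffices as a test, because the relation
  already bridges the eliminated vertices and a path from \<open>v\<close> to \<open>Y\<close> has a
  first step away from \<open>v\<close>.\<close>

definition chosen :: "'a \<Rightarrow> ('a set \<Rightarrow> bool \<times> ('a \<times> 'a) set) \<Rightarrow> 'a set \<Rightarrow> bool" where
  "chosen v T Y \<longleftrightarrow> fst (T (insert v Y)) \<and> (\<exists>c\<in>Y. (v, c) \<in> snd (T (insert v Y)))"

definition msg :: "'a \<Rightarrow> ('a set \<Rightarrow> bool \<times> ('a \<times> 'a) set) \<Rightarrow> 'a set \<Rightarrow> bool \<times> ('a \<times> 'a) set" where
  "msg v T Y = (if chosen v T Y then (True, elim v (snd (T (insert v Y)))) else T Y)"

text \<open>\<open>Tb d z Y\<close>: after \<open>d\<close> eliminations, whether the subset \<open>Y\<close> of the bag of \<open>z\<close> is feasible,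
  and the reachability between its elements through eliminated vertices. Only the edges owned by \<open>z\<close>
  and the messages of eliminated vertices with parent \<open>z\<close> are taken into account.\<close>

fun Tb :: "nat \<Rightarrow> 'a \<Rightarrow> 'a set \<Rightarrow> bool \<times> ('a \<times> 'a) set" where
  "Tb 0 z Y = T0 E z Y"
| "Tb (Suc d) z Y = (let v = nxt d in
     if z = par v then (fst (Tb d z Y) \<and> fst (msg v (Tb d v) (Y \<inter> X v)),
       snd (Tb d z Y) \<union> snd (msg v (Tb d v) (Y \<inter> X v)))
     else Tb d z Y)"

text \<open>\<open>ch\<close>, \<open>val\<close> and \<open>rel\<close> evaluate all tables at once
  on a subset \<open>U\<close> of the remaining vertices. They belong to the proof; the program only
  ever sees the bag of a vertex and that of its parent.\<close>

definition ch :: "nat \<Rightarrow> 'a set \<Rightarrow> bool" where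
  "ch d U \<longleftrightarrow> chosen (nxt d) (Tb d (nxt d)) (U \<inter> X (nxt d))"

definition val :: "nat \<Rightarrow> 'a set \<Rightarrow> bool" where
  "val d U \<longleftrightarrow> (\<forall>z\<in>rest d. fst (Tb d z (U \<inter> Xc z)))"

definition rel :: "nat \<Rightarrow> 'a set \<Rightarrow> ('a \<times> 'a) set" where
  "rel d U = (\<Union>z\<in>rest d. snd (Tb d z (U \<inter> Xc z)))"

text \<open>Replays the decisions in the reverse order of the eliminations. For feasible
  \<open>U\<close> this yields the largest admissible set whose remaining vertices are
  \<open>U\<close>.\<close>

fun expand :: "nat \<Rightarrow> 'a set \<Rightarrow> 'a set" where
  "expand 0 U = U"
| "expand (Suc d) U = expand d (if ch d U then insert (nxt d) U else U)"

lemma n_pos: "0 < n"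
  using ne unfolding n_def by simp

lemma snd_Tb: "snd (Tb d z Y) \<subseteq> Y \<times> Y"
proof (induction d arbitrary: z Y)
  case 0
  then show ?case by (auto simp: T0_def)
next
  case (Suc d)
  let ?v = "nxt d"
  have "snd (msg ?v (Tb d ?v) (Y \<inter> X ?v)) \<subseteq> Y \<times> Y"
    using Suc[of ?v "Y \<inter> X ?v"] Suc[of ?v "insert ?v (Y \<inter> X ?v)"]
    unfolding msg_def elim_def by (auto split: if_splits)
  then show ?case using Suc[of z Y] by (auto simp: Let_def)
qed

lemma rest_Suc:
  assumes "Suc d < n"
  shows "rest d = insert (nxt d) (rest (Suc d))" "nxt d \<notin> rest (Suc d)"
    "X (nxt d) \<subseteq> rest (Suc d)" "par (nxt d) \<in> rest (Suc d)"
    "par (nxt d) \<in> X (nxt d)" "X (nxt d) \<subseteq> Xc (par (nxt d))"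
proof -
  let ?i = "n - 1 - d"
  have i: "?i < length vs" "0 < ?i" "n - d = Suc ?i" "n - Suc d = ?i" using assms unfolding n_def by auto
  show "rest d = insert (nxt d) (rest (Suc d))"
    unfolding rest_def nxt_def i using i(1) by (simp add: take_Suc_conv_app_nth)
  have "distinct (take (Suc ?i) vs)" using dist by simp
  then show "nxt d \<notin> rest (Suc d)"
    unfolding rest_def nxt_def i using i(1) by (simp add: take_Suc_conv_app_nth)
  show X: "X (nxt d) \<subseteq> rest (Suc d)" unfolding rest_def nxt_def i using X_earlier[OF i(1)] .
  show p: "par (nxt d) \<in> X (nxt d)" unfolding nxt_def using par_in[OF i(1,2)] .
  show "par (nxt d) \<in> rest (Suc d)" using p X by blast
  show "X (nxt d) \<subseteq> Xc (par (nxt d))" unfolding nxt_def Xc_def using par_sub[OF i(1,2)] .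
qed

lemma X_rest: "z \<in> rest d \<Longrightarrow> X z \<subseteq> rest d"
proof -
  assume "z \<in> rest d"
  then obtain i where i: "i < n - d" "i < length vs" "vs ! i = z" unfolding rest_def by (auto simp: in_set_conv_nth)
  then have "X z \<subseteq> set (take i vs)" using X_earlier by blast
  also have "\<dots> \<subseteq> rest d" unfolding rest_def using i(1) by (intro set_take_subset_set_take) simp
  finally show ?thesis .
qed

lemma rest_sub: "rest d \<subseteq> set vs"
  unfolding rest_def by (rule set_take_subset)

text \<open>Locality of the tables. The message of \<open>v\<close> depends on \<open>U\<close> only
  through \<open>U \<inter> X v\<close>, which is visible in the bag of \<open>par v\<close>, and no
  other remaining vertex has \<open>v\<close> in its bag. So one local update has the effect of
  eliminating \<open>v\<close> from the global relation.\<close>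

lemma step:
  assumes d: "Suc d < n" and U: "U \<subseteq> rest (Suc d)"
  defines "v \<equiv> nxt d"
  shows "val (Suc d) U \<longleftrightarrow> (if ch d U then val d (insert v U) else val d U)"
    and "rel (Suc d) U = (if ch d U then elim v (rel d (insert v U)) else rel d U)"
    and "ch d U \<longleftrightarrow> fst (Tb d v (insert v U \<inter> Xc v)) \<and> (\<exists>c\<in>U. (v, c) \<in> rel d (insert v U))"
proof -
  note r = rest_Suc[OF d, folded v_def]
  have vU: "v \<notin> U" using r U by blast
  have vX: "v \<notin> X z" if "z \<in> rest (Suc d)" for z using X_rest[OF that] r(2) by blast
  have same: "insert v U \<inter> Xc z = U \<inter> Xc z" if "z \<in> rest (Suc d)" for z
    using vX[OF that] r(2) that unfolding Xc_def by auto
  have self1: "insert v U \<inter> Xc v = insert v (U \<inter> X v)" unfolding Xc_def by auto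
  have self0: "U \<inter> Xc v = U \<inter> X v" unfolding Xc_def using vU by auto
  let ?p = "par v"
  have pz: "(U \<inter> Xc ?p) \<inter> X v = U \<inter> X v" using r by blast
  have T: "Tb (Suc d) z (U \<inter> Xc z) = (if z = ?p then
      (fst (Tb d z (U \<inter> Xc z)) \<and> fst (msg v (Tb d v) (U \<inter> X v)),
       snd (Tb d z (U \<inter> Xc z)) \<union> snd (msg v (Tb d v) (U \<inter> X v)))
     else Tb d z (U \<inter> Xc z))" for z
    using pz unfolding Tb.simps v_def[symmetric] Let_def by auto
  have val: "val (Suc d) U \<longleftrightarrow> (\<forall>z\<in>rest (Suc d). fst (Tb d z (U \<inter> Xc z))) \<and> fst (msg v (Tb d v) (U \<inter> X v))"
    unfolding val_def T using r(4) by (auto split: if_splits)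
  have rel: "rel (Suc d) U = (\<Union>z\<in>rest (Suc d). snd (Tb d z (U \<inter> Xc z))) \<union> snd (msg v (Tb d v) (U \<inter> X v))"
    unfolding rel_def T using r(4) by (auto split: if_splits)
  have reld: "rel d (insert v U) = (\<Union>z\<in>rest (Suc d). snd (Tb d z (U \<inter> Xc z))) \<union> snd (Tb d v (insert v (U \<inter> X v)))"
    unfolding rel_def r(1) using same self1 by auto
  have nov: "(\<Union>z\<in>rest (Suc d). snd (Tb d z (U \<inter> Xc z))) \<subseteq> U \<times> U" using snd_Tb by blast
  show "val (Suc d) U \<longleftrightarrow> (if ch d U then val d (insert v U) else val d U)"
    unfolding val using self0 self1 same r(1)
    by (auto simp: val_def ch_def msg_def chosen_def v_def[symmetric])
  show "rel (Suc d) U = (if ch d U then elim v (rel d (insert v U)) else rel d U)"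
  proof (cases "ch d U")
    case True
    then show ?thesis unfolding rel reld using nov vU unfolding msg_def ch_def v_def[symmetric] elim_def
      by auto
  next
    case False
    then show ?thesis unfolding rel rel_def[of d] r(1) using self0
      by (auto simp: msg_def ch_def v_def[symmetric])
  qed
  have "snd (Tb d v (insert v (U \<inter> X v))) \<subseteq> insert v (U \<inter> X v) \<times> insert v (U \<inter> X v)" by (rule snd_Tb)
  then show "ch d U \<longleftrightarrow> fst (Tb d v (insert v U \<inter> Xc v)) \<and> (\<exists>c\<in>U. (v, c) \<in> rel d (insert v U))"
    unfolding self1 reld ch_def chosen_def v_def[symmetric] using nov vU by blast
qed

definition sound :: "nat \<Rightarrow> 'a set \<Rightarrow> bool" where
  "sound d U \<longleftrightarrow> (let D = expand d U in prob_closed E Pr D \<and> D \<subseteq> set vs \<and> D \<inter> rest d = U \<and>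
     (\<forall>q\<in>D. \<exists>u\<in>U. (q, u) \<in> (E \<inter> D \<times> D)\<^sup>*) \<and> rel d U \<subseteq> (E \<inter> D \<times> D)\<^sup>*)"

lemma owned_ex: "(a, b) \<in> E \<Longrightarrow> a \<noteq> b \<Longrightarrow> \<exists>z\<in>set vs. owned z a b"
  using E_X E_sub unfolding owned_def by blast

lemma owned_Xc: "owned z a b \<Longrightarrow> a \<in> Xc z \<and> b \<in> Xc z"
  unfolding owned_def Xc_def by blast

text \<open>The feasible sets with a fixed intersection with the remaining vertices are closed under union.
  So if adding \<open>v\<close> is possible at all, then adding \<open>v\<close> yields the largest one.\<close>

lemma expand_correct:
  assumes "d < n" "U \<subseteq> rest d"
  shows "val d U \<Longrightarrow> sound d U"
    and "\<And>Q. prob_closed E Pr Q \<Longrightarrow> Q \<subseteq> set vs \<Longrightarrow> Q \<inter> rest d = U \<Longrightarrow>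
      (\<And>q. q \<in> Q \<Longrightarrow> \<exists>u\<in>U. (q, u) \<in> (E \<inter> Q \<times> Q)\<^sup>*) \<Longrightarrow>
      val d U \<and> Q \<subseteq> expand d U \<and> (\<forall>a\<in>U. \<forall>b\<in>U. (a, b) \<in> (E \<inter> Q \<times> Q)\<^sup>* \<longrightarrow> (a, b) \<in> (rel d U)\<^sup>*)"
proof -
  have "(val d U \<longrightarrow> sound d U) \<and> (\<forall>Q. prob_closed E Pr Q \<longrightarrow> Q \<subseteq> set vs \<longrightarrow> Q \<inter> rest d = U \<longrightarrow>
      (\<forall>q\<in>Q. \<exists>u\<in>U. (q, u) \<in> (E \<inter> Q \<times> Q)\<^sup>*) \<longrightarrow>
      val d U \<and> Q \<subseteq> expand d U \<and> (\<forall>a\<in>U. \<forall>b\<in>U. (a, b) \<in> (E \<inter> Q \<times> Q)\<^sup>* \<longrightarrow> (a, b) \<in> (rel d U)\<^sup>*))"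
    using assms
  proof (induction d arbitrary: U)
    case 0
    have r0: "rest 0 = set vs" unfolding rest_def n_def by simp
    have pc: "val 0 U \<longleftrightarrow> prob_closed E Pr U"
    proof
      assume v: "val 0 U"
      show "prob_closed E Pr U" unfolding prob_closed_def
      proof (intro allI impI)
        fix a b assume ab: "(a, b) \<in> E" "a \<in> U \<inter> Pr"
        show "b \<in> U"
        proof (cases "a = b")
          case False
          then obtain z where z: "z \<in> set vs" "owned z a b" using owned_ex ab by blast
          then have "fst (T0 E z (U \<inter> Xc z))" using v unfolding val_def r0 by simp
          then show ?thesis using z ab owned_Xc unfolding T0_def by fastforce
        qed (use ab in auto)
      qed
    next
      assume "prob_closed E Pr U"
      then show "val 0 U" unfolding prob_closed_def val_def using owned_Xc by (fastforce simp: T0_def)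
    qed
    have rel_sub: "rel 0 U \<subseteq> E \<inter> U \<times> U" unfolding rel_def by (auto simp: T0_def)
    have sub_rel: "E \<inter> U \<times> U \<subseteq> rel 0 U \<union> Id"
    proof
      fix x assume x: "x \<in> E \<inter> U \<times> U"
      obtain a b where [simp]: "x = (a, b)" by (cases x)
      show "x \<in> rel 0 U \<union> Id"
      proof (cases "a = b")
        case False
        then obtain z where z: "z \<in> set vs" "owned z a b" using owned_ex x by auto
        then show ?thesis using x owned_Xc[OF z(2)] unfolding rel_def r0 by (auto simp: T0_def)
      qed simp
    qed
    have "(E \<inter> U \<times> U)\<^sup>* \<subseteq> (rel 0 U)\<^sup>*"
      using rtrancl_mono[OF sub_rel] by (metis Un_commute rtrancl_reflcl)
    moreover have "rel 0 U \<subseteq> (E \<inter> U \<times> U)\<^sup>*" using rel_sub by (meson r_into_rtrancl subrelI subsetD)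
    moreover have "U \<inter> set vs = U" using 0 r0 by blast
    moreover have "\<forall>q\<in>U. \<exists>u\<in>U. (q, u) \<in> (E \<inter> U \<times> U)\<^sup>*" by blast
    ultimately have 1: "sound 0 U" if "prob_closed E Pr U"
      unfolding sound_def Let_def expand.simps r0 using that 0 r0 by simp
    have "prob_closed E Pr U \<and> Q \<subseteq> expand 0 U \<and>
        (\<forall>a\<in>U. \<forall>b\<in>U. (a, b) \<in> (E \<inter> Q \<times> Q)\<^sup>* \<longrightarrow> (a, b) \<in> (rel 0 U)\<^sup>*)"
      if "prob_closed E Pr Q" "Q \<subseteq> set vs" "Q \<inter> set vs = U" for Q
    proof -
      have "Q = U" using that by blast
      then show ?thesis using that(1) \<open>(E \<inter> U \<times> U)\<^sup>* \<subseteq> (rel 0 U)\<^sup>*\<close> by auto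
    qed
    then show ?case using 1 unfolding pc r0 by simp
  next
    case (Suc d)
    define v where "v = nxt d"
    note r = rest_Suc[OF Suc.prems(1), folded v_def]
    note st = step[OF Suc.prems, folded v_def]
    have vU: "v \<notin> U" using r Suc.prems by blast
    have d: "d < n" using Suc.prems by simp
    have U0: "U \<subseteq> rest d" and U1: "insert v U \<subseteq> rest d" using Suc.prems r by auto
    note IH0 = Suc.IH[OF d U0]
    note IH1 = Suc.IH[OF d U1]
    have snd: "sound (Suc d) U" if val: "val (Suc d) U"
    proof (cases "ch d U")
      case True
      define D where "D = expand d (insert v U)"
      have s: "prob_closed E Pr D" "D \<subseteq> set vs" "D \<inter> rest d = insert v U"
        "\<forall>q\<in>D. \<exists>u\<in>insert v U. (q, u) \<in> (E \<inter> D \<times> D)\<^sup>*" "rel d (insert v U) \<subseteq> (E \<inter> D \<times> D)\<^sup>*"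
        using IH1 val st(1) True unfolding sound_def D_def Let_def by auto
      obtain c where c: "c \<in> U" "(v, c) \<in> rel d (insert v U)" using st(3) True by blast
      then have vc: "(v, c) \<in> (E \<inter> D \<times> D)\<^sup>*" using s by blast
      have "\<exists>u\<in>U. (q, u) \<in> (E \<inter> D \<times> D)\<^sup>*" if "q \<in> D" for q
        using s(4) that c vc by (metis insert_iff rtrancl_trans)
      moreover have "elim v (rel d (insert v U)) \<subseteq> (E \<inter> D \<times> D)\<^sup>*"
        using s(5) unfolding elim_def by (auto intro: rtrancl_trans)
      moreover have "D \<inter> rest (Suc d) = U" using s(3) r(1,2) Suc.prems(2) by auto
      ultimately show ?thesis using s True st(2) unfolding sound_def Let_def D_def v_def by auto
    next
      case False
      define D where "D = expand d U"
      have s: "prob_closed E Pr D" "D \<subseteq> set vs" "D \<inter> rest d = U"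
        "\<forall>q\<in>D. \<exists>u\<in>U. (q, u) \<in> (E \<inter> D \<times> D)\<^sup>*" "rel d U \<subseteq> (E \<inter> D \<times> D)\<^sup>*"
        using IH0 val st(1) False unfolding sound_def D_def Let_def by auto
      moreover have "D \<inter> rest (Suc d) = U" using s(3) r(1,2) Suc.prems(2) by auto
      ultimately show ?thesis using False st(2) unfolding sound_def Let_def D_def by auto
    qed
    have compl: "val (Suc d) U \<and> Q \<subseteq> expand (Suc d) U \<and>
        (\<forall>a\<in>U. \<forall>b\<in>U. (a, b) \<in> (E \<inter> Q \<times> Q)\<^sup>* \<longrightarrow> (a, b) \<in> (rel (Suc d) U)\<^sup>*)"
      if Q: "prob_closed E Pr Q" "Q \<subseteq> set vs" "Q \<inter> rest (Suc d) = U"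
        "\<forall>q\<in>Q. \<exists>u\<in>U. (q, u) \<in> (E \<inter> Q \<times> Q)\<^sup>*" and vQ: "v \<in> Q" for Q
    proof -
      have QU: "Q \<inter> rest d = insert v U" using Q(3) vQ r(1) by auto
      have h: "val d (insert v U)" "Q \<subseteq> expand d (insert v U)"
        "\<forall>a\<in>insert v U. \<forall>b\<in>insert v U. (a, b) \<in> (E \<inter> Q \<times> Q)\<^sup>* \<longrightarrow> (a, b) \<in> (rel d (insert v U))\<^sup>*"
        using mp[OF mp[OF mp[OF mp[OF spec[OF conjunct2[OF IH1], of Q] Q(1)] Q(2)] QU]] Q(4) by blast+
      \<comment> \<open>Within \<open>Q\<close> there is a path from \<open>v\<close> to
        \<open>U\<close>. By the induction hypothesis it is reflected in \<open>rel\<close>, and its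
        first step away from \<open>v\<close> is what \<open>chosen\<close> asks for.\<close>
      obtain u where u: "u \<in> U" "(v, u) \<in> (E \<inter> Q \<times> Q)\<^sup>*" using Q(4) vQ by blast
      then have "(v, u) \<in> (rel d (insert v U))\<^sup>*" using h(3) by blast
      then obtain c where c: "c \<noteq> v" "(v, c) \<in> rel d (insert v U)"
        using elim_rtrancl[of v u "rel d (insert v U)" v] u(1) vU by auto
      moreover have "rel d (insert v U) \<subseteq> insert v U \<times> insert v U"
        unfolding rel_def using snd_Tb by blast
      ultimately have "c \<in> U" by blast
      moreover have "fst (Tb d v (insert v U \<inter> Xc v))"
        using h(1) r(1) unfolding val_def by blast
      ultimately have ch: "ch d U" using st(3) c by blast
      have "(a, b) \<in> (rel (Suc d) U)\<^sup>*" if "a \<in> U" "b \<in> U" "(a, b) \<in> (E \<inter> Q \<times> Q)\<^sup>*" for a b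
      proof -
        have "(a, b) \<in> (rel d (insert v U))\<^sup>*" "a \<noteq> v" "b \<noteq> v" using h(3) that vU by blast+
        then show ?thesis using elim_rtrancl[of a b "rel d (insert v U)" v] ch st(2) by simp
      qed
      then show ?thesis using h st(1) ch v_def by auto
    qed
    have compl2: "val (Suc d) U \<and> Q \<subseteq> expand (Suc d) U \<and>
        (\<forall>a\<in>U. \<forall>b\<in>U. (a, b) \<in> (E \<inter> Q \<times> Q)\<^sup>* \<longrightarrow> (a, b) \<in> (rel (Suc d) U)\<^sup>*)"
      if Q: "prob_closed E Pr Q" "Q \<subseteq> set vs" "Q \<inter> rest (Suc d) = U"
        "\<forall>q\<in>Q. \<exists>u\<in>U. (q, u) \<in> (E \<inter> Q \<times> Q)\<^sup>*" and vQ: "v \<notin> Q" for Q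
    proof -
      have QU: "Q \<inter> rest d = U" using Q(3) vQ r(1) by auto
      have h: "val d U" "Q \<subseteq> expand d U"
        "\<forall>a\<in>U. \<forall>b\<in>U. (a, b) \<in> (E \<inter> Q \<times> Q)\<^sup>* \<longrightarrow> (a, b) \<in> (rel d U)\<^sup>*"
        using mp[OF mp[OF mp[OF mp[OF spec[OF conjunct2[OF IH0], of Q] Q(1)] Q(2)] QU] Q(4)] by blast+
      show ?thesis
      proof (cases "ch d U")
        case False
        then show ?thesis using h st(1,2) by auto
      next
        case True
        \<comment> \<open>Adding \<open>v\<close> can affect only the table of \<open>v\<close>
          itself, as the bags of the other remaining vertices do not contain it.\<close>
        have "fst (Tb d z (insert v U \<inter> Xc z))" if "z \<in> rest d" for z
        proof (cases "z = v")
          case False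
          then have z: "z \<in> rest (Suc d)" using that r(1) by blast
          have "v \<notin> Xc z" using X_rest[OF z] r(2) False unfolding Xc_def by blast
          then have "insert v U \<inter> Xc z = U \<inter> Xc z" by blast
          then show ?thesis using h(1) that unfolding val_def by simp
        qed (use st(3) True in blast)
        then have val: "val (Suc d) U" using st(1) True unfolding val_def by simp
        define D where "D = expand (Suc d) U"
        have s: "prob_closed E Pr D" "D \<subseteq> set vs" "D \<inter> rest (Suc d) = U"
          "\<forall>q\<in>D. \<exists>u\<in>U. (q, u) \<in> (E \<inter> D \<times> D)\<^sup>*"
          using snd[OF val] unfolding sound_def D_def Let_def by auto
        have "sound d (insert v U)" using IH1 val st(1) True by simp
        then have vD: "v \<in> D" using True unfolding sound_def D_def v_def by (auto simp: Let_def)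
        \<comment> \<open>\<open>Q\<close> omits \<open>v\<close> although \<open>v\<close> is
          chosen. The union of \<open>Q\<close> with the constructed set contains \<open>v\<close>
          and is still admissible, so the case already settled applies to it, and what holds for the
          union is inherited by \<open>Q\<close>.\<close>
        define W where "W = Q \<union> D"
        have m: "(E \<inter> Q \<times> Q)\<^sup>* \<subseteq> (E \<inter> W \<times> W)\<^sup>*" "(E \<inter> D \<times> D)\<^sup>* \<subseteq> (E \<inter> W \<times> W)\<^sup>*"
          unfolding W_def by (auto intro!: rtrancl_mono)
        have "val (Suc d) U \<and> W \<subseteq> expand (Suc d) U \<and>
            (\<forall>a\<in>U. \<forall>b\<in>U. (a, b) \<in> (E \<inter> W \<times> W)\<^sup>* \<longrightarrow> (a, b) \<in> (rel (Suc d) U)\<^sup>*)"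
        proof (rule compl)
          show "prob_closed E Pr W" using Q(1) s(1) unfolding prob_closed_def W_def by blast
          show "\<forall>q\<in>W. \<exists>u\<in>U. (q, u) \<in> (E \<inter> W \<times> W)\<^sup>*" using Q(4) s(4) m unfolding W_def by blast
        qed (use Q s vD in \<open>auto simp: W_def\<close>)
        then show ?thesis using m unfolding W_def by blast
      qed
    qed
    show ?case using snd compl compl2 by blast
  qed
  then show "val d U \<Longrightarrow> sound d U"
    and "\<And>Q. prob_closed E Pr Q \<Longrightarrow> Q \<subseteq> set vs \<Longrightarrow> Q \<inter> rest d = U \<Longrightarrow>
      (\<And>q. q \<in> Q \<Longrightarrow> \<exists>u\<in>U. (q, u) \<in> (E \<inter> Q \<times> Q)\<^sup>*) \<Longrightarrow>
      val d U \<and> Q \<subseteq> expand d U \<and> (\<forall>a\<in>U. \<forall>b\<in>U. (a, b) \<in> (E \<inter> Q \<times> Q)\<^sup>* \<longrightarrow> (a, b) \<in> (rel d U)\<^sup>*)"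
    by blast+
qed

text \<open>After \<open>n - 1\<close> eliminations only \<open>s\<close> remains, and every
  nonempty closed set contains \<open>s\<close>. If \<open>{s}\<close> is infeasible, the empty set
  is the only closed set and therefore the largest.\<close>

theorem almost_sure_reach_eq:
  assumes G: "edges G = E" "verts G = set vs" "prob G = Pr"
  shows "almost_sure_reach G (hd vs) =
    (if fst (Tb (n - 1) (hd vs) {hd vs}) then expand (n - 1) {hd vs} else {})"
proof -
  let ?s = "hd vs" and ?d = "n - 1"
  have r: "rest ?d = {?s}" using ne unfolding rest_def n_def by (cases vs) auto
  have X0: "X ?s = {}" using X_earlier[of 0] ne by (simp add: hd_conv_nth)
  have val: "val ?d {?s} \<longleftrightarrow> fst (Tb ?d ?s {?s})" unfolding val_def r Xc_def X0 by simp
  have d: "?d < n" using n_pos by simp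
  note ec = expand_correct[OF d, of "{?s}", unfolded r, OF subset_refl]
  have max: "val ?d {?s} \<and> Q \<subseteq> expand ?d {?s}" if Q: "almost_sure_closed G ?s Q" "Q \<noteq> {}" for Q
  proof -
    have "?s \<in> Q" using Q unfolding almost_sure_closed_def by blast
    then show ?thesis using ec(2)[of Q] Q G
      unfolding almost_sure_closed_def prob_closed_def by blast
  qed
  show ?thesis
  proof (cases "val ?d {?s}")
    case True
    have "almost_sure_closed G ?s (expand ?d {?s})"
      using ec(1)[OF True] unfolding sound_def Let_def almost_sure_closed_def prob_closed_def G r by blast
    then show ?thesis using closed_maximal_reach[of G ?s "expand ?d {?s}"] max True val by auto
  next
    case False
    have "almost_sure_closed G ?s {}" unfolding almost_sure_closed_def by blast
    then show ?thesis using closed_maximal_reach[of G ?s "{}"] max False val by auto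
  qed
qed

end

section \<open>A structured language with arrays\<close>

datatype aexp = N nat | V nat | Ld nat aexp | Bin binop aexp aexp

datatype stm =
    Asg nat aexp  (infix "::=" 62)
  | Sto nat aexp aexp
  | Sq stm stm  (infixr ";;" 60)
  | Cond aexp stm stm
  | Loop aexp stm

type_synonym regs = "nat \<Rightarrow> nat"
type_synonym arrs = "nat \<Rightarrow> nat \<Rightarrow> nat"

fun ev :: "aexp \<Rightarrow> regs \<Rightarrow> arrs \<Rightarrow> nat" where
  "ev (N a) R A = a"
| "ev (V x) R A = R x"
| "ev (Ld c e) R A = A c (ev e R A)"
| "ev (Bin f a b) R A = eval_binop f (ev a R A) (ev b R A)"

text \<open>Only these operations can leave the range of \<open>wd\<close>-bit words.\<close>

fun may_grow :: "binop \<Rightarrow> bool" where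
  "may_grow Add = True"
| "may_grow Mul = True"
| "may_grow Shl = True"
| "may_grow Sub = False"
| "may_grow Div = False"
| "may_grow Mod = False"
| "may_grow And = False"
| "may_grow Or = False"
| "may_grow Xor = False"
| "may_grow Shr = False"
| "may_grow Less = False"
| "may_grow Equal = False"

text \<open>Below, expressions must not overflow, and array 0 (the input) may only be accessed below \<open>L\<close>.
  Each statement and each test counts as one step.\<close>

locale machine =
  fixes wd L :: nat
  assumes wd_pos: "0 < wd"
begin

fun ok :: "aexp \<Rightarrow> regs \<Rightarrow> arrs \<Rightarrow> bool" where
  "ok (N a) R A \<longleftrightarrow> a < 2 ^ wd"
| "ok (V x) R A \<longleftrightarrow> True"
| "ok (Ld c e) R A \<longleftrightarrow> ok e R A \<and> (c = 0 \<longrightarrow> ev e R A < L)"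
| "ok (Bin f a b) R A \<longleftrightarrow> ok a R A \<and> ok b R A \<and>
     (may_grow f \<longrightarrow> eval_binop f (ev a R A) (ev b R A) < 2 ^ wd)"

inductive run :: "stm \<Rightarrow> regs \<Rightarrow> arrs \<Rightarrow> nat \<Rightarrow> regs \<Rightarrow> arrs \<Rightarrow> bool" where
  Asg: "ok e R A \<Longrightarrow> run (x ::= e) R A 1 (R(x := ev e R A)) A"
| Sto: "ok e R A \<Longrightarrow> ok f R A \<Longrightarrow> (c = 0 \<longrightarrow> ev e R A < L) \<Longrightarrow>
    run (Sto c e f) R A 1 R (A(c := (A c)(ev e R A := ev f R A)))"
| Sq: "run c1 R A t1 R1 A1 \<Longrightarrow> run c2 R1 A1 t2 R2 A2 \<Longrightarrow> run (c1 ;; c2) R A (t1 + t2) R2 A2"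
| CondT: "ok e R A \<Longrightarrow> ev e R A \<noteq> 0 \<Longrightarrow> run c1 R A t R1 A1 \<Longrightarrow> run (Cond e c1 c2) R A (1 + t) R1 A1"
| CondF: "ok e R A \<Longrightarrow> ev e R A = 0 \<Longrightarrow> run c2 R A t R1 A1 \<Longrightarrow> run (Cond e c1 c2) R A (1 + t) R1 A1"
| LoopT: "ok e R A \<Longrightarrow> ev e R A \<noteq> 0 \<Longrightarrow> run c R A t1 R1 A1 \<Longrightarrow> run (Loop e c) R1 A1 t2 R2 A2 \<Longrightarrow>
    run (Loop e c) R A (1 + t1 + t2) R2 A2"
| LoopF: "ok e R A \<Longrightarrow> ev e R A = 0 \<Longrightarrow> run (Loop e c) R A 1 R A"

text \<open>Total correctness with the running time as an argument of the postcondition; the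
  existence of a run includes termination and the absence of overflow.\<close>

definition wp :: "stm \<Rightarrow> (nat \<Rightarrow> regs \<Rightarrow> arrs \<Rightarrow> bool) \<Rightarrow> regs \<Rightarrow> arrs \<Rightarrow> bool" where
  "wp c Q R A \<longleftrightarrow> (\<exists>t R' A'. run c R A t R' A' \<and> Q t R' A')"

lemma wp_Asg [simp]: "wp (x ::= e) Q R A \<longleftrightarrow> ok e R A \<and> Q 1 (R(x := ev e R A)) A"
  unfolding wp_def by (auto elim: run.cases intro!: exI intro: run.Asg simp del: One_nat_def)

lemma wp_Sto [simp]:
  "wp (Sto c e f) Q R A \<longleftrightarrow> ok e R A \<and> ok f R A \<and> (c = 0 \<longrightarrow> ev e R A < L) \<and>
     Q 1 R (A(c := (A c)(ev e R A := ev f R A)))"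
proof -
  have "run (Sto c e f) R A t R' A' \<longleftrightarrow> ok e R A \<and> ok f R A \<and> (c = 0 \<longrightarrow> ev e R A < L) \<and>
     t = 1 \<and> R' = R \<and> A' = A(c := (A c)(ev e R A := ev f R A))" for t R' A'
    using run.Sto[of e R A f c] by (auto elim: run.cases)
  then show ?thesis unfolding wp_def by auto
qed

lemma wp_Sq [simp]:
  "wp (c1 ;; c2) Q R A \<longleftrightarrow> wp c1 (\<lambda>t1. wp c2 (\<lambda>t2. Q (t1 + t2))) R A"
  unfolding wp_def
  by (auto elim!: run.cases[of "c1 ;; c2"] intro: run.intros) (metis run.Sq)

lemma wp_Cond [simp]:
  "wp (Cond e c1 c2) Q R A \<longleftrightarrow> ok e R A \<and>
     (if ev e R A \<noteq> 0 then wp c1 (\<lambda>t. Q (1 + t)) R A else wp c2 (\<lambda>t. Q (1 + t)) R A)"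
proof (cases "ev e R A = 0")
  case True
  have "run (Cond e c1 c2) R A t R' A' \<longleftrightarrow> ok e R A \<and> (\<exists>u. t = 1 + u \<and> run c2 R A u R' A')" for t R' A'
    using True by (auto elim: run.cases intro: run.CondF simp del: One_nat_def plus_1_eq_Suc)
  then show ?thesis using True unfolding wp_def by auto
next
  case False
  have "run (Cond e c1 c2) R A t R' A' \<longleftrightarrow> ok e R A \<and> (\<exists>u. t = 1 + u \<and> run c1 R A u R' A')" for t R' A'
    using False by (auto elim: run.cases intro: run.CondT simp del: One_nat_def plus_1_eq_Suc)
  then show ?thesis using False unfolding wp_def by auto
qed

lemma wp_mono:
  "wp c Q R A \<Longrightarrow> (\<And>t R' A'. Q t R' A' \<Longrightarrow> Q' t R' A') \<Longrightarrow> wp c Q' R A"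
  unfolding wp_def by blast

text \<open>Amortised analysis: the potential pays for every iteration including its test, so it
  proves termination and bounds the time in one go. The extra 1 is the final failing test.\<close>

lemma wp_Loop:
  fixes \<Phi> :: "regs \<Rightarrow> arrs \<Rightarrow> nat"
  assumes "I R A" "\<And>R A. I R A \<Longrightarrow> ok e R A"
    and step: "\<And>R A. I R A \<Longrightarrow> ev e R A \<noteq> 0 \<Longrightarrow>
      wp c (\<lambda>t R' A'. I R' A' \<and> t + 1 + \<Phi> R' A' \<le> \<Phi> R A) R A"
  shows "wp (Loop e c) (\<lambda>t R' A'. I R' A' \<and> ev e R' A' = 0 \<and> t + \<Phi> R' A' \<le> \<Phi> R A + 1) R A"
  using assms(1)
proof (induction "\<Phi> R A" arbitrary: R A rule: less_induct)
  case less
  show ?case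
  proof (cases "ev e R A = 0")
    case True
    have "run (Loop e c) R A 1 R A" using True assms(2)[OF less.prems] by (intro run.LoopF)
    then show ?thesis unfolding wp_def using True less.prems
      by (intro exI[of _ 1] exI[of _ R] exI[of _ A]) auto
  next
    case False
    obtain t R1 A1 where 1: "run c R A t R1 A1" "I R1 A1" "t + 1 + \<Phi> R1 A1 \<le> \<Phi> R A"
      using step[OF less.prems False] unfolding wp_def by blast
    obtain t2 R2 A2 where 2: "run (Loop e c) R1 A1 t2 R2 A2" "I R2 A2" "ev e R2 A2 = 0"
      "t2 + \<Phi> R2 A2 \<le> \<Phi> R1 A1 + 1"
      using less.hyps[of R1 A1] 1 unfolding wp_def by fastforce
    have "run (Loop e c) R A (1 + t + t2) R2 A2"
      using run.LoopT[OF assms(2)[OF less.prems] False 1(1) 2(1)] .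
    then show ?thesis unfolding wp_def using 1 2
      by (intro exI[of _ "1 + t + t2"] exI[of _ R2] exI[of _ A2]) auto
  qed
qed

end

fun wr :: "stm \<Rightarrow> nat set" where
  "wr (x ::= e) = {x}"
| "wr (Sto c e f) = {}"
| "wr (c1 ;; c2) = wr c1 \<union> wr c2"
| "wr (Cond e c1 c2) = wr c1 \<union> wr c2"
| "wr (Loop e c) = wr c"

fun wa :: "stm \<Rightarrow> nat set" where
  "wa (x ::= e) = {}"
| "wa (Sto c e f) = {c}"
| "wa (c1 ;; c2) = wa c1 \<union> wa c2"
| "wa (Cond e c1 c2) = wa c1 \<union> wa c2"
| "wa (Loop e c) = wa c"

text \<open>Frame condition read off the syntax. Arrays are framed as a whole, not cell by
  cell.\<close>

definition agree :: "stm \<Rightarrow> regs \<Rightarrow> arrs \<Rightarrow> regs \<Rightarrow> arrs \<Rightarrow> bool" where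
  "agree c R A R' A' \<longleftrightarrow> (\<forall>x. x \<notin> wr c \<longrightarrow> R' x = R x) \<and> (\<forall>a. a \<notin> wa c \<longrightarrow> A' a = A a)"

lemma agree_R: "agree c R A R' A' \<Longrightarrow> x \<notin> wr c \<Longrightarrow> R' x = R x"
  and agree_A: "agree c R A R' A' \<Longrightarrow> a \<notin> wa c \<Longrightarrow> A' a = A a"
  unfolding agree_def by auto

definition For :: "nat \<Rightarrow> nat \<Rightarrow> stm \<Rightarrow> stm" where
  "For x y c = (x ::= N 0 ;; Loop (Bin Less (V x) (V y)) (c ;; x ::= Bin Add (V x) (N 1)))"

lemma wr_For [simp]: "wr (For x y c) = insert x (wr c)"
  and wa_For [simp]: "wa (For x y c) = wa c"
  by (auto simp: For_def)

context machine
begin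

lemma run_agree: "run c R A t R' A' \<Longrightarrow> agree c R A R' A'"
  by (induction rule: run.induct) (auto simp: agree_def)

lemma wp_agree:
  "wp c Q R A \<Longrightarrow> wp c (\<lambda>t R' A'. Q t R' A' \<and> agree c R A R' A') R A"
  unfolding wp_def using run_agree by blast

lemma wp_agree_mono:
  "wp c Q R A \<Longrightarrow> (\<And>t R' A'. Q t R' A' \<Longrightarrow> agree c R A R' A' \<Longrightarrow> Q' t R' A') \<Longrightarrow> wp c Q' R A"
  using wp_agree wp_mono by blast

text \<open>Each round costs at most \<open>T\<close> for the body, plus the increment and the test.
  The body receives the frame condition for free, so invariants need to describe only what
  changes.\<close>

lemma wp_For:
  assumes n: "R y = n" "n < 2 ^ wd"
    and xy: "x \<noteq> y" "x \<notin> wr c" "y \<notin> wr c"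
    and I0: "I 0 (R(x := 0)) A"
    and step: "\<And>j R' A'. j < n \<Longrightarrow> I j R' A' \<Longrightarrow> agree (For x y c) R A R' A' \<Longrightarrow> R' x = j \<Longrightarrow>
      wp c (\<lambda>t R2 A2. t \<le> T \<and> (agree c R' A' R2 A2 \<longrightarrow> I (Suc j) (R2(x := Suc j)) A2)) R' A'"
  shows "wp (For x y c) (\<lambda>t R' A'. t \<le> n * (T + 2) + 2 \<and> I n R' A' \<and>
    agree (For x y c) R A R' A' \<and> R' x = n) R A"
proof -
  let ?I = "\<lambda>R' A'. R' x \<le> n \<and> I (R' x) R' A' \<and> agree (For x y c) R A R' A'"
  let ?\<Phi> = "\<lambda>R' A'. (n - R' x) * (T + 2)"
  have y: "R' y = n" if "agree (For x y c) R A R' A'" for R' A'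
    using agree_R[OF that, of y] n xy by simp
  have "wp (Loop (Bin Less (V x) (V y)) (c ;; x ::= Bin Add (V x) (N 1)))
     (\<lambda>t R' A'. ?I R' A' \<and> ev (Bin Less (V x) (V y)) R' A' = 0 \<and>
        t + ?\<Phi> R' A' \<le> ?\<Phi> (R(x := 0)) A + 1) (R(x := 0)) A"
  proof (rule wp_Loop, goal_cases)
    case 1
    have "agree (For x y c) R A (R(x := 0)) A" by (simp add: agree_def)
    then show ?case using I0 by (simp del: fun_upd_apply add: fun_upd_same)
  next
    case (2 R A)
    then show ?case by simp
  next
    case (3 R' A')
    then have a: "agree (For x y c) R A R' A'" and I: "I (R' x) R' A'" and lt: "R' x < n"
      using y by (auto split: if_splits)
    show ?case
      unfolding wp_Sq
    proof (rule wp_agree_mono[OF step[OF lt I a refl]], goal_cases)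
      case (1 t R2 A2)
      have x2: "R2 x = R' x" using agree_R[OF 1(2)] xy by blast
      have a2: "agree (For x y c) R A (R2(x := Suc (R' x))) A2"
        using a 1(2) unfolding agree_def by simp
      have p: "(1::nat) < 2 ^ wd" using wd_pos by (intro one_less_power) auto
      obtain d where d: "n = Suc (R' x + d)" using less_imp_Suc_add[OF lt] by auto
      show ?case using 1 x2 a2 lt p \<open>n < 2 ^ wd\<close> d by simp
    qed
  qed
  then have "wp (Loop (Bin Less (V x) (V y)) (c ;; x ::= Bin Add (V x) (N 1)))
     (\<lambda>t R' A'. 1 + t \<le> n * (T + 2) + 2 \<and> I n R' A' \<and>
    agree (For x y c) R A R' A' \<and> R' x = n) (R(x := 0)) A"
  proof (rule wp_mono, goal_cases)
    case (1 t R' A')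
    then have "R' x = n" using y by (auto split: if_splits)
    then show ?case using 1 by auto
  qed
  then show ?thesis unfolding For_def by simp
qed

end

text \<open>Register 98 holds \<open>L\<close>; registers from 99 on are the evaluation stack. Array 0 is the memory
  below \<open>L\<close>, and entry \<open>i\<close> of array \<open>c\<close> with \<open>0 < c < 32\<close> is at address \<open>L + 32 * i + c\<close>.\<close>

definition caddr :: "nat \<Rightarrow> nat \<Rightarrow> com" where
  "caddr c t = (if c = 0 then Op Or t t t else
     Seq (Const (Suc t) 32) (Seq (Op Mul t t (Suc t)) (Seq (Const (Suc t) c)
       (Seq (Op Add t t (Suc t)) (Op Add t t 98)))))"

fun cexp :: "aexp \<Rightarrow> nat \<Rightarrow> com" where
  "cexp (N a) t = Const t a"
| "cexp (V x) t = Op Or t x x"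
| "cexp (Ld c e) t = Seq (cexp e t) (Seq (caddr c t) (Load t t))"
| "cexp (Bin f a b) t = Seq (cexp a t) (Seq (cexp b (Suc t)) (Op f t t (Suc t)))"

fun wfe :: "aexp \<Rightarrow> bool" where
  "wfe (N a) = True"
| "wfe (V x) \<longleftrightarrow> x < 98"
| "wfe (Ld c e) \<longleftrightarrow> c < 32 \<and> wfe e"
| "wfe (Bin f a b) \<longleftrightarrow> wfe a \<and> wfe b"

fun ecost :: "aexp \<Rightarrow> nat" where
  "ecost (N a) = 1"
| "ecost (V x) = 1"
| "ecost (Ld c e) = ecost e + 6"
| "ecost (Bin f a b) = ecost a + ecost b + 1"

fun cstm :: "stm \<Rightarrow> com" where
  "cstm (x ::= e) = Seq (cexp e 99) (Op Or x 99 99)"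
| "cstm (Sto c e f) = Seq (cexp e 99) (Seq (caddr c 99) (Seq (cexp f 100) (Store 99 100)))"
| "cstm (c1 ;; c2) = Seq (cstm c1) (cstm c2)"
| "cstm (Cond e c1 c2) = Seq (cexp e 99) (IfNZ 99 (cstm c1) (cstm c2))"
| "cstm (Loop e c) = Seq (cexp e 99) (WhileNZ 99 (Seq (cstm c) (cexp e 99)))"

fun wfs :: "stm \<Rightarrow> bool" where
  "wfs (x ::= e) \<longleftrightarrow> x < 98 \<and> wfe e"
| "wfs (Sto c e f) \<longleftrightarrow> c < 32 \<and> wfe e \<and> wfe f"
| "wfs (c1 ;; c2) \<longleftrightarrow> wfs c1 \<and> wfs c2"
| "wfs (Cond e c1 c2) \<longleftrightarrow> wfe e \<and> wfs c1 \<and> wfs c2"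
| "wfs (Loop e c) \<longleftrightarrow> wfe e \<and> wfs c"

text \<open>Machine steps per source step, hence a maximum over the parts and not a sum:
  \<open>t\<close> source steps compile to at most \<open>scost c * t\<close> machine steps.\<close>

fun scost :: "stm \<Rightarrow> nat" where
  "scost (x ::= e) = ecost e + 1"
| "scost (Sto c e f) = ecost e + ecost f + 6"
| "scost (c1 ;; c2) = max (scost c1) (scost c2)"
| "scost (Cond e c1 c2) = max (ecost e + 1) (max (scost c1) (scost c2))"
| "scost (Loop e c) = max (ecost e + 1) (scost c)"

lemma or_less_nat: "a < 2 ^ w \<Longrightarrow> b < 2 ^ w \<Longrightarrow> Bit_Operations.or a b < (2::nat) ^ w"
  and xor_less_nat: "a < 2 ^ w \<Longrightarrow> b < 2 ^ w \<Longrightarrow> Bit_Operations.xor a b < (2::nat) ^ w"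
  and and_less_nat: "a < 2 ^ w \<Longrightarrow> Bit_Operations.and a b < (2::nat) ^ w"
  for a b w :: nat
  by (metis take_bit_nat_eq_self take_bit_nat_less_exp take_bit_or,
      metis take_bit_nat_eq_self take_bit_nat_less_exp take_bit_xor,
      metis and.right_idem take_bit_and take_bit_eq_mask and.left_commute and.commute
        take_bit_nat_eq_self take_bit_nat_less_exp)

lemma eval_binop_bound:
  assumes "a < 2 ^ w" "b < 2 ^ w" "\<not> may_grow f" "0 < w"
  shows "eval_binop f a b < 2 ^ w"
proof -
  have "1 < (2::nat) ^ w" using assms(4) by (intro one_less_power) auto
  moreover have "a div b < 2 ^ w" "a mod b < 2 ^ w" "drop_bit b a < 2 ^ w"
    using assms(1) by (auto simp: drop_bit_eq_div intro: le_less_trans[OF div_le_dividend]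
        le_less_trans[OF mod_less_eq_dividend])
  ultimately show ?thesis
    using assms by (cases f) (auto simp: or_less_nat xor_less_nat and_less_nat)
qed

text \<open>Values of the source program have \<open>wd\<close> bits. As an address, an index needs
  five more bits to select one of 32 arrays, and the sixth absorbs the offset \<open>L\<close>, so
  addresses are never truncated.\<close>

locale sim_machine = machine +
  fixes w :: nat
  assumes w: "w = wd + 6" and L: "L \<le> 2 ^ wd"
begin

definition sim :: "regs \<Rightarrow> arrs \<Rightarrow> regs \<Rightarrow> (nat \<Rightarrow> nat) \<Rightarrow> bool" where
  "sim R A R' M \<longleftrightarrow> (\<forall>x<98. R' x = R x \<and> R x < 2 ^ wd) \<and> R' 98 = L \<and> (\<forall>i<L. M i = A 0 i) \<and>
     (\<forall>c i. 0 < c \<longrightarrow> c < 32 \<longrightarrow> M (L + 32 * i + c) = A c i) \<and> (\<forall>c<32. \<forall>i. A c i < 2 ^ wd)"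

lemma ev_bound:
  assumes "sim R A R' M" "wfe e" "ok e R A"
  shows "ev e R A < 2 ^ wd"
  using assms(2,3)
proof (induction e)
  case (Bin f a b)
  then show ?case using eval_binop_bound wd_pos by auto
qed (use assms(1) in \<open>auto simp: sim_def\<close>)

lemma small_le: "(a::nat) < 2 ^ wd \<Longrightarrow> take_bit w a = a"
  using w by (intro take_bit_nat_eq_self) (auto simp: power_add)

lemma addr_less: "i < 2 ^ wd \<Longrightarrow> c < 32 \<Longrightarrow> L + 32 * i + c < 2 ^ w"
  using w L by (auto simp: power_add)

definition addr :: "nat \<Rightarrow> nat \<Rightarrow> nat" where
  "addr c i = (if c = 0 then i else L + 32 * i + c)"

lemma sim_upd:
  assumes "sim R A R' M" "\<forall>x\<le>98. R'' x = R' x"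
  shows "sim R A R'' M"
  using assms unfolding sim_def by auto

lemma exec_caddr:
  assumes "R' 98 = L" "R' t = i" "i < 2 ^ wd" "c < 32" "98 < t"
  shows "\<exists>R'' t'. exec w (caddr c t) (R', M) t' (R'', M) \<and> t' \<le> 5 \<and> R'' t = addr c i \<and> (\<forall>x<t. R'' x = R' x)"
proof (cases "c = 0")
  case True
  have "exec w (Op Or t t t) (R', M) 1 (R'(t := i), M)"
    using exec.Op[of w Or t t t R' M] assms(2) small_le[OF assms(3)] by simp
  moreover have "(R'(t := i)) t = i" "\<forall>x<t. (R'(t := i)) x = R' x" by auto
  moreover have "(1::nat) \<le> 5" by simp
  ultimately show ?thesis unfolding caddr_def addr_def if_P[OF True] by blast
next
  case False
  have b: "L + 32 * i + c < 2 ^ w" by (rule addr_less) fact+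
  then have b': "take_bit w (i * 32) = i * 32" "take_bit w 32 = (32::nat)" "take_bit w c = c"
    "take_bit w (i * 32 + c) = i * 32 + c" "take_bit w (i * 32 + c + L) = i * 32 + c + L"
    using assms(4) wd_pos w by (auto intro!: take_bit_nat_eq_self simp: power_add
      intro: less_le_trans[of 32 64])
  have p: "x = y \<Longrightarrow> exec w cc \<sigma> tt x \<Longrightarrow> exec w cc \<sigma> tt y" for cc \<sigma> tt x y by simp
  let ?R1 = "R'(Suc t := 32)" let ?R2 = "?R1(t := i * 32)" let ?R3 = "?R2(Suc t := c)"
  let ?R4 = "?R3(t := i * 32 + c)" let ?R5 = "?R4(t := i * 32 + c + L)"
  have "exec w (Const (Suc t) 32) (R', M) 1 (?R1, M)"
    using exec.Const[of w "Suc t" 32 R' M] b' by simp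
  moreover have "exec w (Op Mul t t (Suc t)) (?R1, M) 1 (?R2, M)"
    using exec.Op[of w Mul t t "Suc t" ?R1 M] b' assms by simp
  moreover have "exec w (Const (Suc t) c) (?R2, M) 1 (?R3, M)"
    using exec.Const[of w "Suc t" c ?R2 M] b' by simp
  moreover have "exec w (Op Add t t (Suc t)) (?R3, M) 1 (?R4, M)"
    using exec.Op[of w Add t t "Suc t" ?R3 M] b' assms by simp
  moreover have "exec w (Op Add t t 98) (?R4, M) 1 (?R5, M)"
    using exec.Op[of w Add t t 98 ?R4 M] b' assms by simp
  ultimately have "exec w (caddr c t) (R', M) (1 + (1 + (1 + (1 + 1)))) (?R5, M)"
    unfolding caddr_def if_not_P[OF False] by (intro exec.Seq)
  moreover have "?R5 t = addr c i" "\<forall>x<t. ?R5 x = R' x"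
    using False assms(5) unfolding addr_def by auto
  moreover have "(1 + (1 + (1 + (1 + 1)))::nat) \<le> 5" by simp
  ultimately show ?thesis by blast
qed

lemma exec_cexp:
  assumes "sim R A R' M" "wfe e" "ok e R A" "98 < t"
  shows "\<exists>R'' t'. exec w (cexp e t) (R', M) t' (R'', M) \<and> t' \<le> ecost e \<and> R'' t = ev e R A \<and>
    (\<forall>x<t. R'' x = R' x)"
  using assms
proof (induction e arbitrary: t R')
  case (N a)
  then have "exec w (Const t a) (R', M) 1 (R'(t := a), M)"
    using exec.Const[of w t a R' M] small_le[of a] by simp
  moreover have "(R'(t := a)) t = a" "\<forall>x<t. (R'(t := a)) x = R' x" by auto
  ultimately show ?case unfolding cexp.simps ecost.simps ev.simps by blast
next
  case (V x)
  then have "R' x = R x" "R x < 2 ^ wd" by (auto simp: sim_def)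
  then have "exec w (Op Or t x x) (R', M) 1 (R'(t := R x), M)"
    using exec.Op[of w Or t x x R' M] small_le[of "R x"] by simp
  moreover have "(R'(t := R x)) t = R x" "\<forall>y<t. (R'(t := R x)) y = R' y" by auto
  ultimately show ?case unfolding cexp.simps ecost.simps ev.simps by blast
next
  case (Ld c e)
  have we: "wfe e" "ok e R A" "c < 32" using Ld.prems by auto
  obtain R1 t1 where 1: "exec w (cexp e t) (R', M) t1 (R1, M)" "t1 \<le> ecost e"
    "R1 t = ev e R A" "\<forall>x<t. R1 x = R' x"
    using Ld.IH[OF Ld.prems(1) we(1,2) Ld.prems(4)] by blast
  have s1: "sim R A R1 M" by (rule sim_upd[OF Ld.prems(1)]) (use 1(4) Ld.prems(4) in auto)
  have eb: "ev e R A < 2 ^ wd" using ev_bound[OF s1] we by blast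
  obtain R2 t2 where 2: "exec w (caddr c t) (R1, M) t2 (R2, M)" "t2 \<le> 5"
    "R2 t = addr c (ev e R A)" "\<forall>x<t. R2 x = R1 x"
    using exec_caddr[of R1 t "ev e R A" c M] s1 1(3) eb we(3) Ld.prems(4) unfolding sim_def by blast
  have m: "M (addr c (ev e R A)) = A c (ev e R A)"
    using s1 we Ld.prems(3) unfolding addr_def sim_def by auto
  have "exec w (Load t t) (R2, M) 1 (R2(t := M (R2 t)), M)" by (rule exec.Load)
  then have "exec w (cexp (Ld c e) t) (R', M) (t1 + (t2 + 1)) (R2(t := M (R2 t)), M)"
    using 1(1) 2(1) by (auto intro!: exec.Seq simp del: One_nat_def)
  moreover have "t1 + (t2 + 1) \<le> ecost (Ld c e)" using 1 2 by simp
  moreover have "(R2(t := M (R2 t))) t = ev (Ld c e) R A" "\<forall>x<t. (R2(t := M (R2 t))) x = R' x"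
    using 1 2 m by auto
  ultimately show ?case by blast
next
  case (Bin f a b)
  have we: "wfe a" "ok a R A" "wfe b" "ok b R A" using Bin.prems by auto
  obtain R1 t1 where 1: "exec w (cexp a t) (R', M) t1 (R1, M)" "t1 \<le> ecost a"
    "R1 t = ev a R A" "\<forall>x<t. R1 x = R' x"
    using Bin.IH(1)[OF Bin.prems(1) we(1,2) Bin.prems(4)] by blast
  have s1: "sim R A R1 M" by (rule sim_upd[OF Bin.prems(1)]) (use 1(4) Bin.prems(4) in auto)
  obtain R2 t2 where 2: "exec w (cexp b (Suc t)) (R1, M) t2 (R2, M)" "t2 \<le> ecost b"
    "R2 (Suc t) = ev b R A" "\<forall>x<Suc t. R2 x = R1 x"
    using Bin.IH(2)[OF s1 we(3,4), of "Suc t"] Bin.prems(4) by auto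
  have tb: "take_bit w (ev (Bin f a b) R A) = ev (Bin f a b) R A"
    using small_le ev_bound[OF s1] Bin.prems by blast
  have "exec w (Op f t t (Suc t)) (R2, M) 1 (R2(t := ev (Bin f a b) R A), M)"
    using exec.Op[of w f t t "Suc t" R2 M] tb 1 2 by simp
  then have "exec w (cexp (Bin f a b) t) (R', M) (t1 + (t2 + 1)) (R2(t := ev (Bin f a b) R A), M)"
    using 1(1) 2(1) by (auto intro!: exec.Seq simp del: One_nat_def)
  moreover have "t1 + (t2 + 1) \<le> ecost (Bin f a b)" using 1 2 by simp
  moreover have "(R2(t := ev (Bin f a b) R A)) t = ev (Bin f a b) R A"
    "\<forall>x<t. (R2(t := ev (Bin f a b) R A)) x = R' x"
    using 1 2 by auto
  ultimately show ?case by blast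
qed

lemma exec_cstm:
  assumes "run c R A t R1 A1" "sim R A R' M" "wfs c" "scost c \<le> D"
  shows "\<exists>t' R1' M1. exec w (cstm c) (R', M) t' (R1', M1) \<and> t' \<le> D * t \<and> sim R1 A1 R1' M1"
  using assms
proof (induction arbitrary: R' M rule: run.induct)
  case (Asg e R A x)
  obtain R2 t2 where 2: "exec w (cexp e 99) (R', M) t2 (R2, M)" "t2 \<le> ecost e"
    "R2 99 = ev e R A" "\<forall>x<99. R2 x = R' x"
    using exec_cexp[OF Asg.prems(1) _ Asg.hyps(1), of 99] Asg.prems by auto
  have b: "ev e R A < 2 ^ wd" using ev_bound[OF Asg.prems(1) _ Asg.hyps(1)] Asg.prems by auto
  have "exec w (Op Or x 99 99) (R2, M) 1 (R2(x := ev e R A), M)"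
    using exec.Op[of w Or x 99 99 R2 M] 2 small_le[OF b] by simp
  then have "exec w (cstm (x ::= e)) (R', M) (t2 + 1) (R2(x := ev e R A), M)"
    using 2 by (auto intro!: exec.Seq simp del: One_nat_def)
  moreover have "sim (R(x := ev e R A)) A (R2(x := ev e R A)) M"
    using Asg.prems 2 b unfolding sim_def by auto
  moreover have "t2 + 1 \<le> D * 1" using 2 Asg.prems by simp
  ultimately show ?case by blast
next
  case (Sto e R A f c)
  have wf: "wfe e" "wfe f" "c < 32" using Sto.prems by auto
  obtain R2 t2 where 2: "exec w (cexp e 99) (R', M) t2 (R2, M)" "t2 \<le> ecost e"
    "R2 99 = ev e R A" "\<forall>x<99. R2 x = R' x"
    using exec_cexp[OF Sto.prems(1) wf(1) Sto.hyps(1), of 99] by auto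
  have b: "ev e R A < 2 ^ wd" "ev f R A < 2 ^ wd"
    using ev_bound[OF Sto.prems(1)] Sto.hyps wf by auto
  have s2: "sim R A R2 M" by (rule sim_upd[OF Sto.prems(1)]) (use 2 in auto)
  obtain R3 t3 where 3: "exec w (caddr c 99) (R2, M) t3 (R3, M)" "t3 \<le> 5"
    "R3 99 = addr c (ev e R A)" "\<forall>x<99. R3 x = R2 x"
    using exec_caddr[of R2 99 "ev e R A" c M] s2 2(3) b wf unfolding sim_def by auto
  have s3: "sim R A R3 M" by (rule sim_upd[OF s2]) (use 3 in auto)
  obtain R4 t4 where 4: "exec w (cexp f 100) (R3, M) t4 (R4, M)" "t4 \<le> ecost f"
    "R4 100 = ev f R A" "\<forall>x<100. R4 x = R3 x"
    using exec_cexp[OF s3 wf(2) Sto.hyps(2), of 100] by auto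
  have s4: "sim R A R4 M" by (rule sim_upd[OF s3]) (use 4 in auto)
  let ?M = "M(addr c (ev e R A) := ev f R A)"
  have "exec w (Store 99 100) (R4, M) 1 (R4, ?M)"
    using exec.Store[of w 99 100 R4 M] 3 4 by simp
  then have "exec w (cstm (Sto c e f)) (R', M) (t2 + (t3 + (t4 + 1))) (R4, ?M)"
    using 2 3 4 by (auto intro!: exec.Seq simp del: One_nat_def)
  moreover have "sim R (A(c := (A c)(ev e R A := ev f R A))) R4 ?M"
  proof -
    \<comment> \<open>The index selects a block of 32 cells and the array a place in this block, so
      distinct entries never share a cell; array 0 stays below \<open>L\<close>.\<close>
    have inj: "addr c' i = addr c j \<longleftrightarrow> c' = c \<and> i = j"
      if "c' < 32" "c' = 0 \<longrightarrow> i < L" "c = 0 \<longrightarrow> j < L" for c' i j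
    proof -
      have "L + (32 * i + c') = L + (32 * j + c) \<longleftrightarrow> c' = c \<and> i = j"
        using that(1) wf(3) by auto presburger+
      then show ?thesis using that unfolding addr_def by auto
    qed
    have "?M i = (A(c := (A c)(ev e R A := ev f R A))) 0 i" if "i < L" for i
      using inj[of 0 i "ev e R A"] that s4 Sto.hyps(3) unfolding sim_def addr_def[of 0] by auto
    moreover have "?M (L + 32 * i + c') = (A(c := (A c)(ev e R A := ev f R A))) c' i"
      if "0 < c'" "c' < 32" for i c'
      using inj[of c' i "ev e R A"] that s4 Sto.hyps(3) unfolding sim_def addr_def[of c'] by auto
    ultimately show ?thesis using s4 b unfolding sim_def by auto
  qed
  moreover have "t2 + (t3 + (t4 + 1)) \<le> D * 1" using 2 3 4 Sto.prems by simp
  ultimately show ?case by blast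
next
  case (Sq c1 R A t1 R1 A1 c2 t2 R2 A2)
  obtain u1 R3 M3 where 1: "exec w (cstm c1) (R', M) u1 (R3, M3)" "u1 \<le> D * t1" "sim R1 A1 R3 M3"
    using Sq.IH(1)[OF Sq.prems(1)] Sq.prems by auto
  obtain u2 R4 M4 where 2: "exec w (cstm c2) (R3, M3) u2 (R4, M4)" "u2 \<le> D * t2" "sim R2 A2 R4 M4"
    using Sq.IH(2)[OF 1(3)] Sq.prems by auto
  show ?case using exec.Seq[OF 1(1) 2(1)] 1 2
    by (intro exI[of _ "u1 + u2"] exI[of _ R4] exI[of _ M4]) (auto simp: distrib_left)
next
  case (CondT e R A c1 t R1 A1 c2)
  obtain R2 t2 where 2: "exec w (cexp e 99) (R', M) t2 (R2, M)" "t2 \<le> ecost e"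
    "R2 99 = ev e R A" "\<forall>x<99. R2 x = R' x"
    using exec_cexp[OF CondT.prems(1) _ CondT.hyps(1), of 99] CondT.prems by auto
  have s2: "sim R A R2 M" by (rule sim_upd[OF CondT.prems(1)]) (use 2 in auto)
  obtain u1 R3 M3 where 3: "exec w (cstm c1) (R2, M) u1 (R3, M3)" "u1 \<le> D * t" "sim R1 A1 R3 M3"
    using CondT.IH[OF s2] CondT.prems by auto
  have "exec w (IfNZ 99 (cstm c1) (cstm c2)) (R2, M) (1 + u1) (R3, M3)"
    using exec.IfTrue[of R2 99, OF _ 3(1)] 2(3) CondT.hyps by simp
  from exec.Seq[OF 2(1) this] show ?case using 2 3 CondT.prems
    by (intro exI[of _ "t2 + (1 + u1)"] exI[of _ R3] exI[of _ M3]) (auto simp: distrib_left)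
next
  case (CondF e R A c2 t R1 A1 c1)
  obtain R2 t2 where 2: "exec w (cexp e 99) (R', M) t2 (R2, M)" "t2 \<le> ecost e"
    "R2 99 = ev e R A" "\<forall>x<99. R2 x = R' x"
    using exec_cexp[OF CondF.prems(1) _ CondF.hyps(1), of 99] CondF.prems by auto
  have s2: "sim R A R2 M" by (rule sim_upd[OF CondF.prems(1)]) (use 2 in auto)
  obtain u1 R3 M3 where 3: "exec w (cstm c2) (R2, M) u1 (R3, M3)" "u1 \<le> D * t" "sim R1 A1 R3 M3"
    using CondF.IH[OF s2] CondF.prems by auto
  have "exec w (IfNZ 99 (cstm c1) (cstm c2)) (R2, M) (1 + u1) (R3, M3)"
    using exec.IfFalse[of R2 99, OF _ 3(1)] 2(3) CondF.hyps by simp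
  from exec.Seq[OF 2(1) this] show ?case using 2 3 CondF.prems
    by (intro exI[of _ "t2 + (1 + u1)"] exI[of _ R3] exI[of _ M3]) (auto simp: distrib_left)
next
  case (LoopT e R A c t1 R1 A1 t2 R2 A2)
  obtain R3 t3 where 3: "exec w (cexp e 99) (R', M) t3 (R3, M)" "t3 \<le> ecost e"
    "R3 99 = ev e R A" "\<forall>x<99. R3 x = R' x"
    using exec_cexp[OF LoopT.prems(1) _ LoopT.hyps(1), of 99] LoopT.prems by auto
  have s2: "sim R A R3 M" by (rule sim_upd[OF LoopT.prems(1)]) (use 3 in auto)
  obtain u1 R4 M4 where 4: "exec w (cstm c) (R3, M) u1 (R4, M4)" "u1 \<le> D * t1" "sim R1 A1 R4 M4"
    using LoopT.IH(1)[OF s2] LoopT.prems by auto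
  obtain u2 R5 M5 where 5: "exec w (cstm (Loop e c)) (R4, M4) u2 (R5, M5)" "u2 \<le> D * t2"
    "sim R2 A2 R5 M5"
    using LoopT.IH(2)[OF 4(3)] LoopT.prems by auto
  \<comment> \<open>The compiled loop evaluates its condition before \<open>WhileNZ\<close> and
    again at the end of the body. The induction hypothesis begins with such an evaluation, which is
    split off here to become the end of the current round.\<close>
  obtain v1 v2 \<rho> where 6: "exec w (cexp e 99) (R4, M4) v1 \<rho>"
    "exec w (WhileNZ 99 (Seq (cstm c) (cexp e 99))) \<rho> v2 (R5, M5)" "u2 = v1 + v2"
    using 5(1) by (auto elim: exec.cases)
  have "exec w (WhileNZ 99 (Seq (cstm c) (cexp e 99))) (R3, M) (1 + (u1 + v1) + v2) (R5, M5)"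
    using 3 LoopT.hyps by (intro exec.WhileTrue[OF _ exec.Seq[OF 4(1) 6(1)] 6(2)]) simp
  from exec.Seq[OF 3(1) this] show ?case using 3 4 5 6 LoopT.prems
    by (intro exI[of _ "t3 + (1 + (u1 + v1) + v2)"] exI[of _ R5] exI[of _ M5])
      (auto simp: distrib_left)
next
  case (LoopF e R A c)
  obtain R2 t2 where 2: "exec w (cexp e 99) (R', M) t2 (R2, M)" "t2 \<le> ecost e"
    "R2 99 = ev e R A" "\<forall>x<99. R2 x = R' x"
    using exec_cexp[OF LoopF.prems(1) _ LoopF.hyps(1), of 99] LoopF.prems by auto
  have s2: "sim R A R2 M" by (rule sim_upd[OF LoopF.prems(1)]) (use 2 in auto)
  have "exec w (WhileNZ 99 (Seq (cstm c) (cexp e 99))) (R2, M) 1 (R2, M)"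
    using 2 LoopF.hyps by (intro exec.WhileFalse) simp
  from exec.Seq[OF 2(1) this] show ?case using 2 s2 LoopF.prems
    by (intro exI[of _ "t2 + 1"] exI[of _ R2] exI[of _ M]) auto
qed

end

section \<open>The input\<close>

abbreviation add_e (infixl "[+]" 65) where "a [+] b \<equiv> Bin Add a b"
abbreviation sub_e (infixl "[-]" 65) where "a [-] b \<equiv> Bin Sub a b"
abbreviation mul_e (infixl "[*]" 70) where "a [*] b \<equiv> Bin Mul a b"
abbreviation and_e (infixl "[and]" 60) where "a [and] b \<equiv> Bin And a b"
abbreviation or_e (infixl "[or]" 60) where "a [or] b \<equiv> Bin Or a b"
abbreviation xor_e (infixl "[xor]" 60) where "a [xor] b \<equiv> Bin Xor a b"
abbreviation shl_e (infixl "[shl]" 70) where "a [shl] b \<equiv> Bin Shl a b"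
abbreviation shr_e (infixl "[shr]" 70) where "a [shr] b \<equiv> Bin Shr a b"
abbreviation less_e (infix "[<]" 55) where "a [<] b \<equiv> Bin Less a b"
abbreviation eq_e (infix "[=]" 55) where "a [=] b \<equiv> Bin Equal a b"

abbreviation Skip :: stm where "Skip \<equiv> 97 ::= N 0"

lemma length_flatten_pairs [simp]: "length (flatten_pairs ps) = 2 * length ps"
  by (induction ps) (auto simp: flatten_pairs_def)

lemma nth_flatten_pairs:
  "i < length ps \<Longrightarrow> flatten_pairs ps ! (2 * i) = fst (ps ! i)"
  "i < length ps \<Longrightarrow> flatten_pairs ps ! Suc (2 * i) = snd (ps ! i)"
proof (induction ps arbitrary: i)
  case (Cons p ps)
  { case 1 then show ?case using Cons.IH(1) by (cases i; cases p) (auto simp: flatten_pairs_def) }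
  { case 2 then show ?case using Cons.IH(2) by (cases i; cases p) (auto simp: flatten_pairs_def) }
qed auto

text \<open>Position of the \<open>j\<close>-th list when each list is preceded by its length.\<close>

definition lists_off :: "nat list list \<Rightarrow> nat \<Rightarrow> nat" where
  "lists_off bs j = (\<Sum>b\<leftarrow>take j bs. Suc (length b))"

lemma lists_off_Suc: "j < length bs \<Longrightarrow> lists_off bs (Suc j) = lists_off bs j + Suc (length (bs ! j))"
  by (simp add: lists_off_def take_Suc_conv_app_nth)

lemma lists_off_mono: "i \<le> j \<Longrightarrow> lists_off bs i \<le> lists_off bs j"
proof -
  assume "i \<le> j"
  then obtain d where "j = i + d" using le_Suc_ex by blast
  then show ?thesis by (simp add: lists_off_def take_add)
qed

lemma length_lists: "length (concat (map (\<lambda>b. length b # b) bs)) = lists_off bs (length bs)"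
  by (simp add: lists_off_def length_concat comp_def)

lemma nth_lists:
  assumes "j < length bs"
  shows "concat (map (\<lambda>b. length b # b) bs) ! lists_off bs j = length (bs ! j)"
    and "t < length (bs ! j) \<Longrightarrow> concat (map (\<lambda>b. length b # b) bs) ! (lists_off bs j + Suc t) = bs ! j ! t"
proof -
  let ?f = "\<lambda>bs. concat (map (\<lambda>b. length b # b) bs)"
  obtain xs b ys where bs: "bs = xs @ b # ys" "length xs = j"
    using assms by (metis id_take_nth_drop length_take min.absorb4)
  have "length (?f xs) = lists_off bs j" using length_lists[of xs] bs by (simp add: lists_off_def)
  then have "?f bs ! lists_off bs j = length b"
    "t < length b \<Longrightarrow> ?f bs ! (lists_off bs j + Suc t) = b ! t"
    unfolding bs(1) by (auto simp: nth_append)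
  then show "?f bs ! lists_off bs j = length (bs ! j)"
    and "t < length (bs ! j) \<Longrightarrow> ?f bs ! (lists_off bs j + Suc t) = bs ! j ! t"
    using bs by auto
qed

text \<open>\<open>Z\<close> is the single size parameter against which overflow is checked: indices
  are bounded by powers of \<open>Z\<close>, the largest being those of the relation table, below
  \<open>Z ^ 6\<close>.\<close>

locale instance_input = machine +
  fixes n s :: nat and pr :: "nat \<Rightarrow> bool" and es :: "(nat \<times> nat) list" and bs :: "nat list list"
    and ts :: "(nat \<times> nat) list" and inp :: "nat list" and Z :: nat
  assumes inp_def: "inp = [n, s, length es, length bs, length ts]
             @ map (\<lambda>u. of_bool (pr u)) [0..<n]
             @ flatten_pairs es
             @ concat (map (\<lambda>b. length b # b) bs)
             @ flatten_pairs ts"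
    and Z_def: "Z = length inp + 2"
    and inp_L: "length inp \<le> L"
    and Z_bound: "Z ^ 20 \<le> 2 ^ wd"
    and s_less: "s < n"
    and es_less: "\<And>u v. (u, v) \<in> set es \<Longrightarrow> u < n \<and> v < n"
    and es_distinct: "distinct es"
    and bs_less: "\<And>b. b \<in> set bs \<Longrightarrow> set b \<subseteq> {..<n}"
    and bs_distinct: "\<And>b. b \<in> set bs \<Longrightarrow> distinct b"
    and ts_less: "\<And>i j. (i, j) \<in> set ts \<Longrightarrow> i < length bs \<and> j < length bs"
begin

definition In :: "nat \<Rightarrow> nat" where
  "In i = (if i < length inp then inp ! i else 0)"

definition eb :: nat where "eb = 5 + n"

definition off :: "nat \<Rightarrow> nat" where "off j = eb + 2 * length es + lists_off bs j"

definition tb :: nat where "tb = off (length bs)"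

lemma length_inp: "length inp = tb + 2 * length ts"
  unfolding inp_def tb_def off_def eb_def by (simp add: length_lists)

lemma In_simps [simp]:
  "In 0 = n" "In (Suc 0) = s" "In 2 = length es" "In 3 = length bs" "In 4 = length ts"
  using length_inp unfolding In_def tb_def off_def eb_def
  by (simp_all add: inp_def numeral_eq_Suc nth_append)

lemma In_pr: "u < n \<Longrightarrow> In (5 + u) = of_bool (pr u)"
  using length_inp unfolding In_def tb_def off_def eb_def
  by (simp add: inp_def nth_append)

lemma In_es:
  assumes "e < length es"
  shows "In (eb + 2 * e) = fst (es ! e)" "In (Suc (eb + 2 * e)) = snd (es ! e)"
  using length_inp assms unfolding In_def tb_def off_def eb_def
  by (simp_all add: inp_def nth_append nth_flatten_pairs)

lemma off_less: "j < length bs \<Longrightarrow> off j + Suc (length (bs ! j)) \<le> tb"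
  using lists_off_mono[of "Suc j" "length bs" bs] lists_off_Suc[of j bs]
  unfolding tb_def off_def by simp

lemma off_Suc: "j < length bs \<Longrightarrow> off (Suc j) = off j + Suc (length (bs ! j))"
  unfolding off_def by (simp add: lists_off_Suc)

lemma inp_parts: "inp = ([n, s, length es, length bs, length ts]
             @ map (\<lambda>u. of_bool (pr u)) [0..<n]
             @ flatten_pairs es)
             @ (concat (map (\<lambda>b. length b # b) bs)
             @ flatten_pairs ts)"
  unfolding inp_def by simp

lemma In_bag:
  assumes "j < length bs"
  shows "In (off j) = length (bs ! j)"
    and "t < length (bs ! j) \<Longrightarrow> In (Suc (off j + t)) = bs ! j ! t"
proof -
  let ?A = "[n, s, length es, length bs, length ts]
             @ map (\<lambda>u. of_bool (pr u)) [0..<n]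
             @ flatten_pairs es"
  let ?B = "concat (map (\<lambda>b. length b # b) bs)"
  have A: "length ?A = eb + 2 * length es" by (simp add: eb_def)
  have "inp ! (length ?A + i) = ?B ! i" if "i < length ?B" for i
    unfolding inp_parts nth_append_length_plus using that by (simp only: nth_append if_True)
  then have i: "In (eb + 2 * length es + i) = ?B ! i" if "i < lists_off bs (length bs)" for i
    unfolding In_def A using that length_inp unfolding length_lists tb_def off_def by simp
  have l: "lists_off bs j + Suc (length (bs ! j)) \<le> lists_off bs (length bs)"
    using off_less[OF assms] unfolding tb_def off_def by simp
  show "In (off j) = length (bs ! j)"
    using i[of "lists_off bs j"] l nth_lists(1)[OF assms] unfolding off_def by simp
  show "t < length (bs ! j) \<Longrightarrow> In (Suc (off j + t)) = bs ! j ! t"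
    using i[of "lists_off bs j + Suc t"] l nth_lists(2)[OF assms, of t] unfolding off_def by (simp add: add.assoc)
qed

lemma In_ts:
  assumes "e < length ts"
  shows "In (tb + 2 * e) = fst (ts ! e)" "In (Suc (tb + 2 * e)) = snd (ts ! e)"
proof -
  let ?A = "[n, s, length es, length bs, length ts]
             @ map (\<lambda>u. of_bool (pr u)) [0..<n]
             @ flatten_pairs es @ concat (map (\<lambda>b. length b # b) bs)"
  have A: "length ?A = tb" by (simp add: eb_def tb_def off_def length_lists)
  have p: "inp = ?A @ flatten_pairs ts" unfolding inp_def by simp
  have i: "In (tb + i) = flatten_pairs ts ! i" if "i < 2 * length ts" for i
  proof -
    have "inp ! (length ?A + i) = flatten_pairs ts ! i" unfolding p by (rule nth_append_length_plus)
    then show ?thesis unfolding In_def A using that length_inp by simp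
  qed
  show "In (tb + 2 * e) = fst (ts ! e)" "In (Suc (tb + 2 * e)) = snd (ts ! e)"
    using i[of "2 * e"] i[of "Suc (2 * e)"] assms nth_flatten_pairs[OF assms] by auto
qed

lemma Z_ge: "n + 7 \<le> Z" "length inp < Z" "length inp \<le> L" "length es < Z" "length bs < Z" "length ts < Z" "tb < Z"
    "eb + 2 * length es \<le> tb" "2 * length ts < Z" "tb + 2 * length ts < Z"
proof -
  have "length bs \<le> lists_off bs (length bs)" unfolding lists_off_def
    by (induction bs) auto
  then show "n + 7 \<le> Z" "length inp < Z" "length inp \<le> L" "length es < Z" "length bs < Z" "length ts < Z" "tb < Z"
    "eb + 2 * length es \<le> tb" "2 * length ts < Z" "tb + 2 * length ts < Z"
    using length_inp inp_L unfolding Z_def tb_def off_def eb_def by auto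
qed

lemma small: "x < Z ^ i \<Longrightarrow> i \<le> 20 \<Longrightarrow> x < 2 ^ wd"
  using Z_ge(1) Z_bound power_increasing[of i 20 Z] by linarith

lemma small1: "x < Z \<Longrightarrow> x < 2 ^ wd"
  using small[of x 1] by simp

lemma small2: "x < Z * Z \<Longrightarrow> x < 2 ^ wd"
  using small[of x 2] by (simp add: power2_eq_square)

lemma numeral_small [simp]: "numeral k \<le> (100::nat) \<Longrightarrow> numeral k < (2::nat) ^ wd" "Suc 0 < 2 ^ wd" "(0::nat) < 2 ^ wd"
proof -
  have "(7::nat) ^ 20 \<le> Z ^ 20" by (rule power_mono) (use Z_ge(1) in auto)
  then have "(101::nat) \<le> 2 ^ wd" using Z_bound by simp
  then show "numeral k \<le> (100::nat) \<Longrightarrow> numeral k < (2::nat) ^ wd" "Suc 0 < 2 ^ wd" "(0::nat) < 2 ^ wd"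
    by linarith+
qed

definition mx :: "nat \<Rightarrow> nat" where
  "mx j = Max (insert 0 (length ` set (take j bs)))"

lemma mx_Suc: "j < length bs \<Longrightarrow> mx (Suc j) = max (mx j) (length (bs ! j))"
proof -
  assume "j < length bs"
  then have "insert 0 (length ` set (take (Suc j) bs)) = insert (length (bs ! j)) (insert 0 (length ` set (take j bs)))"
    by (auto simp: take_Suc_conv_app_nth)
  then show ?thesis unfolding mx_def by (simp only: max.commute) (rule Max_insert; simp)
qed

definition glob :: "regs \<Rightarrow> arrs \<Rightarrow> bool" where
  "glob R A \<longleftrightarrow> R 0 = n \<and> R 1 = s \<and> R 2 = length es \<and> R 3 = length bs \<and> R 4 = length ts \<and>
     R 5 = eb \<and> R 6 = tb \<and> R 7 = mx (length bs) \<and> A 0 = In \<and> (\<forall>j<length bs. A 1 j = off j)"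

lemma glob_agree:
  "glob R A \<Longrightarrow> agree c R A R' A' \<Longrightarrow> wr c \<inter> {0,1,2,3,4,5,6,7} = {} \<Longrightarrow> wa c \<inter> {0,1} = {} \<Longrightarrow> glob R' A'"
  unfolding glob_def agree_def by auto

end

section \<open>The program\<close>

text \<open>
  Registers 0 to 7 hold \<open>n\<close>, \<open>s\<close>, the numbers of edges, bags and tree edges, the positions of the
  edges and of the tree edges in the input, and the maximum bag size. Registers 9 and 10 hold
  \<open>2 ^ K\<close> and the number \<open>K\<close> of colours. The other registers are local to the phases.

  Array 0 is the input, and finally receives the output. For bags: 1 is the position in the input,
  2 and 3 are the heads and links of the adjacency lists of the decomposition tree, 4 is the queue of
  the breadth-first search and 5 marks the visited bags. For vertices: 6 is the discovery number,
  7 the colour, 8 the mask of the colours of the earlier neighbours, 9 the parent, and 10 maps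
  discovery numbers to vertices. For pairs of a vertex and a mask: 11 marks infeasible subsets,
  12 holds the rows of the reachability relation, one word for each colour, and 13 marks the
  subsets for which the eliminated vertex is added. For vertices: 14 is the mask of the selected
  vertices of the bag, 15 marks the vertices of the result, and 16 is used by the naive algorithm.
\<close>

context machine
begin

lemma wp_For_conseq:
  assumes "R y < 2 ^ wd"
    and "x \<noteq> y" "x \<notin> wr c" "y \<notin> wr c"
    and "I 0 (R(x := 0)) A"
    and "\<And>j R' A'. j < R y \<Longrightarrow> I j R' A' \<Longrightarrow> agree (For x y c) R A R' A' \<Longrightarrow> R' x = j \<Longrightarrow>
      wp c (\<lambda>t R2 A2. t \<le> T \<and> (agree c R' A' R2 A2 \<longrightarrow> I (Suc j) (R2(x := Suc j)) A2)) R' A'"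
    and Q: "\<And>t R' A'. t \<le> R y * (T + 2) + 2 \<Longrightarrow> I (R y) R' A' \<Longrightarrow>
      agree (For x y c) R A R' A' \<Longrightarrow> R' x = R y \<Longrightarrow> Q t R' A'"
  shows "wp (For x y c) Q R A"
  by (rule wp_mono[OF wp_For[OF refl assms(1-6)]]) (auto intro: Q)

lemma wp_Loop_conseq:
  fixes \<Phi> :: "regs \<Rightarrow> arrs \<Rightarrow> nat"
  assumes "I R A" "\<And>R A. I R A \<Longrightarrow> ok e R A"
    and "\<And>R A. I R A \<Longrightarrow> ev e R A \<noteq> 0 \<Longrightarrow>
      wp c (\<lambda>t R' A'. I R' A' \<and> t + 1 + \<Phi> R' A' \<le> \<Phi> R A) R A"
    and "\<And>t R' A'. I R' A' \<Longrightarrow> ev e R' A' = 0 \<Longrightarrow> t + \<Phi> R' A' \<le> \<Phi> R A + 1 \<Longrightarrow> Q t R' A'"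
  shows "wp (Loop e c) Q R A"
  by (rule wp_mono[OF wp_Loop[OF assms(1-3)]]) (use assms(4) in blast)+

end

section \<open>Header of the input and adjacency lists of the decomposition tree\<close>

definition header_loop :: stm where
  "header_loop = For 20 3 (Sto 1 (V 20) (V 8) ;; 21 ::= Ld 0 (V 8) ;;
     Cond (V 7 [<] V 21) (7 ::= V 21) Skip ;; 8 ::= V 8 [+] (V 21 [+] N 1))"

definition header :: stm where
  "header = (0 ::= Ld 0 (N 0) ;; 1 ::= Ld 0 (N 1) ;; 2 ::= Ld 0 (N 2) ;; 3 ::= Ld 0 (N 3) ;;
     4 ::= Ld 0 (N 4) ;; 5 ::= V 0 [+] N 5 ;; 8 ::= V 5 [+] (V 2 [+] V 2) ;; 7 ::= N 0 ;;
     header_loop ;; 6 ::= V 8)"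

definition adjacency :: stm where
  "adjacency = (21 ::= N 2 [*] V 4 ;; For 20 21 (22 ::= Ld 0 (V 6 [+] V 20) ;;
     Sto 3 (V 20 [+] N 1) (Ld 2 (V 22)) ;; Sto 2 (V 22) (V 20 [+] N 1)))"

context instance_input
begin

lemma wp_header_loop:
  assumes "R 3 = length bs" "R 7 = 0" "R 8 = eb + 2 * length es" "A 0 = In"
  shows "wp header_loop (\<lambda>t R' A'. t \<le> 7 * length bs + 2 \<and> R' 7 = mx (length bs) \<and> R' 8 = tb \<and>
    (\<forall>j<length bs. A' 1 j = off j) \<and> agree header_loop R A R' A') R A"
  unfolding header_loop_def
proof (rule wp_For_conseq[where I = "\<lambda>j R A. R 8 = off j \<and> R 7 = mx j \<and> (\<forall>i<j. A 1 i = off i)" and T = 5], goal_cases)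
  case (6 j R' A')
  then have j: "j < length bs" using assms by simp
  have a0: "A' 0 = In" using assms agree_A[OF 6(3), of 0] by simp
  have l: "off j < length inp" "off j + Suc (length (bs ! j)) < Z"
    using off_less[OF j] length_inp Z_ge by auto
  have b: "Suc (length (bs ! j)) < 2 ^ wd" "off j + Suc (length (bs ! j)) < 2 ^ wd" "off j < L"
    using l Z_ge(3) small1 by auto
  show ?case using 6(2,4) b 
    by (simp add: a0 In_bag[OF j] off_Suc[OF j] mx_Suc[OF j] less_Suc_eq)
qed (use assms small1[OF Z_ge(5)] in \<open>auto simp: off_def lists_off_def mx_def tb_def\<close>)

lemma wp_header:
  assumes "A 0 = In"
  shows "wp header (\<lambda>t R' A'. t \<le> 7 * length bs + 12 \<and> glob R' A' \<and> (\<forall>a>1. A' a = A a)) R A"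
proof -
  have L5: "5 < L" "(0::nat) < L" "Suc 0 < L" "(2::nat) < L" "(3::nat) < L" "(4::nat) < L" using length_inp Z_ge(3) s_less by (auto simp: tb_def off_def eb_def)
  have b: "n + 5 < 2 ^ wd" "eb + 2 * length es < 2 ^ wd" "2 * length es < 2 ^ wd"
    using Z_ge small1 by auto
  show ?thesis unfolding header_def
    apply (simp add: assms L5 b)
    apply (intro conjI)
    subgoal using b by linarith
    subgoal using b by (simp add: eb_def)
    apply (rule wp_mono[OF wp_header_loop])
    apply (auto simp: assms glob_def agree_def header_loop_def eb_def)
    done
qed

end

section \<open>Breadth-first search of the decomposition tree\<close>

definition bfs_inner :: stm where
  "bfs_inner = Loop (V 25) (26 ::= Ld 0 (V 6 [+] ((V 25 [-] N 1) [xor] N 1)) ;;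
     Cond (Ld 5 (V 26)) Skip
       (Sto 5 (V 26) (N 1) ;; Sto 4 (V 24) (V 26) ;; 24 ::= V 24 [+] N 1) ;;
     25 ::= Ld 3 (V 25))"

definition bfs_loop :: stm where
  "bfs_loop = Loop (V 23 [<] V 24) (25 ::= Ld 2 (Ld 4 (V 23)) ;;
       bfs_inner ;;
       23 ::= V 23 [+] N 1)"

definition bfs :: stm where
  "bfs = (Sto 5 (N 0) (N 1) ;; 23 ::= N 0 ;; 24 ::= N 1 ;; bfs_loop)"

lemma xor_1_even: "Bit_Operations.xor (2 * e) (1::nat) = Suc (2 * e)"
  and xor_1_odd: "Bit_Operations.xor (Suc (2 * e)) (1::nat) = 2 * e"
  by (simp_all add: xor_Suc_0_eq)

context instance_input
begin

text \<open>The two entries of each tree edge are at positions \<open>2 * e\<close> and \<open>2 * e + 1\<close>, so that flipping the last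
  bit leads from one endpoint to the other. In the adjacency lists, entry \<open>p\<close> is represented by
  \<open>p + 1\<close>, and 0 is the end of the list; \<open>prev b x\<close> is the last entry of \<open>b\<close> before \<open>x\<close>.\<close>

definition own :: "nat \<Rightarrow> nat" where "own p = In (tb + p)"
definition partner :: "nat \<Rightarrow> nat" where "partner p = In (tb + Bit_Operations.xor p (Suc 0))"

lemma own_partner:
  assumes "p < 2 * length ts"
  shows "own p < length bs" "partner p < length bs" "tb + Bit_Operations.xor p (Suc 0) < length inp"
    "\<exists>e<length ts. (own p, partner p) = ts ! e \<or> (partner p, own p) = ts ! e"
proof -
  obtain e where e: "e < length ts" "p = 2 * e \<or> p = Suc (2 * e)"
    using assms by (metis Suc_double_not_eq_double evenE nat_mult_less_cancel_disj oddE Suc_eq_plus1 Suc_lessD)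
  have "(own p, partner p) = ts ! e \<or> (partner p, own p) = ts ! e"
    using e In_ts[OF e(1)] xor_1_even[of e] xor_1_odd[of e] unfolding own_def partner_def
    by (auto simp: prod_eq_iff)
  moreover have "fst (ts ! e) < length bs \<and> snd (ts ! e) < length bs"
    using ts_less[of "fst (ts ! e)" "snd (ts ! e)"] e(1) by simp
  ultimately show "own p < length bs" "partner p < length bs"
    "\<exists>e<length ts. (own p, partner p) = ts ! e \<or> (partner p, own p) = ts ! e"
    using e(1) by (auto simp: prod_eq_iff)
  show "tb + Bit_Operations.xor p (Suc 0) < length inp"
    using e xor_1_even[of e] xor_1_odd[of e] length_inp by auto
qed

lemma own_partner_ex:
  assumes "(i, j) \<in> set ts"
  shows "\<exists>p<2 * length ts. own p = i \<and> partner p = j" "\<exists>p<2 * length ts. own p = j \<and> partner p = i"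
proof -
  obtain e where e: "e < length ts" "ts ! e = (i, j)" using assms by (auto simp: in_set_conv_nth)
  show "\<exists>p<2 * length ts. own p = i \<and> partner p = j"
    using e In_ts[OF e(1)] xor_1_even[of e] unfolding own_def partner_def
    by (intro exI[of _ "2 * e"]) auto
  show "\<exists>p<2 * length ts. own p = j \<and> partner p = i"
    using e In_ts[OF e(1)] xor_1_odd[of e] unfolding own_def partner_def
    by (intro exI[of _ "Suc (2 * e)"]) auto
qed

primrec prev :: "nat \<Rightarrow> nat \<Rightarrow> nat" where
  "prev b 0 = 0"
| "prev b (Suc x) = (if own x = b then Suc x else prev b x)"

text \<open>The number of entries of \<open>b\<close> among the first \<open>x\<close>, that is,
  what is left of its adjacency list at pointer \<open>x\<close>. It is the potential of the inner
  loop of the search.\<close>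

primrec cnt :: "nat \<Rightarrow> nat \<Rightarrow> nat" where
  "cnt b 0 = 0"
| "cnt b (Suc x) = cnt b x + of_bool (own x = b)"

lemma prev_le: "prev b x \<le> x"
  by (induction x) auto

lemma prev_own: "0 < prev b x \<Longrightarrow> own (prev b x - 1) = b"
  by (induction x) (auto split: if_splits)

lemma prev_gap: "prev b x \<le> p \<Longrightarrow> p < x \<Longrightarrow> own p \<noteq> b"
  by (induction x) (auto split: if_splits simp: less_Suc_eq)

lemma cnt_prev: "cnt b (prev b x) = cnt b x"
  by (induction x) auto

text \<open>Every entry is owned by exactly one bag. At \<open>x = 2 * length ts\<close> this is the
  handshake identity that makes the search linear.\<close>

lemma sum_cnt: "x \<le> 2 * length ts \<Longrightarrow> (\<Sum>b<length bs. cnt b x) = x"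
proof (induction x)
  case (Suc x)
  have "(\<Sum>b<length bs. of_bool (own x = b)) = (1::nat)"
    using own_partner(1)[of x] Suc.prems by (simp add: of_bool_def)
  then show ?case using Suc by (simp add: sum.distrib)
qed simp

text \<open>Entries are prepended in increasing order, so the head is the last entry of its bag and
  each link leads to the preceding entry of the same bag; both are values of
  \<open>prev\<close>.\<close>

lemma wp_adjacency:
  assumes "glob R A" "A 2 = (\<lambda>_. 0)"
  shows "wp adjacency (\<lambda>t R' A'. t \<le> 10 * length ts + 3 \<and> (\<forall>b. A' 2 b = prev b (2 * length ts)) \<and>
    (\<forall>p<2 * length ts. A' 3 (Suc p) = prev (own p) p) \<and> agree adjacency R A R' A') R A"
proof -
  have b: "2 * length ts < 2 ^ wd" using Z_ge small1 by auto
  have g: "R 4 = length ts" "R 6 = tb" "A 0 = In" using assms unfolding glob_def by auto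
  have "wp (For 20 21 (22 ::= Ld 0 (V 6 [+] V 20) ;;
     Sto 3 (V 20 [+] N 1) (Ld 2 (V 22)) ;; Sto 2 (V 22) (V 20 [+] N 1)))
    (\<lambda>t R' A'. Suc t \<le> 10 * length ts + 3 \<and> (\<forall>b. A' 2 b = prev b (2 * length ts)) \<and>
    (\<forall>p<2 * length ts. A' 3 (Suc p) = prev (own p) p) \<and> agree adjacency R A R' A')
    (R(21 := 2 * length ts)) A"
  proof (rule wp_For_conseq[where T = 3 and I = "\<lambda>j R A. (\<forall>b. A 2 b = prev b j) \<and>
    (\<forall>p<j. A 3 (Suc p) = prev (own p) p)"], goal_cases)
    case (6 j R' A')
    then have j: "j < 2 * length ts" by simp
    have ag: "R' 6 = tb" "A' 0 = In"
      using agree_R[OF 6(3), of 6] agree_A[OF 6(3), of 0] g by auto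
    have l: "tb + j < L" "tb + j < 2 ^ wd" "Suc j < 2 ^ wd"
      using j Z_ge length_inp small1[of "tb + j"] b by auto
    show ?case using 6(2,4) l by (simp add: ag own_def less_Suc_eq)
  next
    case (7 t R' A')
    then have "agree adjacency R A R' A'" unfolding agree_def adjacency_def by auto
    then show ?case using 7 by simp
  qed (use assms(2) b in auto)
  then show ?thesis unfolding adjacency_def using b by (simp add: g)
qed

definition adj :: "(nat \<times> nat) set" where
  "adj = {(i, j). \<exists>p<2 * length ts. own p = i \<and> partner p = j}"

definition bfs_list :: "nat list \<Rightarrow> bool" where
  "bfs_list qs \<longleftrightarrow> distinct qs \<and> set qs \<subseteq> {..<length bs} \<and> 0 < length qs \<and> qs ! 0 = 0 \<and>
     (\<forall>i<length qs. 0 < i \<longrightarrow> (\<exists>p<i. (qs ! p, qs ! i) \<in> adj))"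

definition bfs_inv :: "nat list \<Rightarrow> regs \<Rightarrow> arrs \<Rightarrow> bool" where
  "bfs_inv qs R A \<longleftrightarrow> bfs_list qs \<and> length qs = R 24 \<and> (\<forall>i<length qs. A 4 i = qs ! i) \<and>
     (\<forall>y<length bs. A 5 y = of_bool (y \<in> set qs)) \<and> R 23 \<le> R 24 \<and>
     (\<forall>i<R 23. \<forall>p<2 * length ts. own p = qs ! i \<longrightarrow> partner p \<in> set qs)"

definition static :: "regs \<Rightarrow> arrs \<Rightarrow> bool" where
  "static R A \<longleftrightarrow> R 6 = tb \<and> A 0 = In \<and> (\<forall>b. A 2 b = prev b (2 * length ts)) \<and>
    (\<forall>p<2 * length ts. A 3 (Suc p) = prev (own p) p)"

lemma bfs_list_len: "bfs_list qs \<Longrightarrow> length qs \<le> length bs"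
  unfolding bfs_list_def by (metis card_lessThan card_mono distinct_card finite_lessThan)

text \<open>The queue contents \<open>qs\<close> are bound existentially because the loop appends to
  them. Adjacency lists run downwards, so the entries of the current bag already handled are those
  from \<open>R 25\<close> on.\<close>

definition inner_inv :: "nat \<Rightarrow> regs \<Rightarrow> arrs \<Rightarrow> bool" where
  "inner_inv h R A \<longleftrightarrow> static R A \<and> R 23 = h \<and> h < R 24 \<and> R 25 \<le> 2 * length ts \<and>
     (\<exists>qs. bfs_inv qs R A \<and> (0 < R 25 \<longrightarrow> own (R 25 - 1) = qs ! h) \<and>
      (\<forall>p. R 25 \<le> p \<longrightarrow> p < 2 * length ts \<longrightarrow> own p = qs ! h \<longrightarrow> partner p \<in> set qs))"

lemma bfs_push:
  assumes inv: "bfs_inv qs R A" and y: "y < length bs" "y \<notin> set qs" and h: "h < length qs" "(qs ! h, y) \<in> adj"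
    and R': "R' 24 = Suc (R 24)" "R' 23 = R 23"
    and A': "A' 4 = (A 4)(R 24 := y)" "A' 5 = (A 5)(y := 1)"
  shows "bfs_inv (qs @ [y]) R' A'"
proof -
  have bl: "bfs_list qs" using inv unfolding bfs_inv_def by blast
  have "\<exists>p<i. ((qs @ [y]) ! p, (qs @ [y]) ! i) \<in> adj" if i: "i < length (qs @ [y])" "0 < i" for i
  proof (cases "i < length qs")
    case True
    then obtain p where "p < i" "(qs ! p, qs ! i) \<in> adj" using bl i unfolding bfs_list_def by blast
    then show ?thesis using True by (intro exI[of _ p]) (simp add: nth_append)
  next
    case False
    then have "i = length qs" using i by simp
    then show ?thesis using h by (intro exI[of _ h]) (simp add: nth_append)
  qed
  then have "bfs_list (qs @ [y])" using bl y unfolding bfs_list_def by (auto simp: nth_append)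
  then show ?thesis using inv y R' A' unfolding bfs_inv_def
    by (auto simp: nth_append less_Suc_eq)
qed

lemma wp_bfs_inner:
  assumes "inner_inv h R A" "\<forall>i\<le>h. A 4 i = f i" and fb: "f h = b"
  shows "wp bfs_inner (\<lambda>t R' A'. inner_inv h R' A' \<and> R' 25 = 0 \<and>
           (\<forall>i\<le>h. A' 4 i = f i) \<and> t \<le> 7 * cnt b (R 25) + 1) R A"
  unfolding bfs_inner_def
proof (rule wp_Loop_conseq[where I = "\<lambda>R A. inner_inv h R A \<and> (\<forall>i\<le>h. A 4 i = f i)" and \<Phi> = "\<lambda>R A. 7 * cnt b (R 25)"], goal_cases)
  case (3 R A)
  obtain qs where q: "bfs_inv qs R A" "own (R 25 - 1) = qs ! h"
      "\<forall>p. R 25 \<le> p \<longrightarrow> p < 2 * length ts \<longrightarrow> own p = qs ! h \<longrightarrow> partner p \<in> set qs"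
    and st: "static R A" "R 23 = h" "h < R 24" "R 25 \<le> 2 * length ts" "0 < R 25"
    using 3 unfolding inner_inv_def by auto
  define p where "p = R 25 - 1"
  have p: "R 25 = Suc p" "p < 2 * length ts" using st unfolding p_def by auto
  note op = own_partner[OF p(2)]
  have hq: "h < length qs" "qs ! h = b" using q(1) st 3 fb unfolding bfs_inv_def by auto
  have fA: "\<forall>i\<le>h. A 4 i = f i" using 3 by blast
  have ob: "own p = b" using q(2) hq p by simp
  have yq: "(qs ! h, partner p) \<in> adj" unfolding adj_def using p ob hq by auto
  have l: "tb + Bit_Operations.xor p (Suc 0) < L" "tb + Bit_Operations.xor p (Suc 0) < 2 ^ wd"
    using op(3) Z_ge small1 by auto
  \<comment> \<open>The queue pointer cannot overflow: the longer queue still lists distinct bags,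
    so its length is at most \<open>length bs\<close>.\<close>
  have t: "Suc (R 24) < 2 ^ wd" if "partner p \<notin> set qs"
  proof -
    have "Suc (length qs) \<le> length bs" using bfs_list_len[OF bfs_push[OF q(1) op(2) that hq(1) yq,
        of "R(24 := Suc (R 24))" "A(4 := (A 4)(R 24 := partner p), 5 := (A 5)(partner p := 1))",
        unfolded bfs_inv_def, THEN conjunct1]] by simp
    then show ?thesis using q(1) Z_ge small1[of "Suc (R 24)"] unfolding bfs_inv_def by auto
  qed
  have In: "A 0 (tb + Bit_Operations.xor p (Suc 0)) = partner p" "R 6 = tb" "A 3 (Suc p) = prev b p"
    using st p ob unfolding static_def partner_def by auto
  have vis: "A 5 (partner p) = of_bool (partner p \<in> set qs)" using q(1) op(2) unfolding bfs_inv_def by auto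
  have c: "cnt b (prev b p) + 1 = cnt b (Suc p)" using ob cnt_prev by simp
  have fin: "inner_inv h R' A'"
    if i: "bfs_inv qs' R' A'" and s: "set qs' = insert (partner p) (set qs)" "qs' ! h = b"
      and R': "R' 25 = prev b p" "R' 23 = h" "R 24 \<le> R' 24" "R' 6 = tb"
      and A': "A' 0 = A 0" "A' 2 = A 2" "A' 3 = A 3" for R' A' qs'
  proof -
    have 2: "partner p' \<in> set qs'" if "prev b p \<le> p'" "p' < 2 * length ts" "own p' = b" for p'
    proof -
      have "p \<le> p'" using prev_gap[OF that(1)] that(3) by (meson not_le)
      then consider "p' = p" | "R 25 \<le> p'" using p(1) by linarith
      then show ?thesis using q(3) that s hq by cases auto
    qed
    have "prev b p \<le> 2 * length ts" using prev_le[of b p] p(2) by simp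
    then show ?thesis
      using 2 i R' A' st prev_own[of b p] s(2)
      unfolding inner_inv_def static_def by auto
  qed
  show ?case
  proof (cases "partner p \<in> set qs")
    case True
    have i: "bfs_inv qs (R(26 := partner p, 97 := 0, 25 := prev b p)) A"
      using q(1) unfolding bfs_inv_def by simp
    have f: "inner_inv h (R(26 := partner p, 97 := 0, 25 := prev b p)) A"
      by (rule fin[OF i]) (use True hq st In in auto)
    show ?thesis using f fA True c l by (simp add: p(1) In vis del: cnt.simps)
  next
    case False
    let ?R = "R(26 := partner p, 24 := Suc (R 24), 25 := prev b p)"
    let ?A = "A(5 := (A 5)(partner p := 1), 4 := (A 4)(R 24 := partner p))"
    have i: "bfs_inv (qs @ [partner p]) ?R ?A"
      by (rule bfs_push[OF q(1) op(2) False hq(1) yq]) auto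
    have f: "inner_inv h ?R ?A"
      by (rule fin[OF i]) (use hq st In in \<open>auto simp: nth_append\<close>)
    show ?thesis using f fA st(3) False c l t by (simp add: p(1) In vis del: cnt.simps)
  qed
qed (use assms in auto)

lemma wp_bfs:
  assumes g: "glob R A" and a: "\<forall>b. A 2 b = prev b (2 * length ts)"
    "\<forall>p<2 * length ts. A 3 (Suc p) = prev (own p) p" "A 4 = (\<lambda>_. 0)" "A 5 = (\<lambda>_. 0)" and nb: "0 < length bs"
  shows "wp bfs (\<lambda>t R' A'. t \<le> 14 * length ts + 4 * length bs + 4 \<and> agree bfs R A R' A' \<and>
    (\<exists>qs. bfs_list qs \<and> (\<forall>i<length qs. A' 4 i = qs ! i) \<and>
      (\<forall>i\<in>set qs. \<forall>j. (i, j) \<in> adj \<longrightarrow> j \<in> set qs))) R A"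
proof -
  let ?c = "\<lambda>b. 7 * cnt b (2 * length ts) + 4"
  \<comment> \<open>Every bag not yet taken from the queue holds the credit for its own round: 7 for
    each of its adjacency entries and 4 for the outer loop.\<close>
  let ?\<Phi> = "\<lambda>R A. \<Sum>b\<in>{..<length bs} - A 4 ` {..<R 23}. ?c b"
  let ?I = "\<lambda>R A. static R A \<and> (\<exists>qs. bfs_inv qs R A)"
  have \<Phi>0: "?\<Phi> (R(23 := 0, 24 := 1)) (A(5 := (A 5)(0 := 1))) = 14 * length ts + 4 * length bs"
    using sum_cnt[of "2 * length ts"] by (simp add: sum.distrib sum_distrib_left[symmetric])
  have "wp bfs_loop (\<lambda>t R' A'. t + 3 \<le> 14 * length ts + 4 * length bs + 4 \<and>
    (\<exists>qs. bfs_list qs \<and> (\<forall>i<length qs. A' 4 i = qs ! i) \<and>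
      (\<forall>i\<in>set qs. \<forall>j. (i, j) \<in> adj \<longrightarrow> j \<in> set qs)))
    (R(23 := 0, 24 := 1)) (A(5 := (A 5)(0 := 1)))"
    unfolding bfs_loop_def
    proof (rule wp_Loop_conseq[where I = ?I and \<Phi> = ?\<Phi>], goal_cases)
      case 1
      have "bfs_inv [0] (R(23 := 0, 24 := 1)) (A(5 := (A 5)(0 := 1)))"
        using a nb unfolding bfs_inv_def bfs_list_def by auto
      then show ?case using g a unfolding static_def glob_def by auto
    next
      case (3 R A)
      then obtain qs where q: "bfs_inv qs R A" and h: "R 23 < length qs" and st: "static R A"
        unfolding bfs_inv_def by (auto split: if_splits)
      define b where "b = A 4 (R 23)"
      have b: "b = qs ! R 23" "b < length bs" using q h unfolding b_def bfs_inv_def bfs_list_def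
        by (auto simp: subset_eq)
      have A2: "A 2 b = prev b (2 * length ts)" using st unfolding static_def by blast
      let ?R = "R(25 := prev b (2 * length ts))"
      have iv: "inner_inv (R 23) ?R A"
      proof -
        have "bfs_inv qs ?R A" using q unfolding bfs_inv_def by simp
        moreover have "static ?R A" using st unfolding static_def by simp
        moreover have "prev b (2 * length ts) \<le> 2 * length ts" by (rule prev_le)
        moreover have "R 23 < R 24" using h q unfolding bfs_inv_def by simp
        ultimately show ?thesis using prev_own[of b "2 * length ts"] prev_gap[of b "2 * length ts"] b(1)
          unfolding inner_inv_def by (auto intro!: exI[of _ qs])
      qed
      show ?case
        apply (simp add: A2 b_def[symmetric])
        apply (rule wp_agree_mono[OF wp_bfs_inner[OF iv, of "A 4", OF _ b_def[symmetric]]], simp)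
      proof (goal_cases)
        case (1 t R' A')
        then have r: "R' 23 = R 23" "A' 4 (R 23) = b" "R' 25 = 0" "static R' A'" "R' 23 < R' 24"
            unfolding inner_inv_def b_def by auto
        obtain qs' where q': "bfs_inv qs' R' A'"
          "\<forall>p. p < 2 * length ts \<longrightarrow> own p = qs' ! (R 23) \<longrightarrow> partner p \<in> set qs'"
          using 1 unfolding inner_inv_def by auto
        have t: "t \<le> 7 * cnt b (2 * length ts) + 1" using 1 by (simp add: cnt_prev)
        have len: "R' 24 \<le> length bs" using q'(1) bfs_list_len[of qs'] unfolding bfs_inv_def by simp
        have "bfs_inv qs' (R'(23 := Suc (R 23))) A'"
          using q' r unfolding bfs_inv_def by (auto simp: less_Suc_eq)
        moreover have "static (R'(23 := Suc (R 23))) A'" using r unfolding static_def by simp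
        moreover have "Suc (R 23) < 2 ^ wd" using r len Z_ge small1[of "Suc (R 23)"] by auto
        moreover have "t + 3 + (\<Sum>b\<in>{..<length bs} - A' 4 ` {..<Suc (R 23)}. ?c b) \<le> ?\<Phi> R A"
        proof -
          have A4: "A' 4 i = A 4 i" if "i < R 23" for i
            using 1 that by simp
          have "A' 4 ` {..<Suc (R 23)} = insert b (A 4 ` {..<R 23})"
            using r A4 by (auto simp: lessThan_Suc)
          then have S: "{..<length bs} - A' 4 ` {..<Suc (R 23)} = {..<length bs} - insert b (A 4 ` {..<R 23})"
            by (simp only:)
          have "b \<notin> A 4 ` {..<R 23}"
          proof
            assume "b \<in> A 4 ` {..<R 23}"
            then obtain i where "i < R 23" "b = A 4 i" by auto
            then show False using b(1) q h unfolding bfs_inv_def bfs_list_def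
              by (auto simp: nth_eq_iff_index_eq)
          qed
          then have e: "{..<length bs} - A 4 ` {..<R 23} = insert b ({..<length bs} - insert b (A 4 ` {..<R 23}))"
            using b(2) by blast
          have "?\<Phi> R A = ?c b + (\<Sum>b\<in>{..<length bs} - A' 4 ` {..<Suc (R 23)}. ?c b)"
            unfolding S e by (rule sum.insert) auto
          then show ?thesis using t by simp
        qed
        ultimately show ?case using r by auto
      qed
    next
      case (4 t R' A')
      then obtain qs where q: "bfs_inv qs R' A'" by blast
      have "R' 23 = length qs" using 4 q unfolding bfs_inv_def by (auto split: if_splits)
      then have "\<forall>i\<in>set qs. \<forall>j. (i, j) \<in> adj \<longrightarrow> j \<in> set qs"
        using q unfolding bfs_inv_def adj_def by (auto simp: in_set_conv_nth)
      then show ?case using 4(3) q \<Phi>0 unfolding bfs_inv_def by auto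
    qed simp
  then have "wp bfs (\<lambda>t R' A'. t \<le> 14 * length ts + 4 * length bs + 4 \<and>
    (\<exists>qs. bfs_list qs \<and> (\<forall>i<length qs. A' 4 i = qs ! i) \<and>
      (\<forall>i\<in>set qs. \<forall>j. (i, j) \<in> adj \<longrightarrow> j \<in> set qs))) R A"
    unfolding bfs_def by simp
  then show ?thesis by (rule wp_agree_mono) blast
qed

end

section \<open>Discovery order, colouring and parents of the vertices\<close>

definition scan_seen :: stm where
  "scan_seen = For 34 33 (35 ::= Ld 0 (V 32 [+] V 34) ;;
     Cond (Ld 6 (V 35)) (36 ::= (V 36 [or] (N 1 [shl] Ld 7 (V 35))) ;;
       Cond (V 37 [<] Ld 6 (V 35)) (37 ::= Ld 6 (V 35)) Skip) Skip)"

definition free_colour :: stm where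
  "free_colour = (39 ::= N 0 ;; Loop ((V 36 [shr] V 39) [and] N 1) (39 ::= V 39 [+] N 1))"

definition scan_new :: stm where
  "scan_new = For 34 33 (35 ::= Ld 0 (V 32 [+] V 34) ;;
     Cond (Ld 6 (V 35)) Skip (free_colour ;;
       Sto 7 (V 35) (V 39) ;; Sto 8 (V 35) (V 36) ;; Sto 9 (V 35) (Ld 10 (V 37)) ;;
       38 ::= V 38 [+] N 1 ;; Sto 6 (V 35) (V 38) ;; Sto 10 (V 38) (V 35) ;; 37 ::= V 38 ;;
       36 ::= (V 36 [or] (N 1 [shl] V 39))))"

text \<open>Both scans treat \<open>s\<close> as a member of every bag. The mask of used colours
  starts as 1 because \<open>s\<close> has colour 0, and the number of the latest discovered member
  starts as 1, the number of \<open>s\<close>.\<close>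

definition discover_loop :: stm where
  "discover_loop = For 30 3 (31 ::= Ld 4 (V 30) ;; 32 ::= Ld 1 (V 31) [+] N 1 ;;
     33 ::= Ld 0 (Ld 1 (V 31)) ;; 36 ::= N 1 ;; 37 ::= N 1 ;; scan_seen ;; scan_new)"

definition discover :: stm where
  "discover = (Sto 6 (V 1) (N 1) ;; Sto 10 (N 1) (V 1) ;; 38 ::= N 1 ;; discover_loop)"

lemma drop_bit_mod_2 [simp]: "drop_bit c a mod 2 = of_bool (bit a c)" for a :: nat
  by (simp add: bit_iff_odd_drop_bit mod_2_eq_odd)

lemma bit_or_exp: "bit (Bit_Operations.or a (2 ^ c)) i \<longleftrightarrow> bit a i \<or> i = c" for a :: nat
  by (auto simp: bit_or_iff bit_exp_iff)

text \<open>Vertices are numbered by \<open>ix\<close> in the order of discovery, starting with 1; 0 stands for undiscovered.\<close>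

definition earlier :: "(nat \<Rightarrow> nat) \<Rightarrow> nat set \<Rightarrow> nat \<Rightarrow> nat set" where
  "earlier ix b v = {w \<in> b. 0 < ix w \<and> ix w < ix v}"

context instance_input
begin

definition kk :: nat where "kk = mx (length bs)"
text \<open>One colour for each vertex of a bag, and an additional one for \<open>s\<close>, which is added to all bags.\<close>

definition K :: nat where "K = Suc kk"

lemma bag_le: "b \<in> set bs \<Longrightarrow> length b \<le> kk"
  unfolding kk_def mx_def by auto

text \<open>\<open>f\<close> is the position of the topmost bag of \<open>v\<close>.\<close>

definition good :: "(nat \<Rightarrow> nat set) \<Rightarrow> nat \<Rightarrow> (nat \<Rightarrow> nat) \<Rightarrow> (nat \<Rightarrow> nat) \<Rightarrow> (nat \<Rightarrow> nat) \<Rightarrow>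
    (nat \<Rightarrow> nat) \<Rightarrow> nat \<Rightarrow> bool" where
  "good \<beta> j ix col mk par v \<longleftrightarrow> (\<exists>f<j. v \<in> \<beta> f \<and> (\<forall>i<f. \<forall>w\<in>\<beta> i. 0 < ix w \<and> ix w < ix v) \<and>
     (\<forall>c. bit (mk v) c \<longleftrightarrow> c \<in> col ` earlier ix (insert s (\<beta> f)) v) \<and>
     col v \<notin> col ` earlier ix (insert s (\<beta> f)) v \<and>
     par v \<in> earlier ix (insert s (\<beta> f)) v \<and>
     (\<forall>w\<in>earlier ix (insert s (\<beta> f)) v. ix w \<le> ix (par v)))"

definition dinv :: "(nat \<Rightarrow> nat set) \<Rightarrow> nat \<Rightarrow> nat set \<Rightarrow> nat \<Rightarrow> (nat \<Rightarrow> nat) \<Rightarrow> (nat \<Rightarrow> nat) \<Rightarrow> (nat \<Rightarrow> nat) \<Rightarrow>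
    (nat \<Rightarrow> nat) \<Rightarrow> (nat \<Rightarrow> nat) \<Rightarrow> bool" where
  "dinv \<beta> j Sn m ix col mk par ord \<longleftrightarrow> ix s = 1 \<and> col s = 0 \<and> s \<in> Sn \<and> ord 1 = s \<and> (\<forall>v. 0 < ix v \<longleftrightarrow> v \<in> Sn) \<and>
     (\<forall>v\<in>Sn. ix v \<le> m \<and> ord (ix v) = v \<and> v < n \<and> col v < K) \<and>
     (\<forall>i. 1 \<le> i \<longrightarrow> i \<le> m \<longrightarrow> ord i \<in> Sn \<and> ix (ord i) = i) \<and>
     (\<forall>v\<in>Sn - {s}. good \<beta> j ix col mk par v)"

text \<open>\<open>used\<close> collects the colours of the discovered members of the bag, and
  \<open>lst\<close> is the number of the latest of them, which becomes the parent of the next new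
  vertex.\<close>

definition binv :: "nat set \<Rightarrow> nat set \<Rightarrow> nat \<Rightarrow> nat \<Rightarrow> nat \<Rightarrow> (nat \<Rightarrow> nat) \<Rightarrow> (nat \<Rightarrow> nat) \<Rightarrow> (nat \<Rightarrow> nat) \<Rightarrow> bool" where
  "binv b Sn used lst m ix col ord \<longleftrightarrow> (\<forall>c. bit used c \<longleftrightarrow> c \<in> col ` (insert s b \<inter> Sn)) \<and>
     1 \<le> lst \<and> lst \<le> m \<and> ord lst \<in> insert s b \<and> (\<forall>w\<in>insert s b \<inter> Sn. ix w \<le> lst)"

text \<open>The record of \<open>v\<close> looks only at smaller discovery numbers, so vertices
  discovered later cannot disturb it.\<close>

lemma good_upd:
  assumes "good \<beta> j ix col mk par v" "ix u = 0" "ix v < m" "v \<noteq> u"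
  shows "good \<beta> j (ix(u := m)) (col(u := c)) (mk(u := d)) (par(u := p)) v"
proof -
  obtain f where f: "f < j" "v \<in> \<beta> f" "\<forall>i<f. \<forall>w\<in>\<beta> i. 0 < ix w \<and> ix w < ix v"
     "\<forall>c. bit (mk v) c \<longleftrightarrow> c \<in> col ` earlier ix (insert s (\<beta> f)) v"
     "col v \<notin> col ` earlier ix (insert s (\<beta> f)) v"
     "par v \<in> earlier ix (insert s (\<beta> f)) v"
     "\<forall>w\<in>earlier ix (insert s (\<beta> f)) v. ix w \<le> ix (par v)"
    using assms(1) unfolding good_def by blast
  have e: "earlier (ix(u := m)) (insert s (\<beta> f)) v = earlier ix (insert s (\<beta> f)) v"
    using assms(2-4) unfolding earlier_def by auto
  have nu: "u \<notin> earlier ix (insert s (\<beta> f)) v" using assms(2) unfolding earlier_def by simp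
  then have c: "(col(u := c)) ` earlier ix (insert s (\<beta> f)) v = col ` earlier ix (insert s (\<beta> f)) v"
    by (intro image_cong) auto
  have "\<forall>i<f. \<forall>w\<in>\<beta> i. 0 < (ix(u := m)) w \<and> (ix(u := m)) w < (ix(u := m)) v"
    using f(3) assms(2,4) by (metis fun_upd_apply less_irrefl)
  moreover have "par v \<noteq> u" using f(6) nu by blast
  moreover have "\<forall>w\<in>earlier ix (insert s (\<beta> f)) v. w \<noteq> u" using nu by blast
  ultimately show ?thesis
    unfolding good_def using f e c assms(4) by (intro exI[of _ f]) auto
qed

text \<open>Being undiscovered, \<open>u\<close> is in no earlier bag, so bag \<open>j\<close> is
  its topmost bag and the members discovered so far are exactly its earlier neighbours. Mask and
  parent can therefore be copied from the running values \<open>used\<close> and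
  \<open>lst\<close>.\<close>

lemma dinv_new:
  assumes d: "dinv \<beta> (Suc j) Sn m ix col mk par ord" and b: "binv (\<beta> j) Sn used lst m ix col ord"
    and u: "u \<in> \<beta> j" "u \<notin> Sn" "u < n" and c: "c < K" "\<not> bit used c"
    and seen: "\<And>i. i < j \<Longrightarrow> \<beta> i \<subseteq> Sn"
  shows "dinv \<beta> (Suc j) (insert u Sn) (Suc m) (ix(u := Suc m)) (col(u := c)) (mk(u := used))
      (par(u := ord lst)) (ord(Suc m := u))"
    and "binv (\<beta> j) (insert u Sn) (Bit_Operations.or used (2 ^ c)) (Suc m) (Suc m)
      (ix(u := Suc m)) (col(u := c)) (ord(Suc m := u))"
proof -
  note D = d[unfolded dinv_def] and B = b[unfolded binv_def]
  have u0: "ix u = 0" using D u(2) by (metis gr0I)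
  have us: "u \<noteq> s" using D u(2) by blast
  have Sm: "ix v \<le> m" "0 < ix v" "ord (ix v) = v" if "v \<in> Sn" for v using D that by auto
  let ?e = "earlier (ix(u := Suc m)) (insert s (\<beta> j)) u"
  have e: "?e = insert s (\<beta> j) \<inter> Sn"
    using Sm D u(2) unfolding earlier_def by (auto simp: le_imp_less_Suc)
  have nu: "u \<notin> ?e" using e u by blast
  then have ce: "(col(u := c)) ` ?e = col ` ?e" by (intro image_cong) auto
  have lst: "ord lst \<in> Sn" "ix (ord lst) = lst" "ord lst \<in> ?e" using D B e by auto
  have gu: "good \<beta> (Suc j) (ix(u := Suc m)) (col(u := c)) (mk(u := used)) (par(u := ord lst)) u"
    unfolding good_def
  proof (intro exI[of _ j] conjI)
    show "\<forall>i<j. \<forall>w\<in>\<beta> i. 0 < (ix(u := Suc m)) w \<and> (ix(u := Suc m)) w < (ix(u := Suc m)) u"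
    proof (intro allI impI ballI)
      fix i w assume "i < j" "w \<in> \<beta> i"
      then have "w \<in> Sn" "w \<noteq> u" using seen u by blast+
      then show "0 < (ix(u := Suc m)) w \<and> (ix(u := Suc m)) w < (ix(u := Suc m)) u" using Sm[of w] by simp
    qed
    show "\<forall>ca. bit ((mk(u := used)) u) ca \<longleftrightarrow> ca \<in> (col(u := c)) ` ?e"
      unfolding ce using B e by simp
    show "(col(u := c)) u \<notin> (col(u := c)) ` ?e" unfolding ce using B e c by simp
    show "(par(u := ord lst)) u \<in> ?e" using lst by simp
    show "\<forall>w\<in>?e. (ix(u := Suc m)) w \<le> (ix(u := Suc m)) ((par(u := ord lst)) u)"
    proof
      fix w assume w: "w \<in> ?e"
      then have "w \<noteq> u" "ix w \<le> lst" using nu B e by auto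
      moreover have "ord lst \<noteq> u" using lst(1) u by blast
      ultimately show "(ix(u := Suc m)) w \<le> (ix(u := Suc m)) ((par(u := ord lst)) u)"
        using lst(2) by simp
    qed
  qed (use u in auto)
  have gv: "good \<beta> (Suc j) (ix(u := Suc m)) (col(u := c)) (mk(u := used)) (par(u := ord lst)) v"
    if "v \<in> Sn - {s}" for v
    by (rule good_upd) (use D that u0 u(2) Sm in \<open>auto simp: le_imp_less_Suc\<close>)
  have ord: "(ord(Suc m := u)) i \<in> insert u Sn \<and> (ix(u := Suc m)) ((ord(Suc m := u)) i) = i"
    if "1 \<le> i" "i \<le> Suc m" for i
  proof (cases "i = Suc m")
    case False
    then have "ord i \<in> Sn" "ix (ord i) = i" using D that by auto
    then show ?thesis using False u by auto
  qed simp
  have m: "1 \<le> m" using B by linarith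
  have v: "(ix(u := Suc m)) v \<le> Suc m \<and> (ord(Suc m := u)) ((ix(u := Suc m)) v) = v \<and> v < n \<and> (col(u := c)) v < K"
    if "v \<in> insert u Sn" for v
    using that D u c Sm[of v] by (cases "v = u") auto
  have "0 < (ix(u := Suc m)) v \<longleftrightarrow> v \<in> insert u Sn" for v using D by auto
  then show "dinv \<beta> (Suc j) (insert u Sn) (Suc m) (ix(u := Suc m)) (col(u := c)) (mk(u := used))
      (par(u := ord lst)) (ord(Suc m := u))"
    unfolding dinv_def using gu gv ord v D us m by auto
  have "insert s (\<beta> j) \<inter> insert u Sn = insert u (insert s (\<beta> j) \<inter> Sn)" using u by blast
  moreover have "(col(u := c)) ` (insert s (\<beta> j) \<inter> Sn) = col ` (insert s (\<beta> j) \<inter> Sn)"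
    using u(2) by (intro image_cong) auto
  ultimately show "binv (\<beta> j) (insert u Sn) (Bit_Operations.or used (2 ^ c)) (Suc m) (Suc m)
      (ix(u := Suc m)) (col(u := c)) (ord(Suc m := u))"
    unfolding binv_def bit_or_exp using B u Sm by (auto simp: le_SucI)
qed

text \<open>Pigeonhole: \<open>u\<close> itself has no colour yet, so the discovered members of the
  bag together with \<open>s\<close> are at most \<open>kk\<close> vertices, one less than the
  number \<open>K\<close> of colours.\<close>

lemma free_colour_ex:
  assumes d: "dinv \<beta> j' Sn m ix col mk par ord" and b: "binv (\<beta> j) Sn used lst m ix col ord"
    and u: "u \<in> \<beta> j" "u \<notin> Sn" and card: "card (\<beta> j) \<le> kk" and fin: "finite (\<beta> j)"
  shows "\<exists>c<K. \<not> bit used c"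
proof (rule ccontr)
  assume "\<not> ?thesis"
  then have "{..<K} \<subseteq> col ` (insert s (\<beta> j) \<inter> Sn)" using b unfolding binv_def by blast
  also have "\<dots> \<subseteq> col ` insert s (\<beta> j - {u})" using u by blast
  finally have "K \<le> card (col ` insert s (\<beta> j - {u}))"
    using card_mono[of "col ` insert s (\<beta> j - {u})" "{..<K}"] fin by simp
  also have "\<dots> \<le> card (insert s (\<beta> j - {u}))" using fin by (intro card_image_le) simp
  also have "\<dots> \<le> Suc (card (\<beta> j - {u}))" by (simp add: card_insert_if fin)
  also have "\<dots> = card (\<beta> j)" using u(1) fin by (metis card.remove)
  finally show False using card unfolding K_def by simp
qed

lemma mx_less: "mx (length bs) < Z"
proof -
  have "length b < Z" if b: "b \<in> set bs" for b
  proof -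
    obtain j where "j < length bs" "bs ! j = b" using b by (auto simp: in_set_conv_nth)
    then show ?thesis using off_less[of j] Z_ge(7) by simp
  qed
  then show ?thesis unfolding mx_def using Z_ge(1) by simp
qed

lemma K_less: "K < Z * Z" "K < 2 ^ wd"
proof -
  have "2 * Z \<le> Z * Z" using Z_ge(1) by (intro mult_right_mono) auto
  then show "K < Z * Z" using mx_less Z_ge(1) unfolding K_def kk_def by linarith
  then show "K < 2 ^ wd" by (rule small2)
qed

text \<open>A linear search that stops no later than at the given free colour \<open>c\<close>. It
  is the reason why the time per bag is quadratic in its size bound.\<close>

lemma wp_free_colour:
  assumes "\<not> bit (R 36) c" "c < K"
  shows "wp free_colour (\<lambda>t R' A'. t \<le> 2 * K + 2 \<and> A' = A \<and> R' = R(39 := R' 39) \<and>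
    R' 39 < K \<and> \<not> bit (R 36) (R' 39)) R A"
proof -
  have "wp (Loop ((V 36 [shr] V 39) [and] N 1) (39 ::= V 39 [+] N 1))
    (\<lambda>t R' A'. t \<le> 2 * K + 1 \<and> A' = A \<and> R' = R(39 := R' 39) \<and>
    R' 39 < K \<and> \<not> bit (R 36) (R' 39)) (R(39 := 0)) A"
  proof (rule wp_Loop_conseq[where I = "\<lambda>R' A'. A' = A \<and> R' = R(39 := R' 39) \<and> R' 39 \<le> c"
      and \<Phi> = "\<lambda>R A. 2 * (c - R 39)"], goal_cases)
    case (3 R' A')
    have R': "R' = R(39 := R' 39)" "R' 39 \<le> c" using 3 by auto
    have e: "R' 36 = R 36" using fun_cong[OF R'(1), of 36] by simp
    have "R' 39 < c" using 3 e R'(2) assms(1) by (cases "R' 39 = c") auto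
    moreover have "Suc (R' 39) < 2 ^ wd" using calculation assms(2) K_less by simp
    moreover have "R'(39 := x) = R(39 := x)" for x using R'(1) by (metis fun_upd_upd)
    ultimately show ?case using 3 by (simp add: diff_Suc_1 Suc_diff_Suc[symmetric] del: fun_upd_apply) simp
  next
    case (4 t R' A')
    have R': "R' = R(39 := R' 39)" using 4 by auto
    have e: "R' 36 = R 36" using fun_cong[OF R'(1), of 36] by simp
    show ?case using 4 e assms(2) by auto
  qed auto
  then show ?thesis unfolding free_colour_def by simp
qed


lemma binv_seen:
  assumes "binv B Sn used lst m ix col ord" "u \<in> Sn" "ord (ix u) = u" "0 < ix u" "ix u \<le> m"
  shows "binv (insert u B) Sn (Bit_Operations.or used (2 ^ col u)) (max lst (ix u)) m ix col ord"
proof -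
  note b = assms(1)[unfolded binv_def]
  have e: "insert s (insert u B) \<inter> Sn = insert u (insert s B \<inter> Sn)" using assms(2) by blast
  have "bit (Bit_Operations.or used (2 ^ col u)) c \<longleftrightarrow> c \<in> col ` insert u (insert s B \<inter> Sn)" for c
    unfolding bit_or_exp using b by auto
  moreover have "ix w \<le> max lst (ix u)" if "w \<in> insert u (insert s B \<inter> Sn)" for w
    using b that by (cases "w = u") (simp, meson insertE max.coboundedI1)
  moreover have "ord (max lst (ix u)) \<in> insert s (insert u B)" "max lst (ix u) \<le> m" "1 \<le> max lst (ix u)"
    using assms(3-5) b by (auto simp: max_def)
  ultimately show ?thesis unfolding binv_def e by simp
qed

lemma binv_unseen:
  assumes "binv B Sn used lst m ix col ord" "u \<notin> Sn"
  shows "binv (insert u B) Sn used lst m ix col ord"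
proof -
  have "insert s (insert u B) \<inter> Sn = insert s B \<inter> Sn" using assms(2) by blast
  then show ?thesis using assms unfolding binv_def by auto
qed

definition dstate :: "nat list \<Rightarrow> nat \<Rightarrow> nat set \<Rightarrow> regs \<Rightarrow> arrs \<Rightarrow> bool" where
  "dstate qs j Sn R A \<longleftrightarrow> dinv (\<lambda>i. set (bs ! (qs ! i))) j Sn (R 38) (A 6) (A 7) (A 8) (A 9) (A 10)"

definition bstate :: "nat set \<Rightarrow> nat set \<Rightarrow> regs \<Rightarrow> arrs \<Rightarrow> bool" where
  "bstate B Sn R A \<longleftrightarrow> binv B Sn (R 36) (R 37) (R 38) (A 6) (A 7) (A 10)"

lemma bag_access:
  assumes "bi < length bs" "t < length (bs ! bi)"
  shows "In (Suc (off bi + t)) = bs ! bi ! t" "Suc (off bi + t) < L" "Suc (off bi + t) < 2 ^ wd"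
    "bs ! bi ! t < n"
proof -
  show "In (Suc (off bi + t)) = bs ! bi ! t" by (rule In_bag(2)) fact+
  have "Suc (off bi + t) < tb" using off_less[OF assms(1)] assms(2) by simp
  then show "Suc (off bi + t) < L" "Suc (off bi + t) < 2 ^ wd"
    using Z_ge length_inp small1[of "Suc (off bi + t)"] by auto
  show "bs ! bi ! t < n" using bs_less[of "bs ! bi"] assms by (metis lessThan_iff nth_mem subset_eq)
qed

lemma bag_length_small: "bi < length bs \<Longrightarrow> length (bs ! bi) < 2 ^ wd"
  using off_less[of bi] Z_ge small1[of "length (bs ! bi)"] by simp

lemma wp_scan_seen:
  assumes g: "A 0 = In" "R 32 = Suc (off bi)" "R 33 = length (bs ! bi)" "bi < length bs"
    and d: "dstate qs j Sn R A" and r: "R 36 = 1" "R 37 = 1" and P: "2 ^ K < (2::nat) ^ wd"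
    and m: "1 \<le> R 38"
  shows "wp scan_seen (\<lambda>t R' A'. t \<le> 7 * kk + 2 \<and> bstate (set (bs ! bi)) Sn R' A' \<and> agree scan_seen R A R' A') R A"
  unfolding scan_seen_def
proof (rule wp_For_conseq[where T = 5 and I = "\<lambda>t R A. bstate (set (take t (bs ! bi))) Sn R A"], goal_cases)
  case 5
  show ?case using d r m unfolding bstate_def dstate_def dinv_def binv_def
    by (auto simp: bit_1_iff bit_Suc_0_iff)
next
  case (6 t R' A')
  have t: "t < length (bs ! bi)" using 6(1) g by simp
  have ag: "R' 32 = Suc (off bi)" "A' 0 = In" "A' 6 = A 6" "A' 7 = A 7" "A' 10 = A 10" "R' 38 = R 38"
    using agree_R[OF 6(3)] agree_A[OF 6(3)] g by auto
  note ba = bag_access[OF g(4) t]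
  define u where "u = bs ! bi ! t"
  note D = d[unfolded dstate_def dinv_def]
  have tk: "set (take (Suc t) (bs ! bi)) = insert u (set (take t (bs ! bi)))"
    using t by (simp add: take_Suc_conv_app_nth u_def)
  show ?case
  proof (cases "u \<in> Sn")
    case False
    then have "A 6 u = 0" using D by (metis gr0I)
    then show ?thesis using 6(2,4) ba binv_unseen[of _ Sn, OF _ False]
      by (simp add: ag u_def[symmetric] tk bstate_def)
  next
    case True
    then have u: "0 < A 6 u" "A 6 u \<le> R 38" "A 10 (A 6 u) = u" "A 7 u < K" using D by auto
    have "2 ^ A 7 u \<le> (2::nat) ^ K" using u(4) by (intro power_increasing) auto
    then have c: "2 ^ A 7 u < (2::nat) ^ wd" using P by linarith
    have "binv (insert u (set (take t (bs ! bi)))) Sn (Bit_Operations.or (R' 36) (2 ^ A 7 u))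
      (max (R' 37) (A 6 u)) (R 38) (A 6) (A 7) (A 10)"
      by (rule binv_seen) (use 6(2) True u in \<open>auto simp: bstate_def ag\<close>)
    then show ?thesis using 6(4) ba u c
      by (auto simp: ag u_def[symmetric] tk bstate_def max_def)
  qed
next
  case (7 t R' A')
  have "length (bs ! bi) * 7 \<le> kk * 7" using bag_le[of "bs ! bi"] g by (intro mult_right_mono) auto
  then show ?case using 7 g by (auto simp: scan_seen_def)
qed (use g bag_length_small in auto)

lemma cnt_le:
  assumes "dinv \<beta> j Sn m ix col mk par ord"
  shows "m \<le> n"
proof -
  have "inj_on ord {1..m}" using assms unfolding dinv_def inj_on_def by (metis atLeastAtMost_iff)
  moreover have "ord ` {1..m} \<subseteq> {..<n}" using assms unfolding dinv_def by auto
  ultimately show ?thesis using card_inj_on_le[of ord "{1..m}" "{..<n}"] by simp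
qed

lemma wp_scan_new:
  assumes g: "A 0 = In" "R 32 = Suc (off bi)" "R 33 = length (bs ! bi)" "bi < length bs" "qs ! j = bi"
    and d: "dstate qs (Suc j) Sn R A" and b: "bstate (set (bs ! bi)) Sn R A"
    and P: "2 ^ K < (2::nat) ^ wd" and seen: "\<And>i. i < j \<Longrightarrow> set (bs ! (qs ! i)) \<subseteq> Sn"
  shows "wp scan_new (\<lambda>t R' A'. t \<le> kk * (2 * K + 14) + 2 \<and>
    dstate qs (Suc j) (Sn \<union> set (bs ! bi)) R' A' \<and> agree scan_new R A R' A') R A"
  unfolding scan_new_def
proof (rule wp_For_conseq[where T = "2 * K + 12" and I = "\<lambda>t R A. dstate qs (Suc j) (Sn \<union> set (take t (bs ! bi))) R A \<and>
    bstate (set (bs ! bi)) (Sn \<union> set (take t (bs ! bi))) R A"], goal_cases)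
  case 5
  show ?case using d b unfolding dstate_def bstate_def by simp
next
  case (6 t R' A')
  have t: "t < length (bs ! bi)" using 6(1) g by simp
  have ag: "R' 32 = Suc (off bi)" "A' 0 = In"
    using agree_R[OF 6(3)] agree_A[OF 6(3)] g by (auto simp: free_colour_def)
  note ba = bag_access[OF g(4) t]
  define u where "u = bs ! bi ! t"
  define S where "S = Sn \<union> set (take t (bs ! bi))"
  have tk: "Sn \<union> set (take (Suc t) (bs ! bi)) = insert u S"
    using t by (simp add: take_Suc_conv_app_nth u_def S_def)
  have dS: "dinv (\<lambda>i. set (bs ! (qs ! i))) (Suc j) S (R' 38) (A' 6) (A' 7) (A' 8) (A' 9) (A' 10)"
    and bS: "binv (set (bs ! (qs ! j))) S (R' 36) (R' 37) (R' 38) (A' 6) (A' 7) (A' 10)"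
    using 6(2) g(5) unfolding S_def dstate_def bstate_def by auto
  show ?case
  proof (cases "u \<in> S")
    case True
    then have "0 < A' 6 u" using dS unfolding dinv_def by auto
    moreover have "insert u S = S" using True by blast
    ultimately show ?thesis using 6(2,4) ba
      by (simp add: ag u_def[symmetric] S_def[symmetric] tk bstate_def dstate_def)
  next
    case False
    have u0: "A' 6 u = 0" using False dS unfolding dinv_def by (metis gr0I)
    have ub: "u \<in> set (bs ! (qs ! j))" using t u_def g(5) by simp
    have "card (set (bs ! (qs ! j))) \<le> kk"
      using g bag_le[of "bs ! bi"] by (intro le_trans[OF card_length]) auto
    then obtain c where c: "c < K" "\<not> bit (R' 36) c"
      using free_colour_ex[OF dS bS ub False] by auto
    have un: "u < n" using ba u_def by simp
    let ?R = "R'(35 := u)"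
    have seen': "set (bs ! (qs ! i)) \<subseteq> S" if "i < j" for i using seen[OF that] unfolding S_def by blast
    note new = dinv_new[OF dS bS ub False un _ _ seen', unfolded g(5)]
    have "Suc (R' 38) \<le> n" using cnt_le[OF new(1)[OF c]] .
    then have m: "Suc (R' 38) < 2 ^ wd" using Z_ge small1[of "Suc (R' 38)"] by auto
    have w: "wp free_colour (\<lambda>t R2 A2. t \<le> 2 * K + 2 \<and> A2 = A' \<and> R2 = ?R(39 := R2 39) \<and>
      R2 39 < K \<and> \<not> bit (?R 36) (R2 39)) ?R A'"
      by (rule wp_free_colour) (use c in auto)
    show ?thesis
      apply (simp add: ag 6(4) ba u_def[symmetric] u0)
      apply (rule wp_mono[OF w])
    proof (goal_cases)
      case (1 tt R2 A2)
      define c where "c = R2 39"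
      have c: "c < K" "\<not> bit (R' 36) c" using 1 unfolding c_def by auto
      have "R2 x = ?R x" if "x \<noteq> 39" for x
        using 1 fun_upd_other[OF that, of ?R "R2 39"] by metis
      then have R2: "R2 36 = R' 36" "R2 37 = R' 37" "R2 38 = R' 38" "R2 35 = u" "R2 39 = c" "A2 = A'"
        using 1 unfolding c_def by simp_all
      have "2 ^ c \<le> (2::nat) ^ K" using c by (intro power_increasing) auto
      then have c2: "2 ^ c < (2::nat) ^ wd" using P by linarith
      show ?case using new[OF c] 1 c2 m 6(4)
        by (simp add: R2 tk bstate_def dstate_def)
    qed
  qed
next
  case (7 t R' A')
  have "length (bs ! bi) * (2 * K + 14) \<le> kk * (2 * K + 14)"
    using bag_le[of "bs ! bi"] g by (intro mult_right_mono) auto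
  moreover have "2 * K + 12 + 2 = 2 * K + 14" by simp
  ultimately have "t \<le> kk * (2 * K + 14) + 2" using 7(1) unfolding g(3) by (metis add_le_mono1 le_trans)
  then show ?case using 7(2-4) unfolding g(3) by (auto simp: scan_new_def)
qed (use g bag_length_small in \<open>auto simp: free_colour_def\<close>)


lemma dstate_mono: "dstate qs j Sn R A \<Longrightarrow> dstate qs (Suc j) Sn R A"
proof -
  have "good \<beta> j ix col mk par v \<Longrightarrow> good \<beta> (Suc j) ix col mk par v" for \<beta> ix col mk par v
    unfolding good_def using less_SucI by blast
  then show "dstate qs j Sn R A \<Longrightarrow> dstate qs (Suc j) Sn R A"
    unfolding dstate_def dinv_def by simp
qed

lemma wr_scans: "wr scan_seen = {34,35,36,37,97}" "wa scan_seen = {}"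
  "wr scan_new = {34,35,36,37,38,39,97}" "wa scan_new = {6,7,8,9,10}"
  by (auto simp: scan_seen_def scan_new_def free_colour_def)

lemma wp_discover_loop:
  assumes g: "glob R A" and q: "length qs = length bs" "set qs \<subseteq> {..<length bs}" "\<forall>i<length qs. A 4 i = qs ! i"
    and d: "dstate qs 0 {s} R A" and P: "2 ^ K < (2::nat) ^ wd"
  shows "wp discover_loop (\<lambda>t R' A'. t \<le> length bs * (kk * (2 * K + 21) + 11) + 2 \<and>
    dstate qs (length bs) (insert s (\<Union>i<length bs. set (bs ! (qs ! i)))) R' A' \<and> agree discover_loop R A R' A') R A"
  unfolding discover_loop_def
proof (rule wp_For_conseq[where T = "kk * (2 * K + 21) + 9" and
    I = "\<lambda>j R A. dstate qs j (insert s (\<Union>i<j. set (bs ! (qs ! i)))) R A"], goal_cases)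
  case 5
  show ?case using d unfolding dstate_def by simp
next
  case (6 j R' A')
  have j: "j < length bs" using 6(1) g unfolding glob_def by simp
  define bi where "bi = qs ! j"
  have bi: "bi < length bs" using q j unfolding bi_def by (metis lessThan_iff nth_mem subsetD)
  have ag: "A' 0 = In" "A' 4 j = bi" "A' (Suc 0) bi = off bi"
    using agree_A[OF 6(3)] g q j bi unfolding glob_def bi_def by (auto simp: wr_scans)
  let ?S = "insert s (\<Union>i<j. set (bs ! (qs ! i)))"
  have o: "off bi < L" "Suc (off bi) < 2 ^ wd" using off_less[OF bi] length_inp Z_ge small1[of "Suc (off bi)"] by auto
  let ?R = "R'(31 := bi, 32 := Suc (off bi), 33 := length (bs ! bi), 36 := 1, 37 := 1)"
  have d1: "dstate qs (Suc j) ?S ?R A'" using dstate_mono[OF 6(2)] unfolding dstate_def by simp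
  have m: "1 \<le> R' 38" using 6(2) unfolding dstate_def dinv_def by (metis One_nat_def insertI1)
  have w1: "wp scan_seen (\<lambda>t R1 A1. t \<le> 7 * kk + 2 \<and> bstate (set (bs ! bi)) ?S R1 A1 \<and> agree scan_seen ?R A' R1 A1) ?R A'"
    by (rule wp_scan_seen[where bi = bi and qs = qs and j = "Suc j"]) (use ag bi d1 P m in auto)
  show ?case
    apply (simp add: 6(4) ag o In_bag[OF bi])
    apply (rule wp_mono[OF w1[simplified]])
  proof (goal_cases)
    case (1 t1 R1 A1)
    then have a1: "agree scan_seen ?R A' R1 A1" by simp
    have R1: "R1 32 = Suc (off bi)" "R1 33 = length (bs ! bi)" "R1 38 = R' 38" "A1 = A'"
      using agree_R[OF a1] agree_A[OF a1] by (auto simp: wr_scans fun_eq_iff)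
    have w2: "wp scan_new (\<lambda>t R2 A2. t \<le> kk * (2 * K + 14) + 2 \<and>
      dstate qs (Suc j) (?S \<union> set (bs ! bi)) R2 A2 \<and> agree scan_new R1 A1 R2 A2) R1 A1"
      by (rule wp_scan_new) (use R1 ag bi d1 1 P in \<open>auto simp: bi_def dstate_def\<close>)
    have S: "?S \<union> set (bs ! bi) = insert s (\<Union>i<Suc j. set (bs ! (qs ! i)))"
      unfolding bi_def lessThan_Suc by auto
    show ?case
      by (rule wp_mono[OF w2]) (use 1 in \<open>auto simp: S[symmetric] dstate_def algebra_simps\<close>)
  qed
next
  case (7 t R' A')
  then show ?case using g unfolding glob_def by (auto simp: discover_loop_def algebra_simps)
qed (use g Z_ge small1[of "length bs"] in \<open>auto simp: wr_scans glob_def\<close>)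

lemma wp_discover:
  assumes g: "glob R A" and q: "length qs = length bs" "set qs \<subseteq> {..<length bs}" "\<forall>i<length qs. A 4 i = qs ! i"
    and z: "A 6 = (\<lambda>_. 0)" "A 7 = (\<lambda>_. 0)" and P: "2 ^ K < (2::nat) ^ wd"
  shows "wp discover (\<lambda>t R' A'. t \<le> length bs * (kk * (2 * K + 21) + 11) + 5 \<and>
    dstate qs (length bs) (insert s (\<Union>i<length bs. set (bs ! (qs ! i)))) R' A' \<and> agree discover R A R' A') R A"
proof -
  let ?R = "R(38 := 1)" let ?A = "A(6 := (A 6)(s := 1), 10 := (A 10)(1 := s))"
  have R1: "R (Suc 0) = s" using g unfolding glob_def by simp
  have d: "dstate qs 0 {s} ?R ?A"
    using z s_less unfolding dstate_def dinv_def by (auto simp: K_def)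
  have gl: "glob ?R ?A" using g unfolding glob_def by simp
  have "wp discover_loop (\<lambda>t R' A'. t \<le> length bs * (kk * (2 * K + 21) + 11) + 2 \<and>
    dstate qs (length bs) (insert s (\<Union>i<length bs. set (bs ! (qs ! i)))) R' A' \<and> agree discover_loop ?R ?A R' A') ?R ?A"
    by (rule wp_discover_loop[OF gl q(1,2) _ d P]) (use q in auto)
  then have "wp discover (\<lambda>t R' A'. t \<le> length bs * (kk * (2 * K + 21) + 11) + 5 \<and>
    dstate qs (length bs) (insert s (\<Union>i<length bs. set (bs ! (qs ! i)))) R' A') R A"
    unfolding discover_def by (simp add: R1) (erule wp_mono, simp)
  then show ?thesis by (rule wp_agree_mono) simp
qed

end

section \<open>Initial tables: the edges owned by each vertex\<close>

definition init_row :: stm where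
  "init_row = For 48 9 (Cond ((V 48 [shr] V 44) [and] N 1)
     (Cond ((V 48 [shr] V 45) [and] N 1)
       (49 ::= (V 47 [+] V 48) [*] V 10 [+] V 44 ;; Sto 12 (V 49) (Ld 12 (V 49) [or] (N 1 [shl] V 45)))
       (Cond (V 46) (Sto 11 (V 47 [+] V 48) (N 1)) Skip)) Skip)"

definition init_tables :: stm where
  "init_tables = For 40 2 (41 ::= Ld 0 (V 5 [+] N 2 [*] V 40) ;; 42 ::= Ld 0 (V 5 [+] N 2 [*] V 40 [+] N 1) ;;
     Cond (V 41 [=] V 42) Skip (
       Cond (Ld 6 (V 41) [<] Ld 6 (V 42)) (43 ::= V 42) (43 ::= V 41) ;;
       44 ::= Ld 7 (V 41) ;; 45 ::= Ld 7 (V 42) ;; 46 ::= Ld 0 (N 5 [+] V 41) ;;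
       47 ::= V 43 [*] V 9 ;; init_row))"

lemma wr_init_row: "wr init_row = {48, 49, 97}" "wa init_row = {11, 12}"
  by (auto simp: init_row_def)

lemma mult_add_inj:
  "a < K \<Longrightarrow> a' < K \<Longrightarrow> x * K + a = x' * K + a' \<longleftrightarrow> x = x' \<and> a = a'" for a K :: nat
proof
  assume a: "a < K" "a' < K" "x * K + a = x' * K + a'"
  have "(x * K + a) div K = x" "(x' * K + a') div K = x'" using a(1,2) by auto
  then have "x = x'" using a(3) by metis
  then show "x = x' \<and> a = a'" using a(3) by simp
qed simp

text \<open>Connects the abstract elimination order with the contents of the arrays. The bound on
  \<open>P\<close> is where the case split on \<open>n * n\<close> against \<open>2 ^ k\<close>
  enters. \<open>mk\<close> is specified only away from \<open>s\<close>, the root, which is never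
  eliminated.\<close>

locale coloured_elimination = instance_input wd L n s pr es bs ts inp Z +
    el: elimination "set es" "{u. u < n \<and> pr u}" vs X par
  for wd L n s pr es bs ts inp Z vs X par +
  fixes ix col mk ord :: "nat \<Rightarrow> nat" and P :: nat
  assumes set_vs: "set vs = {..<n}" and vs0: "vs ! 0 = s"
    and ord: "\<And>i. i < n \<Longrightarrow> ord (Suc i) = vs ! i" and ix: "\<And>i. i < n \<Longrightarrow> ix (vs ! i) = Suc i"
    and mk: "\<And>v c. v < n \<Longrightarrow> v \<noteq> s \<Longrightarrow> bit (mk v) c \<longleftrightarrow> c \<in> col ` X v"
    and col_inj: "\<And>v. v < n \<Longrightarrow> inj_on col (insert v (X v))"
    and col_less: "\<And>v. v < n \<Longrightarrow> col v < K" and col_s: "col s = 0"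
    and P_def: "P = 2 ^ K" and P_bound: "P \<le> Z ^ 3"
begin

lemma len_vs: "length vs = n"
  using el.dist set_vs by (metis card_lessThan distinct_card)

lemma eln [simp]: "el.n = n"
  unfolding el.n_def by (rule len_vs)

lemma X_less: "v < n \<Longrightarrow> x \<in> X v \<Longrightarrow> x < n \<and> ix x < ix v"
proof -
  assume v: "v < n" "x \<in> X v"
  obtain i where i: "i < n" "vs ! i = v" using v(1) set_vs len_vs by (metis in_set_conv_nth lessThan_iff)
  then have "x \<in> set (take i vs)" using el.X_earlier[of i] v(2) len_vs by auto
  then obtain j where "j < i" "vs ! j = x" using i len_vs nth_image[of i vs]
    by (metis atLeastLessThan_iff imageE less_imp_le)
  then show ?thesis using i ix set_vs len_vs by (metis lessThan_iff less_trans nth_mem Suc_mono)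
qed

text \<open>A vertex and a mask give an index below \<open>Z * Z ^ 3\<close>; the colour contributes
  another factor \<open>Z ^ 2\<close>.\<close>

lemma idx3_less:
  assumes "z < n" "S < P" "a < K"
  shows "z * P + S < 2 ^ wd" "(z * P + S) * K + a < 2 ^ wd" "z * P < 2 ^ wd" "(z * P + S) * K < 2 ^ wd"
proof -
  have "Suc z * P \<le> Z * Z ^ 3" using assms(1) Z_ge(1) P_bound by (intro mult_mono) auto
  then have 1: "z * P + S < Z ^ 4" using assms(2) by (simp add: power_Suc[symmetric] del: power_Suc)
  then have "Suc (z * P + S) * K \<le> Z ^ 4 * Z ^ 2"
    using K_less(1) by (intro mult_mono) (auto simp: power2_eq_square)
  then have 2: "(z * P + S) * K + a < Z ^ 6" using assms(3) by (simp add: power_add[symmetric])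
  show "z * P + S < 2 ^ wd" "(z * P + S) * K + a < 2 ^ wd" using small[OF 1] small[OF 2] by auto
  then show "z * P < 2 ^ wd" "(z * P + S) * K < 2 ^ wd" by auto
qed

text \<open>Bags have at most one vertex of each colour, so a mask of colours represents a subset of a bag.\<close>

definition dec :: "nat \<Rightarrow> nat \<Rightarrow> nat set" where
  "dec z S = {x \<in> insert z (X z). bit S (col x)}"

text \<open>Array 11 flags infeasibility, so untouched zero memory represents the tables of the
  edgeless graph. Masks with bits of absent colours stand for the same subset as without these bits,
  and row bits at absent colours are left open.\<close>

definition rep :: "arrs \<Rightarrow> nat \<Rightarrow> nat \<Rightarrow> (nat set \<Rightarrow> bool \<times> (nat \<times> nat) set) \<Rightarrow> bool" where
  "rep A z S f \<longleftrightarrow> (A 11 (z * P + S) = 0 \<longleftrightarrow> fst (f (dec z S))) \<and>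
     (\<forall>a\<in>insert z (X z). \<forall>b\<in>insert z (X z). bit (A 12 ((z * P + S) * K + col a)) (col b) \<longleftrightarrow> (a, b) \<in> snd (f (dec z S)))"

lemma rep_cong:
  "rep A z S f \<Longrightarrow> f (dec z S) = g (dec z S) \<Longrightarrow> A' 11 (z * P + S) = A 11 (z * P + S) \<Longrightarrow>
   (\<And>a. a < K \<Longrightarrow> A' 12 ((z * P + S) * K + a) = A 12 ((z * P + S) * K + a)) \<Longrightarrow> z < n \<Longrightarrow> rep A' z S g"
  unfolding rep_def using col_less X_less by (auto; blast)

lemma T0_insert:
  assumes "el.owned z u v"
  shows "fst (el.T0 (insert (u, v) F) z Y) \<longleftrightarrow> fst (el.T0 F z Y) \<and> (u \<in> Y \<and> u < n \<and> pr u \<longrightarrow> v \<in> Y)"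
    "snd (el.T0 (insert (u, v) F) z Y) = snd (el.T0 F z Y) \<union> (if u \<in> Y \<and> v \<in> Y then {(u, v)} else {})"
  using assms unfolding el.T0_def by auto

lemma T0_insert_other:
  assumes "\<not> el.owned z u v"
  shows "el.T0 (insert (u, v) F) z = el.T0 F z"
  using assms unfolding el.T0_def fun_eq_iff by auto

lemma rep_insert:
  assumes r: "rep A z S (el.T0 F z)" and o: "el.owned z u v" and z: "z < n" "u < n"
    and bad: "A' 11 (z * P + S) = (if bit S (col u) \<and> \<not> bit S (col v) \<and> pr u then 1 else A 11 (z * P + S))"
    and row: "\<And>a. a < K \<Longrightarrow> A' 12 ((z * P + S) * K + a) = (if a = col u \<and> bit S (col u) \<and> bit S (col v)
      then Bit_Operations.or (A 12 ((z * P + S) * K + a)) (2 ^ col v) else A 12 ((z * P + S) * K + a))"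
  shows "rep A' z S (el.T0 (insert (u, v) F) z)"
proof -
  have uv: "u \<in> insert z (X z)" "v \<in> insert z (X z)" using o unfolding el.owned_def by auto
  have d: "x \<in> dec z S \<longleftrightarrow> bit S (col x)" if "x \<in> insert z (X z)" for x using that unfolding dec_def by simp
  have "A' 11 (z * P + S) = 0 \<longleftrightarrow> fst (el.T0 (insert (u, v) F) z (dec z S))"
    using r uv z unfolding rep_def T0_insert(1)[OF o] bad by (auto simp: d)
  moreover have "bit (A' 12 ((z * P + S) * K + col a)) (col b) \<longleftrightarrow> (a, b) \<in> snd (el.T0 (insert (u, v) F) z (dec z S))"
    if ab: "a \<in> insert z (X z)" "b \<in> insert z (X z)" for a b
  proof -
    have "a < n" using ab X_less z by auto
    have inj: "col a = col u \<longleftrightarrow> a = u" "col b = col v \<longleftrightarrow> b = v"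
      using inj_on_eq_iff[OF col_inj[OF z(1)]] ab uv by blast+
    show ?thesis
      unfolding T0_insert(2)[OF o] row[OF col_less[OF \<open>a < n\<close>]] inj
      using r ab uv unfolding rep_def by (auto simp: d bit_or_exp inj)
  qed
  ultimately show ?thesis unfolding rep_def by blast
qed

definition dglob :: "regs \<Rightarrow> arrs \<Rightarrow> bool" where
  "dglob R A \<longleftrightarrow> R 0 = n \<and> R 1 = s \<and> R 2 = length es \<and> R 5 = eb \<and> R 9 = P \<and> R 10 = K \<and> A 0 = In \<and> A 6 = ix \<and> A 7 = col \<and>
     A 8 = mk \<and> A 9 = par \<and> A 10 = ord"

lemma dglob_agree:
  "dglob R A \<Longrightarrow> agree c R A R' A' \<Longrightarrow> wr c \<inter> {0,1,2,5,9,10} = {} \<Longrightarrow> wa c \<inter> {0,6,7,8,9,10} = {} \<Longrightarrow> dglob R' A'"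
  unfolding dglob_def agree_def by auto

lemma P_less: "P < 2 ^ wd" "0 < P"
proof -
  have "Z ^ 3 < Z ^ 4" using Z_ge(1) by (intro power_strict_increasing) auto
  then show "P < 2 ^ wd" using P_bound by (intro small[of P 4]) auto
qed (simp add: P_def)

lemma wp_init_row:
  assumes g: "dglob R A" and r: "R 44 = col u" "R 45 = col v" "R 46 = of_bool (pr u)" "R 47 = z * P"
    and o: "el.owned z u v" and z: "z < n" "u < n" "v < n"
    and rep: "\<And>z' S. z' < n \<Longrightarrow> S < P \<Longrightarrow> rep A z' S (el.T0 F z')"
    and other: "\<And>z'. z' < n \<Longrightarrow> z' \<noteq> z \<Longrightarrow> \<not> el.owned z' u v"
  shows "wp init_row (\<lambda>t R' A'. t \<le> P * 7 + 2 \<and> (\<forall>z'<n. \<forall>S<P. rep A' z' S (el.T0 (insert (u, v) F) z')) \<and>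
    agree init_row R A R' A') R A"
  unfolding init_row_def
\<comment> \<open>Only the masks of the owner below \<open>S0\<close> have taken in the new edge.
  For the other vertices the edge changes nothing, so they count as updated from the start.\<close>
proof (rule wp_For_conseq[where T = 5 and I = "\<lambda>S0 R' A'. \<forall>z'<n. \<forall>S<P. rep A' z' S
    (el.T0 (if S < S0 \<or> z' \<noteq> z then insert (u, v) F else F) z')"], goal_cases)
  case 5
  show ?case using rep T0_insert_other[OF other] by auto
next
  case (6 S0 R' A')
  have S0: "S0 < P" using 6(1) g unfolding dglob_def by simp
  have ag: "R' 44 = col u" "R' 45 = col v" "R' 46 = of_bool (pr u)" "R' 47 = z * P" "R' 10 = K"
    using agree_R[OF 6(3)] r g unfolding dglob_def by auto
  have cK: "col u < K" "col v < K" using col_less z by auto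
  have b: "z * P + S0 < 2 ^ wd" "(z * P + S0) * K + col u < 2 ^ wd" "(z * P + S0) * K < 2 ^ wd"
    using idx3_less[OF z(1) S0 cK(1)] by auto
  have "2 ^ col v \<le> (2::nat) ^ K" using cK by (intro power_increasing) auto
  then have c2: "2 ^ col v < (2::nat) ^ wd" using P_less unfolding P_def by linarith
  have upd: "\<forall>z'<n. \<forall>S<P. rep A2 z' S (el.T0 (if S < Suc S0 \<or> z' \<noteq> z then insert (u, v) F else F) z')"
    if A11: "A2 11 = (if bit S0 (col u) \<and> \<not> bit S0 (col v) \<and> pr u then (A' 11)(z * P + S0 := 1) else A' 11)"
      and A12: "A2 12 = (if bit S0 (col u) \<and> bit S0 (col v) then (A' 12)((z * P + S0) * K + col u :=
         Bit_Operations.or (A' 12 ((z * P + S0) * K + col u)) (2 ^ col v)) else A' 12)" for A2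
  proof (intro allI impI)
    fix z' S assume z': "z' < n" "S < P"
    show "rep A2 z' S (el.T0 (if S < Suc S0 \<or> z' \<noteq> z then insert (u, v) F else F) z')"
    proof (cases "z' = z \<and> S = S0")
      case True
      have "rep A' z S0 (el.T0 (if S0 < S0 \<or> z \<noteq> z then insert (u, v) F else F) z)" using 6(2) z(1) S0 by blast
      then have "rep A' z S0 (el.T0 F z)" by simp
      then have "rep A2 z S0 (el.T0 (insert (u, v) F) z)"
        by (rule rep_insert[OF _ o z(1,2)]) (auto simp: A11 A12)
      then show ?thesis using True by simp
    next
      case False
      then have eq: "z' * P + S \<noteq> z * P + S0" using mult_add_inj[OF z'(2) S0] by auto
      show ?thesis
      proof (rule rep_cong)
        show "rep A' z' S (el.T0 (if S < S0 \<or> z' \<noteq> z then insert (u, v) F else F) z')" using 6(2) z' by blast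
        fix a assume "a < K"
        then show "A2 12 ((z' * P + S) * K + a) = A' 12 ((z' * P + S) * K + a)"
          using eq cK(1) unfolding A12 by (auto simp: mult_add_inj)
      qed (use False eq z' in \<open>auto simp: A11 less_Suc_eq\<close>)
    qed
  qed
  show ?case
    using upd 6(4) b c2 by (auto simp: ag)
next
  case (7 t R' A')
  then show ?case using g unfolding dglob_def by (auto simp: init_row_def)
qed (use g P_less in \<open>auto simp: dglob_def\<close>)


lemma owned_unique: "u \<noteq> v \<Longrightarrow> z < n \<Longrightarrow> z' < n \<Longrightarrow> el.owned z u v \<Longrightarrow> el.owned z' u v \<Longrightarrow> z = z'"
  unfolding el.owned_def using X_less by (metis less_asym)

text \<open>Elements of \<open>X v\<close> have smaller numbers than \<open>v\<close>, so comparing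
  the discovery numbers of the endpoints finds the owner of an edge without computing
  \<open>X\<close>.\<close>

lemma owned_later:
  assumes "(u, v) \<in> set es" "u \<noteq> v"
  shows "el.owned (if ix u < ix v then v else u) u v"
  using el.E_X[OF assms] es_less[OF assms(1)] X_less unfolding el.owned_def by (auto dest: less_asym)

lemma wp_init_tables:
  assumes g: "dglob R A" and z: "A 11 = (\<lambda>_. 0)" "A 12 = (\<lambda>_. 0)"
  shows "wp init_tables (\<lambda>t R' A'. t \<le> length es * (P * 7 + 14) + 2 \<and> (\<forall>z<n. \<forall>S<P. rep A' z S (el.Tb 0 z)) \<and>
    agree init_tables R A R' A') R A"
  unfolding init_tables_def
proof (rule wp_For_conseq[where T = "P * 7 + 12" and I = "\<lambda>e R' A'. \<forall>z<n. \<forall>S<P. rep A' z S (el.T0 (set (take e es)) z)"], goal_cases)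
  case 5
  show ?case using z unfolding rep_def el.T0_def by simp
next
  case (6 e R' A')
  have e: "e < length es" using 6(1) g unfolding dglob_def by simp
  have dg: "dglob R' A'" by (rule dglob_agree[OF g 6(3)]) (auto simp: wr_init_row)
  note dg' = dg[unfolded dglob_def]
  define u v where "u = fst (es ! e)" and "v = snd (es ! e)"
  have uv: "(u, v) \<in> set es" "u < n" "v < n" using e es_less[of u v] unfolding u_def v_def by auto
  have tk: "set (take (Suc e) es) = insert (u, v) (set (take e es))"
    using e by (simp add: take_Suc_conv_app_nth u_def v_def)
  have Ine: "In (eb + 2 * e) = u" "In (Suc (eb + 2 * e)) = v" using In_es[OF e] u_def v_def by auto
  have l: "Suc (eb + 2 * e) < tb" using Z_ge(8) e by simp
  then have l: "Suc (eb + 2 * e) < L" "Suc (eb + 2 * e) < 2 ^ wd" using length_inp Z_ge small1[of "Suc (eb + 2 * e)"] by auto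
  have l5: "5 + u < L" "5 + u < 2 ^ wd" using uv length_inp Z_ge small1[of "5 + u"] by (auto simp: tb_def off_def eb_def)
  show ?case
  proof (cases "u = v")
    case True
    have "el.T0 (insert (u, u) (set (take e es))) z = el.T0 (set (take e es)) z" if "z < n" for z
      by (rule T0_insert_other) (use X_less uv in \<open>auto simp: el.owned_def\<close>)
    then show ?thesis using 6(2,4) dg' Ine l True by (simp add: tk)
  next
    case False
    define z where "z = (if ix u < ix v then v else u)"
    have z: "z < n" "el.owned z u v" using uv owned_later[OF uv(1) False] unfolding z_def by auto
    have zP: "z * P < 2 ^ wd" using idx3_less(3)[OF z(1) P_less(2), of 0] by (simp add: K_def)
    define bp where "bp = (of_bool (pr u) :: nat)"
    let ?R = "R'(41 := u, 42 := v, 43 := z, 44 := col u, 45 := col v, 46 := bp, 47 := z * P)"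
    have w: "wp init_row (\<lambda>t R2 A2. t \<le> P * 7 + 2 \<and> (\<forall>z'<n. \<forall>S<P. rep A2 z' S (el.T0 (insert (u, v) (set (take e es))) z')) \<and>
      agree init_row ?R A' R2 A2) ?R A'"
    proof (rule wp_init_row)
      show "dglob ?R A'" using dg unfolding dglob_def by simp
      show "\<And>z'. z' < n \<Longrightarrow> z' \<noteq> z \<Longrightarrow> \<not> el.owned z' u v" using owned_unique[OF False] z by blast
    qed (use 6(2) z uv in \<open>auto simp: bp_def\<close>)
    have w': "wp init_row (\<lambda>t R2 A2. t + 9 \<le> P * 7 + 12 \<and> (\<forall>z'<n. \<forall>S<P. rep A2 z' S (el.T0 (set (take (Suc e) es)) z'))) ?R A'"
      by (rule wp_mono[OF w]) (auto simp: tk)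
    have Inp: "In (5 + u) = bp" unfolding bp_def by (rule In_pr[OF uv(2)])
    show ?thesis
    proof (cases "ix u < ix v")
      case True
      then have "z = v" unfolding z_def by simp
      then show ?thesis using dg' Ine l l5 True False zP Inp 6(4)
        apply simp
        apply (rule wp_mono[OF w'[unfolded \<open>z = v\<close>]])
        by simp
    next
      case nt: False
      then have "z = u" unfolding z_def by simp
      then show ?thesis using dg' Ine l l5 nt False zP Inp 6(4)
        apply simp
        apply (rule wp_mono[OF w'[unfolded \<open>z = u\<close>]])
        by simp
    qed
  qed
next
  case (7 t R' A')
  have "R 2 = length es" using g unfolding dglob_def by simp
  moreover have "el.Tb 0 z = el.T0 (set es) z" for z by (simp add: fun_eq_iff)
  ultimately show ?case using 7 by (simp add: init_tables_def add.commute)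
qed (use g small1 Z_ge in \<open>auto simp: dglob_def wr_init_row\<close>)


end

section \<open>Elimination of the vertices, bottom-up\<close>

definition push_row :: stm where
  "push_row = For 63 10 (Cond ((V 54 [shr] V 63) [and] N 1)
     (64 ::= Ld 12 (V 61 [*] V 10 [+] V 63) ;;
      Cond ((V 64 [shr] V 55) [and] N 1) (64 ::= (V 64 [or] V 60)) Skip ;;
      65 ::= V 62 [*] V 10 [+] V 63 ;;
      Sto 12 (V 65) (Ld 12 (V 65) [or] (V 64 [and] V 54))) Skip)"

text \<open>Register 60 is the row of \<open>v\<close>, cleared if adding \<open>v\<close> is
  infeasible. This merges both conditions of \<open>chosen\<close> into one test against 0, and in
  the case without \<open>v\<close> the bridging in \<open>push_row\<close> has no effect.\<close>

definition eliminate_subset :: stm where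
  "eliminate_subset = (57 ::= (V 56 [and] V 54) ;; 58 ::= (V 57 [or] (N 1 [shl] V 55)) ;;
     59 ::= V 52 [*] V 9 [+] V 58 ;; 60 ::= (Ld 12 (V 59 [*] V 10 [+] V 55) [and] V 54) ;;
     Cond (Ld 11 (V 59)) (60 ::= N 0) Skip ;; 62 ::= V 53 [*] V 9 [+] V 56 ;;
     Cond (V 60) (Sto 13 (V 52 [*] V 9 [+] V 56) (N 1) ;; 61 ::= V 59)
       (61 ::= V 52 [*] V 9 [+] V 57 ;; Cond (Ld 11 (V 61)) (Sto 11 (V 62) (N 1)) Skip) ;;
     push_row)"

definition eliminate :: stm where
  "eliminate = (51 ::= V 0 [-] N 1 ;; For 50 51 (52 ::= Ld 10 (V 0 [-] V 50) ;; 53 ::= Ld 9 (V 52) ;;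
     54 ::= Ld 8 (V 52) ;; 55 ::= Ld 7 (V 52) ;; For 56 9 eliminate_subset))"

lemma wr_push: "wr push_row = {63,64,65,97}" "wa push_row = {12}"
  and wr_eliminate_subset: "wr eliminate_subset = {57,58,59,60,61,62,63,64,65,97}" "wa eliminate_subset = {11,12,13}"
  by (auto simp: push_row_def eliminate_subset_def)

context coloured_elimination
begin

text \<open>A row of \<open>elim v\<close> in bits: \<open>x\<close> is the row of a neighbour,
  \<open>r\<close> that of \<open>v\<close>, \<open>c\<close> the colour of \<open>v\<close> and
  \<open>m\<close> the mask of its earlier neighbours. With \<open>r = 0\<close> it is just the
  restriction of \<open>x\<close> to \<open>m\<close>.\<close>

definition pushed :: "nat \<Rightarrow> nat \<Rightarrow> nat \<Rightarrow> nat \<Rightarrow> nat" where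
  "pushed r c m x = Bit_Operations.and (if bit x c then Bit_Operations.or x r else x) m"

lemma wp_push_row:
  assumes r: "R 10 = K" "R 54 = m" "R 55 = c" "R 60 = rr" "R 61 = D" "R 62 = q"
    and b: "Suc D * K < 2 ^ wd" "Suc q * K < 2 ^ wd" and Dq: "D \<noteq> q"
  shows "wp push_row (\<lambda>t R' A'. t \<le> K * 8 + 2 \<and>
    (\<forall>x a. a < K \<longrightarrow> A' 12 (x * K + a) = (if x = q \<and> bit m a then
       Bit_Operations.or (A 12 (x * K + a)) (pushed rr c m (A 12 (D * K + a))) else A 12 (x * K + a)))) R A"
proof -
  define RI where "RI j f \<longleftrightarrow> (\<forall>x a. a < K \<longrightarrow> f (x * K + a) = (if x = q \<and> a < j \<and> bit m a then
       Bit_Operations.or (A 12 (x * K + a)) (pushed rr c m (A 12 (D * K + a))) else A 12 (x * K + a)))" for j f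
  show ?thesis
    unfolding push_row_def
  proof (rule wp_For_conseq[where T = 6 and I = "\<lambda>j R' A'. RI j (A' 12)"], goal_cases)
    case 5
    show ?case unfolding RI_def by simp
  next
    case (6 j R' A')
    have j: "j < K" using 6(1) r by simp
    have ag: "R' 10 = K" "R' 54 = m" "R' 55 = c" "R' 60 = rr" "R' 61 = D" "R' 62 = q" "R' 63 = j"
      using agree_R[OF 6(3)] r 6(4) by auto
    have l: "D * K + j < 2 ^ wd" "q * K + j < 2 ^ wd" "D * K < 2 ^ wd" "q * K < 2 ^ wd" using b j by auto
    have AD: "A' 12 (D * K + j) = A 12 (D * K + j)" "A' 12 (q * K + j) = A 12 (q * K + j)"
      using 6(2) j Dq unfolding RI_def by auto
    have upd: "RI (Suc j) ((A' 12)(q * K + j := Bit_Operations.or (A 12 (q * K + j)) (pushed rr c m (A 12 (D * K + j)))))"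
      if "bit m j"
      using 6(2) that j unfolding RI_def by (auto simp: mult_add_inj less_Suc_eq)
    have upd': "RI (Suc j) (A' 12)" if "\<not> bit m j"
      using 6(2) that unfolding RI_def by (auto simp: less_Suc_eq)
    show ?case
    proof (cases "bit m j")
      case True
      show ?thesis using upd[OF True] True l by (auto simp: ag AD pushed_def)
    next
      case False
      show ?thesis using upd'[OF False] False by (simp add: ag)
    qed
  next
    case (7 t R' A')
    have "RI (R 10) (A' 12)" by (rule 7(2))
    then show ?case using 7(1) r unfolding RI_def by auto
  qed (use r K_less in auto)
qed

end

context coloured_elimination
begin

lemma nxt_props:
  assumes "Suc d < n"
  shows "el.nxt d < n" "el.nxt d \<noteq> s" "par (el.nxt d) < n" "par (el.nxt d) \<noteq> el.nxt d"
    "X (el.nxt d) \<subseteq> insert (par (el.nxt d)) (X (par (el.nxt d)))" "el.nxt d = ord (n - d)"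
proof -
  note r = el.rest_Suc[unfolded eln, OF assms]
  show v: "el.nxt d < n" using nth_mem[of "n - 1 - d" vs] set_vs len_vs assms unfolding el.nxt_def eln by auto
  show "el.nxt d \<noteq> s"
    using assms vs0 len_vs nth_eq_iff_index_eq[OF el.dist, of "n - 1 - d" 0] unfolding el.nxt_def eln by auto
  show "par (el.nxt d) < n" "par (el.nxt d) \<noteq> el.nxt d"
    using r el.rest_sub[of "Suc d"] set_vs by auto
  show "X (el.nxt d) \<subseteq> insert (par (el.nxt d)) (X (par (el.nxt d)))" using r unfolding el.Xc_def by blast
  have "n - d = Suc (n - 1 - d)" "n - 1 - d < n" using assms by auto
  then show "el.nxt d = ord (n - d)" unfolding el.nxt_def eln using ord by metis
qed

text \<open>This is where colouring vertices rather than bag positions pays off: the same word is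
  read in the bags of \<open>p\<close> and of \<open>v\<close>. Conjunction with \<open>mk v\<close>
  restricts to \<open>X v\<close>, and it excludes \<open>v\<close>, whose colour differs from those
  of its earlier neighbours.\<close>

lemma subset_masks:
  assumes v: "v < n" "v \<noteq> s" and p: "X v \<subseteq> insert p (X p)" and S: "S < P"
  defines "S0 \<equiv> Bit_Operations.and S (mk v)"
  defines "S1 \<equiv> Bit_Operations.or S0 (2 ^ col v)"
  shows "S0 < P" "S1 < P" "dec v S0 = dec p S \<inter> X v" "dec v S1 = insert v (dec p S \<inter> X v)"
proof -
  have c: "col v < K" by (rule col_less[OF v(1)])
  then have "2 ^ col v < P" unfolding P_def by simp
  then show "S0 < P" "S1 < P" using S unfolding S0_def S1_def P_def by (auto intro: or_less_nat and_less_nat)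
  have vX: "v \<notin> X v" using X_less[OF v(1)] by blast
  have cv: "col v \<notin> col ` X v" using col_inj[OF v(1)] vX unfolding inj_on_def by auto
  have cx: "col x \<noteq> col v" if "x \<in> X v" for x using cv imageI[OF that, of col] by auto
  show "dec v S0 = dec p S \<inter> X v"
    using p cv unfolding dec_def S0_def by (auto simp: bit_and_iff mk[OF v])
  show "dec v S1 = insert v (dec p S \<inter> X v)"
    using p cv cx unfolding dec_def S1_def S0_def by (auto simp: bit_or_exp bit_and_iff mk[OF v])
qed

lemma nat_eq_0_bits: "(a::nat) = 0 \<longleftrightarrow> (\<forall>c. \<not> bit a c)"
  by (metis bit_0_eq bit_eq_iff bot_apply bot_bool_def)

text \<open>Masking the row of \<open>v\<close> with \<open>mk v\<close> removes the bit of
  \<open>v\<close> itself and bits without meaning. What is left is nonzero iff \<open>v\<close> has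
  a successor in \<open>Y\<close>, since the relation lives on \<open>insert v Y\<close>.\<close>

lemma chosen_iff:
  assumes v: "v < n" "v \<noteq> s" and T: "\<And>Y. snd (T Y) \<subseteq> Y \<times> Y" and Y: "Y \<subseteq> X v"
    and rep: "rep A v S1 T" and d1: "dec v S1 = insert v Y"
  shows "el.chosen v T Y \<longleftrightarrow> A 11 (v * P + S1) = 0 \<and>
    Bit_Operations.and (A 12 ((v * P + S1) * K + col v)) (mk v) \<noteq> 0"
proof -
  have "Bit_Operations.and (A 12 ((v * P + S1) * K + col v)) (mk v) \<noteq> 0 \<longleftrightarrow>
    (\<exists>x\<in>X v. bit (A 12 ((v * P + S1) * K + col v)) (col x))"
    unfolding nat_eq_0_bits[of "Bit_Operations.and _ _"] bit_and_iff mk[OF v] by blast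
  also have "\<dots> \<longleftrightarrow> (\<exists>x\<in>X v. (v, x) \<in> snd (T (insert v Y)))"
    using rep unfolding rep_def d1 by auto
  also have "\<dots> \<longleftrightarrow> (\<exists>x\<in>Y. (v, x) \<in> snd (T (insert v Y)))"
    using T[of "insert v Y"] Y X_less[OF v(1)] by blast
  finally show ?thesis using rep unfolding el.chosen_def rep_def d1 by blast
qed

lemma bit_pushed:
  "bit (pushed r c m x) b \<longleftrightarrow> bit m b \<and> (bit x b \<or> bit x c \<and> bit r b)"
  unfolding pushed_def by (auto simp: bit_and_iff bit_or_iff)

lemma rep_push:
  assumes v: "v < n" "v \<noteq> s" and p: "X v \<subseteq> insert p (X p)" "p < n" and S: "S < P"
    and T: "\<And>Y. snd (T Y) \<subseteq> Y \<times> Y"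
  defines "S0 \<equiv> Bit_Operations.and S (mk v)"
  defines "S1 \<equiv> Bit_Operations.or S0 (2 ^ col v)"
  defines "Y \<equiv> dec p S \<inter> X v"
  assumes rep: "rep A v S0 T" "rep A v S1 T" "rep A p S Tp"
    and r: "r = Bit_Operations.and (A 12 ((v * P + S1) * K + col v)) (mk v)"
    and c: "ch = el.chosen v T Y"
    and a11: "A' 11 (p * P + S) = (if ch \<or> A 11 (v * P + S0) = 0 then A 11 (p * P + S) else 1)"
    and a12: "\<And>a. a < K \<Longrightarrow> A' 12 ((p * P + S) * K + a) = (if bit (mk v) a then
       Bit_Operations.or (A 12 ((p * P + S) * K + a)) (pushed (if ch then r else 0) (col v) (mk v)
         (A 12 ((v * P + (if ch then S1 else S0)) * K + a))) else A 12 ((p * P + S) * K + a))"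
    and T': "T' (dec p S) = (fst (Tp (dec p S)) \<and> fst (el.msg v T Y), snd (Tp (dec p S)) \<union> snd (el.msg v T Y))"
  shows "rep A' p S T'"
proof -
  note sm = subset_masks[OF v p(1) S, folded S0_def, folded S1_def, folded Y_def]
  have YX: "Y \<subseteq> X v" unfolding Y_def by blast
  have vX: "v \<notin> X v" using X_less[OF v(1)] by blast
  have msgY: "snd (el.msg v T Y) \<subseteq> Y \<times> Y"
    using T[of Y] T[of "insert v Y"] unfolding el.msg_def elim_def by (auto split: if_splits)
  \<comment> \<open>The bag of \<open>p\<close> contains \<open>X v\<close> and has pairwise
    different colours, so no other member of it shares a colour with an element of
    \<open>X v\<close>.\<close>
  have mem: "bit (mk v) (col a) \<longleftrightarrow> a \<in> X v" if a: "a \<in> insert p (X p)" for a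
  proof -
    have "x = a" if "x \<in> X v" "col x = col a" for x
      using inj_on_eq_iff[OF col_inj[OF p(2)], of x a] that a p(1) by blast
    then show ?thesis unfolding mk[OF v] by (metis image_iff)
  qed
  have 1: "A' 11 (p * P + S) = 0 \<longleftrightarrow> fst (T' (dec p S))"
    using rep sm(3) unfolding T' a11 rep_def c el.msg_def by auto
  have 2: "bit (A' 12 ((p * P + S) * K + col a)) (col b) \<longleftrightarrow> (a, b) \<in> snd (T' (dec p S))"
    if ab: "a \<in> insert p (X p)" "b \<in> insert p (X p)" for a b
  proof -
    have an: "a < n" using ab X_less p(2) by auto
    have old: "bit (A 12 ((p * P + S) * K + col a)) (col b) \<longleftrightarrow> (a, b) \<in> snd (Tp (dec p S))"
      using rep(3) ab unfolding rep_def by blast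
    have "bit (pushed (if ch then r else 0) (col v) (mk v)
         (A 12 ((v * P + (if ch then S1 else S0)) * K + col a))) (col b) \<longleftrightarrow> (a, b) \<in> snd (el.msg v T Y)"
      if aX: "a \<in> X v"
    proof (cases "b \<in> X v")
      case False
      then show ?thesis using mem[OF ab(2)] msgY YX unfolding bit_pushed by blast
    next
      case bX: True
      have bits: "bit (A 12 ((v * P + S1) * K + col x)) (col y) \<longleftrightarrow> (x, y) \<in> snd (T (insert v Y))"
        if "x \<in> insert v (X v)" "y \<in> insert v (X v)" for x y
        using rep(2) that unfolding rep_def sm(4) by blast
      have bits0: "bit (A 12 ((v * P + S0) * K + col x)) (col y) \<longleftrightarrow> (x, y) \<in> snd (T Y)"
        if "x \<in> insert v (X v)" "y \<in> insert v (X v)" for x y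
        using rep(1) that unfolding rep_def sm(3) by blast
      have mb: "bit (mk v) (col b)" using mem[OF ab(2)] bX by blast
      have neq: "a \<noteq> v" "b \<noteq> v" using aX bX vX by auto
      show ?thesis
      proof (cases ch)
        case True
        have rb: "bit r (col b) \<longleftrightarrow> (v, b) \<in> snd (T (insert v Y))"
          unfolding r bit_and_iff using bits[of v b] bX mb by simp
        have "(a, b) \<in> snd (el.msg v T Y) \<longleftrightarrow> (a, b) \<in> elim v (snd (T (insert v Y)))"
          using True unfolding el.msg_def c by simp
        then show ?thesis using True mb rb bits[of a b] bits[of a v] aX bX neq
          unfolding bit_pushed elim_def by simp
      next
        case False
        have "(a, b) \<in> snd (el.msg v T Y) \<longleftrightarrow> (a, b) \<in> snd (T Y)"
          using False unfolding el.msg_def c by simp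
        then show ?thesis using False mb bits0[of a b] aX bX unfolding bit_pushed by simp
      qed
    qed
    moreover have "(a, b) \<notin> snd (el.msg v T Y)" if "a \<notin> X v" using msgY YX that by blast
    ultimately show ?thesis
      unfolding T' a12[OF col_less[OF an]] mem[OF ab(1)] using old by (auto simp: bit_or_iff)
  qed
  show ?thesis unfolding rep_def using 1 2 by blast
qed

lemma wp_eliminate_subset:
  assumes d: "Suc d < n" and v: "v = el.nxt d" and S: "S < P"
    and g: "dglob R A" and r: "R 52 = v" "R 53 = par v" "R 54 = mk v" "R 55 = col v" "R 56 = S"
    and rep: "\<And>S. S < P \<Longrightarrow> rep A v S (el.Tb d v)" "rep A (par v) S (el.Tb d (par v))"
  shows "wp eliminate_subset (\<lambda>t R' A'. t \<le> K * 8 + 15 \<and>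
    A' 13 = (if el.chosen v (el.Tb d v) (dec (par v) S \<inter> X v) then (A 13)(v * P + S := 1) else A 13) \<and>
    rep A' (par v) S (el.Tb (Suc d) (par v)) \<and>
    (\<forall>z S' f. z < n \<longrightarrow> S' < P \<longrightarrow> z \<noteq> par v \<or> S' \<noteq> S \<longrightarrow> rep A z S' f \<longrightarrow> rep A' z S' f)) R A"
proof -
  note np = nxt_props[OF d, folded v]
  define p where "p = par v"
  define S0 where "S0 = Bit_Operations.and S (mk v)"
  define S1 where "S1 = Bit_Operations.or S0 (2 ^ col v)"
  define Y where "Y = dec p S \<inter> X v"
  define ch where "ch = el.chosen v (el.Tb d v) Y"
  define rr where "rr = Bit_Operations.and (A 12 ((v * P + S1) * K + col v)) (mk v)"
  note sm = subset_masks[OF np(1,2) np(5) S, folded p_def, folded S0_def, folded S1_def, folded Y_def]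
  have cK: "col v < K" by (rule col_less[OF np(1)])
  have ch: "ch \<longleftrightarrow> A 11 (v * P + S1) = 0 \<and> rr \<noteq> 0"
    unfolding ch_def rr_def
    by (rule chosen_iff[OF np(1,2) el.snd_Tb _ rep(1)[OF sm(2)] sm(4)]) (simp add: Y_def)
  have i1: "v * P + S1 < 2 ^ wd" "(v * P + S1) * K + col v < 2 ^ wd" "v * P < 2 ^ wd" "(v * P + S1) * K < 2 ^ wd"
    using idx3_less[OF np(1) sm(2) cK] by auto
  have i0: "v * P + S0 < 2 ^ wd" "v * P + S < 2 ^ wd"
    using idx3_less(1)[OF np(1) sm(1) cK] idx3_less(1)[OF np(1) S cK] by auto
  have ip: "p * P + S < 2 ^ wd" "p * P < 2 ^ wd"
    using idx3_less(1)[OF np(3) S cK] unfolding p_def by auto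
  have big: "Suc (z * P + S') * K < 2 ^ wd" if "z < n" "S' < P" for z S'
  proof -
    have "Suc z * P \<le> Z * Z ^ 3" using that(1) Z_ge(1) P_bound by (intro mult_mono) auto
    then have "z * P + S' < Z ^ 4" using that(2) by (simp add: power_Suc[symmetric] del: power_Suc)
    then have "Suc (z * P + S') * K \<le> Z ^ 4 * K" by (intro mult_right_mono) auto
    also have "\<dots> < Z ^ 4 * (Z * Z)" using K_less(1) Z_ge(1) by (intro mult_strict_left_mono) auto
    also have "\<dots> = Z ^ 6" by (simp add: power2_eq_square[symmetric] power_add[symmetric])
    finally show ?thesis by (rule small) simp
  qed
  have c2: "2 ^ col v < (2::nat) ^ wd"
    using P_less(1) cK power_strict_increasing[of "col v" K "2::nat"] unfolding P_def by simp
  define D where "D = v * P + (if ch then S1 else S0)"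
  have Dq: "D \<noteq> p * P + S" unfolding D_def using np(4) sm(1,2) S
    by (auto simp: p_def mult_add_inj)
  have DK: "Suc D * K < 2 ^ wd" unfolding D_def using big[OF np(1)] sm(1,2) by auto
  have qK: "Suc (p * P + S) * K < 2 ^ wd" using big[OF np(3) S] unfolding p_def .
  let ?Q = "\<lambda>t R' A'. t \<le> K * 8 + 2 \<and>
    A' 13 = (if ch then (A 13)(v * P + S := 1) else A 13) \<and>
    rep A' (par v) S (el.Tb (Suc d) (par v)) \<and>
    (\<forall>z S' f. z < n \<longrightarrow> S' < P \<longrightarrow> z \<noteq> par v \<or> S' \<noteq> S \<longrightarrow> rep A z S' f \<longrightarrow> rep A' z S' f)"
  have push: "wp push_row ?Q R2 A2"
    if R2: "R2 10 = K" "R2 54 = mk v" "R2 55 = col v" "R2 60 = (if ch then rr else 0)" "R2 61 = D" "R2 62 = p * P + S"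
      and A2: "A2 12 = A 12" "A2 13 = (if ch then (A 13)(v * P + S := 1) else A 13)"
        "A2 11 = (if ch \<or> A 11 (v * P + S0) = 0 then A 11 else (A 11)(p * P + S := 1))" for R2 A2
  proof (rule wp_agree_mono[OF wp_push_row[OF R2 DK qK Dq]], goal_cases)
    case (1 t R' A')
    have A11: "A' 11 = A2 11" "A' 13 = A2 13" using agree_A[OF 1(2)] by (auto simp: wr_push)
    have A12: "A' 12 (x * K + a) = (if x = p * P + S \<and> bit (mk v) a then
       Bit_Operations.or (A 12 (x * K + a)) (pushed (if ch then rr else 0) (col v) (mk v) (A 12 (D * K + a))) else A 12 (x * K + a))"
      if "a < K" for x a using 1(1) that unfolding A2 by blast
    have rp: "rep A' p S (el.Tb (Suc d) p)"
    proof (rule rep_push[where v = v and T = "el.Tb d v" and Tp = "el.Tb d p" and A = A and ch = ch and r = rr])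
      show "v < n" "v \<noteq> s" "X v \<subseteq> insert p (X p)" "p < n" "S < P" using np S unfolding p_def by auto
      show "rep A p S (el.Tb d p)" using rep(2) unfolding p_def .
      show "A' 11 (p * P + S) = (if ch \<or> A 11 (v * P + Bit_Operations.and S (mk v)) = 0 then A 11 (p * P + S) else 1)"
        unfolding A11 A2 S0_def by simp
      show "el.Tb (Suc d) p (dec p S) = (fst (el.Tb d p (dec p S)) \<and> fst (el.msg v (el.Tb d v) (dec p S \<inter> X v)),
        snd (el.Tb d p (dec p S)) \<union> snd (el.msg v (el.Tb d v) (dec p S \<inter> X v)))"
        by (simp add: Let_def v[symmetric] p_def)
      show "A' 12 ((p * P + S) * K + a) = (if bit (mk v) a then
       Bit_Operations.or (A 12 ((p * P + S) * K + a)) (pushed (if ch then rr else 0) (col v) (mk v)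
         (A 12 ((v * P + (if ch then Bit_Operations.or (Bit_Operations.and S (mk v)) (2 ^ col v)
            else Bit_Operations.and S (mk v))) * K + a))) else A 12 ((p * P + S) * K + a))" if "a < K" for a
        unfolding A12[OF that] D_def S0_def S1_def by simp
    qed (use el.snd_Tb rep(1) sm in \<open>auto simp: S0_def[symmetric] S1_def[symmetric] rr_def ch_def Y_def\<close>)
    have other: "rep A' z S' f" if z: "z < n" "S' < P" "z \<noteq> p \<or> S' \<noteq> S" "rep A z S' f" for z S' f
    proof (rule rep_cong[where f = f and g = f])
      show "rep A z S' f" "z < n" by fact+
      have ne: "z * P + S' \<noteq> p * P + S" using z S by (auto simp: mult_add_inj)
      then show "A' 11 (z * P + S') = A 11 (z * P + S')" unfolding A11 A2 by simp
      show "A' 12 ((z * P + S') * K + a) = A 12 ((z * P + S') * K + a)" if "a < K" for a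
        using A12[OF that] ne by simp
    qed simp
    show ?case using 1(1) A11 A2(2) rp other unfolding p_def by auto
  qed
  note dg = g[unfolded dglob_def]
  have rrz: "A 11 (v * P + S1) = 0 \<Longrightarrow> rr \<noteq> 0 \<Longrightarrow> ch" "A 11 (v * P + S1) \<noteq> 0 \<Longrightarrow> \<not> ch" "rr = 0 \<Longrightarrow> \<not> ch"
    using ch by auto
  note simps = r dg i1 i0 ip c2 S0_def[symmetric] S1_def[symmetric] p_def[symmetric] rr_def[symmetric]
  have goal: "wp eliminate_subset (\<lambda>t R' A'. t \<le> K * 8 + 15 \<and>
    A' 13 = (if ch then (A 13)(v * P + S := 1) else A 13) \<and>
    rep A' (par v) S (el.Tb (Suc d) (par v)) \<and>
    (\<forall>z S' f. z < n \<longrightarrow> S' < P \<longrightarrow> z \<noteq> par v \<or> S' \<noteq> S \<longrightarrow> rep A z S' f \<longrightarrow> rep A' z S' f)) R A"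
  proof (cases ch)
    case True
    then have "A 11 (v * P + S1) = 0" "rr \<noteq> 0" using ch by auto
    then show ?thesis unfolding eliminate_subset_def
      apply (simp add: simps True)
      apply (rule wp_mono[OF push])
      using True by (auto simp: dg r D_def p_def)
  next
    case False
    note nch = False
    show ?thesis
    proof (cases "A 11 (v * P + S1) = 0")
      case True
      then have "rr = 0" using ch False by auto
      then show ?thesis using True unfolding eliminate_subset_def
        apply (simp add: simps nch)
        apply (intro conjI impI)
         apply (rule wp_mono[OF push]; use nch in \<open>auto simp: dg r D_def p_def\<close>)
        apply (rule wp_mono[OF push]; use nch in \<open>auto simp: dg r D_def p_def\<close>)
        done
    next
      case b: False
      then show ?thesis unfolding eliminate_subset_def
        apply (simp add: simps nch)
        apply (intro conjI impI)
         apply (rule wp_mono[OF push]; use nch in \<open>auto simp: dg r D_def p_def\<close>)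
        apply (rule wp_mono[OF push]; use nch in \<open>auto simp: dg r D_def p_def\<close>)
        done
    qed
  qed
  then show ?thesis unfolding ch_def Y_def p_def .
qed


lemma rest_sub_n: "z \<in> el.rest d \<Longrightarrow> z < n"
  using el.rest_sub set_vs by blast

text \<open>Decisions are stored under masks read in the bag of the parent, although they depend
  only on the part inside \<open>X\<close>. Those of eliminated vertices are final; the entries of
  remaining vertices still have the zeros of fresh memory.\<close>

definition elim_inv :: "nat \<Rightarrow> arrs \<Rightarrow> bool" where
  "elim_inv d A \<longleftrightarrow> (\<forall>z\<in>el.rest d. \<forall>S<P. rep A z S (el.Tb d z) \<and> A 13 (z * P + S) = 0) \<and>
     (\<forall>d'<d. \<forall>S<P. A 13 (el.nxt d' * P + S) \<noteq> 0 \<longleftrightarrow>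
        el.chosen (el.nxt d') (el.Tb d' (el.nxt d')) (dec (par (el.nxt d')) S \<inter> X (el.nxt d')))"

lemma nxt_neq: "d' < d \<Longrightarrow> d < n \<Longrightarrow> el.nxt d' \<noteq> el.nxt d"
  unfolding el.nxt_def eln using nth_eq_iff_index_eq[OF el.dist, of "n - 1 - d'" "n - 1 - d"] len_vs by auto

lemma Tb_Suc_other: "z \<noteq> par (el.nxt d) \<Longrightarrow> el.Tb (Suc d) z = el.Tb d z"
  by (simp add: fun_eq_iff Let_def)

lemma wp_eliminate_vertex:
  assumes d: "Suc d < n" and v: "v = el.nxt d"
    and g: "dglob R A" and r: "R 52 = v" "R 53 = par v" "R 54 = mk v" "R 55 = col v"
    and inv: "elim_inv d A"
  shows "wp (For 56 9 eliminate_subset) (\<lambda>t R' A'. t \<le> P * (K * 8 + 17) + 2 \<and> elim_inv (Suc d) A') R A"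
proof -
  note np = nxt_props[OF d, folded v]
  note rs = el.rest_Suc[unfolded eln, OF d, folded v]
  \<comment> \<open>State in the middle of the loop over masks: the table of the parent has reached
    level \<open>Suc d\<close> below \<open>S0\<close> and is still at level \<open>d\<close> from
    \<open>S0\<close> on. For the other remaining vertices both levels coincide, and the table of
    \<open>v\<close> is only read.\<close>
  define SI where "SI S0 A' \<longleftrightarrow>
    (\<forall>z\<in>el.rest (Suc d). \<forall>S<P. rep A' z S (el.Tb (if z = par v \<and> S0 \<le> S then d else Suc d) z) \<and> A' 13 (z * P + S) = 0) \<and>
    (\<forall>S<P. rep A' v S (el.Tb d v)) \<and>
    (\<forall>S<P. A' 13 (v * P + S) \<noteq> 0 \<longleftrightarrow> S < S0 \<and> el.chosen v (el.Tb d v) (dec (par v) S \<inter> X v)) \<and>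
    (\<forall>d'<d. \<forall>S<P. A' 13 (el.nxt d' * P + S) \<noteq> 0 \<longleftrightarrow>
        el.chosen (el.nxt d') (el.Tb d' (el.nxt d')) (dec (par (el.nxt d')) S \<inter> X (el.nxt d')))" for S0 A'
  show ?thesis
  proof (rule wp_For_conseq[where T = "K * 8 + 15" and I = "\<lambda>j R' A'. SI j A'"], goal_cases)
    case 5
    have "rep A z S (el.Tb (if z = par v \<and> 0 \<le> S then d else Suc d) z)" if "z \<in> el.rest (Suc d)" "S < P" for z S
      using inv that rs(1) Tb_Suc_other[of z d, folded v] unfolding elim_inv_def by auto
    then show ?case using inv rs(1) unfolding SI_def elim_inv_def by auto
  next
    case (6 S R' A')
    have S: "S < P" using 6(1) g unfolding dglob_def by simp
    have dg: "dglob R' A'" by (rule dglob_agree[OF g 6(3)]) (auto simp: wr_eliminate_subset)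
    have ag: "R' 52 = v" "R' 53 = par v" "R' 54 = mk v" "R' 55 = col v"
      using agree_R[OF 6(3)] r by (auto simp: wr_eliminate_subset)
    note si = 6(2)[unfolded SI_def]
    have "rep A' (par v) S (el.Tb (if par v = par v \<and> S \<le> S then d else Suc d) (par v))"
      using si rs(4) S by blast
    then have rp: "rep A' (par v) S (el.Tb d (par v))" by simp
    have w: "wp eliminate_subset (\<lambda>t R2 A2. t \<le> K * 8 + 15 \<and>
      A2 13 = (if el.chosen v (el.Tb d v) (dec (par v) S \<inter> X v) then (A' 13)(v * P + S := 1) else A' 13) \<and>
      rep A2 (par v) S (el.Tb (Suc d) (par v)) \<and>
      (\<forall>z S' f. z < n \<longrightarrow> S' < P \<longrightarrow> z \<noteq> par v \<or> S' \<noteq> S \<longrightarrow> rep A' z S' f \<longrightarrow> rep A2 z S' f)) R' A'"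
      by (rule wp_eliminate_subset[OF d v S dg ag 6(4) _ rp]) (use si in blast)
    show ?case
    proof (rule wp_mono[OF w], goal_cases)
      case (1 t R2 A2)
      let ?ch = "el.chosen v (el.Tb d v) (dec (par v) S \<inter> X v)"
      have keep: "rep A2 z S' f" if "z < n" "S' < P" "z \<noteq> par v \<or> S' \<noteq> S" "rep A' z S' f" for z S' f
        using 1 that by blast
      have A13: "A2 13 (z * P + S') = (if z = v \<and> S' = S \<and> ?ch then 1 else A' 13 (z * P + S'))" if "S' < P" for z S'
        using 1 that S by (auto simp: mult_add_inj)
      have "rep A2 z S' (el.Tb (if z = par v \<and> Suc S \<le> S' then d else Suc d) z)"
        if z: "z \<in> el.rest (Suc d)" "S' < P" for z S'
      proof (cases "z = par v \<and> S' = S")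
        case True
        then show ?thesis using 1 by simp
      next
        case False
        have "rep A' z S' (el.Tb (if z = par v \<and> S \<le> S' then d else Suc d) z)" using si z by blast
        then have "rep A2 z S' (el.Tb (if z = par v \<and> S \<le> S' then d else Suc d) z)"
          using keep[of z S'] rest_sub_n[OF z(1)] z(2) False by blast
        moreover have "(z = par v \<and> S \<le> S') \<longleftrightarrow> (z = par v \<and> Suc S \<le> S')" using False by auto
        ultimately show ?thesis by simp
      qed
      moreover have "A2 13 (z * P + S') = 0" if "z \<in> el.rest (Suc d)" "S' < P" for z S'
        using si that rs(2) A13[OF that(2)] by auto
      moreover have "rep A2 v S' (el.Tb d v)" if "S' < P" for S'
        using keep[OF np(1) that] np(4) si that by auto
      moreover have "A2 13 (v * P + S') \<noteq> 0 \<longleftrightarrow> S' < Suc S \<and> el.chosen v (el.Tb d v) (dec (par v) S' \<inter> X v)"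
        if "S' < P" for S'
        using si that A13[OF that] by (auto simp: less_Suc_eq)
      moreover have "A2 13 (el.nxt d' * P + S') \<noteq> 0 \<longleftrightarrow>
        el.chosen (el.nxt d') (el.Tb d' (el.nxt d')) (dec (par (el.nxt d')) S' \<inter> X (el.nxt d'))"
        if "d' < d" "S' < P" for d' S'
        using si that A13[OF that(2)] nxt_neq[OF that(1)] d v by auto
      ultimately have "SI (Suc S) A2" unfolding SI_def by blast
      then show ?case using 1 by blast
    qed
  next
    case (7 t R' A')
    have P: "R 9 = P" using g unfolding dglob_def by simp
    have si: "SI P A'" using 7(2) P by simp
    have "\<not> (z = par v \<and> P \<le> S)" if "S < P" for z S using that by simp
    then have "elim_inv (Suc d) A'" using si unfolding SI_def elim_inv_def
      by (auto simp: less_Suc_eq v)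
    then show ?case using 7(1) unfolding P by (simp add: add.commute)
  qed (use g P_less in \<open>auto simp: dglob_def wr_eliminate_subset\<close>)
qed

lemma n_less_word: "n - 1 < 2 ^ wd" "n < 2 ^ wd"
  using Z_ge small1[of n] by auto

lemma wp_eliminate:
  assumes g: "dglob R A" and rep: "\<forall>z<n. \<forall>S<P. rep A z S (el.Tb 0 z)" and z: "A 13 = (\<lambda>_. 0)"
  shows "wp eliminate (\<lambda>t R' A'. t \<le> n * (P * (K * 8 + 17) + 8) + 3 \<and> elim_inv (n - 1) A' \<and> R' 51 = n - 1 \<and>
    agree eliminate R A R' A') R A"
proof -
  have w: "wp (For 50 51 (52 ::= Ld 10 (V 0 [-] V 50) ;; 53 ::= Ld 9 (V 52) ;;
     54 ::= Ld 8 (V 52) ;; 55 ::= Ld 7 (V 52) ;; For 56 9 eliminate_subset))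
    (\<lambda>t R' A'. t + 1 \<le> n * (P * (K * 8 + 17) + 8) + 3 \<and> elim_inv (n - 1) A' \<and> R' 51 = n - 1) (R(51 := n - 1)) A"
  proof (rule wp_For_conseq[where T = "P * (K * 8 + 17) + 6" and I = "\<lambda>d R' A'. elim_inv d A'"], goal_cases)
    case 5
    show ?case using rep z rest_sub_n[of _ 0] unfolding elim_inv_def by auto
  next
    case (6 d R' A')
    have d: "Suc d < n" using 6(1) by simp
    have g': "dglob (R(51 := n - 1)) A" using g unfolding dglob_def by simp
    have dg: "dglob R' A'" by (rule dglob_agree[OF g' 6(3)]) (auto simp: wr_eliminate_subset)
    note dg' = dg[unfolded dglob_def]
    define v where "v = el.nxt d"
    note np = nxt_props[OF d, folded v_def]
    let ?R = "R'(52 := v, 53 := par v, 54 := mk v, 55 := col v)"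
    have w: "wp (For 56 9 eliminate_subset) (\<lambda>t R' A'. t \<le> P * (K * 8 + 17) + 2 \<and> elim_inv (Suc d) A') ?R A'"
      by (rule wp_eliminate_vertex[OF d v_def]) (use dg' 6(2) in \<open>auto simp: dglob_def\<close>)
    show ?case
      apply (simp add: dg' 6(4) np(6)[symmetric])
      apply (rule wp_mono[OF w])
      by simp
  next
    case (7 t R' A')
    have "R' 51 = n - 1" using agree_R[OF 7(3), of 51] by (simp add: wr_eliminate_subset)
    moreover have "(n - 1) * (P * (K * 8 + 17) + 6 + 2) \<le> n * (P * (K * 8 + 17) + 8)"
      by (intro mult_mono) auto
    ultimately show ?case using 7(1,2) by auto
  qed (use n_less_word in \<open>auto simp: wr_eliminate_subset\<close>)
  have "R 0 = n" using g unfolding dglob_def by simp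
  then have "wp eliminate (\<lambda>t R' A'. t \<le> n * (P * (K * 8 + 17) + 8) + 3 \<and> elim_inv (n - 1) A' \<and> R' 51 = n - 1) R A"
    unfolding eliminate_def using w by simp
  then show ?thesis by (rule wp_agree_mono) simp
qed


end

section \<open>Recovering the set from the decisions, top-down\<close>

definition top_down_loop :: stm where
  "top_down_loop = For 70 51 (71 ::= Ld 10 (V 70 [+] N 2) ;; 72 ::= (Ld 14 (Ld 9 (V 71)) [and] Ld 8 (V 71)) ;;
     Cond (Ld 13 (V 71 [*] V 9 [+] V 72))
       (Sto 15 (V 71) (N 1) ;; 72 ::= (V 72 [or] (N 1 [shl] Ld 7 (V 71)))) Skip ;;
     Sto 14 (V 71) (V 72))"

definition top_down :: stm where
  "top_down = Cond (Ld 11 (V 1 [*] V 9 [+] N 1)) Skip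
     (Sto 14 (V 1) (N 1) ;; Sto 15 (V 1) (N 1) ;; top_down_loop)"

lemma wr_top_down_loop: "wr top_down_loop = {70,71,72,97}" "wa top_down_loop = {14,15}"
  by (auto simp: top_down_loop_def)

context coloured_elimination
begin

text \<open>\<open>U\<close> is the selection among the vertices decided so far. The decisions still
  to come are accounted for by \<open>expand\<close>, whose value never changes while
  \<open>d\<close> goes down to 0.\<close>

definition td_inv :: "nat \<Rightarrow> arrs \<Rightarrow> bool" where
  "td_inv d A \<longleftrightarrow> (\<exists>U. el.expand d U = el.expand (n - 1) {s} \<and> U \<subseteq> el.rest d \<and> (\<forall>x. A 15 x = of_bool (x \<in> U)) \<and>
     (\<forall>z\<in>el.rest d. A 14 z < P \<and> dec z (A 14 z) = U \<inter> insert z (X z)))"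

lemma td_step:
  assumes d: "Suc d < n" and v: "v = el.nxt d" and inv: "td_inv (Suc d) A" and ei: "elim_inv (n - 1) A"
  defines "S0 \<equiv> Bit_Operations.and (A 14 (par v)) (mk v)"
  shows "A 14 (par v) < P" "S0 < P"
    and "A 13 (v * P + S0) \<noteq> 0 \<Longrightarrow> A' 15 = (A 15)(v := 1) \<Longrightarrow>
      A' 14 = (A 14)(v := Bit_Operations.or S0 (2 ^ col v)) \<Longrightarrow> td_inv d A'"
    and "A 13 (v * P + S0) = 0 \<Longrightarrow> A' 15 = A 15 \<Longrightarrow> A' 14 = (A 14)(v := S0) \<Longrightarrow> td_inv d A'"
proof -
  note np = nxt_props[OF d, folded v]
  note rs = el.rest_Suc[unfolded eln, OF d, folded v]
  obtain U where U: "el.expand (Suc d) U = el.expand (n - 1) {s}" "U \<subseteq> el.rest (Suc d)" "\<forall>x. A 15 x = of_bool (x \<in> U)"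
     "\<forall>z\<in>el.rest (Suc d). A 14 z < P \<and> dec z (A 14 z) = U \<inter> insert z (X z)"
    using inv unfolding td_inv_def by blast
  show S: "A 14 (par v) < P" using U(4) rs(4) by blast
  note sm = subset_masks[OF np(1,2,5) S, folded S0_def]
  show "S0 < P" by (rule sm(1))
  have vU: "v \<notin> U" using U(2) rs(2) by blast
  have dp: "dec (par v) (A 14 (par v)) \<inter> X v = U \<inter> X v" using U(4) rs(4) np(5) by blast
  \<comment> \<open>Decisions were recorded for all masks, in particular for \<open>S0\<close>,
    which is the mask of the parent with everything outside \<open>X v\<close> already cut off. Both
    masks meet \<open>X v\<close> in the same set, so the lookup at \<open>S0\<close> gives the
    right decision.\<close>
  have "dec (par v) S0 \<inter> X v = dec (par v) (A 14 (par v)) \<inter> X v"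
    unfolding dec_def S0_def by (auto simp: bit_and_iff mk[OF np(1,2)])
  then have "A 13 (v * P + S0) \<noteq> 0 \<longleftrightarrow> el.chosen v (el.Tb d v) (U \<inter> X v)"
    using ei sm(1) d dp v unfolding elim_inv_def by auto
  then have ch: "A 13 (v * P + S0) \<noteq> 0 \<longleftrightarrow> el.ch d U" unfolding el.ch_def v .
  have nov: "v \<notin> insert z (X z)" if "z \<in> el.rest (Suc d)" for z using el.X_rest[OF that] that rs(2) by blast
  have U0: "U \<inter> insert v (X v) = U \<inter> X v" "insert v U \<inter> insert v (X v) = insert v (U \<inter> X v)" using vU by auto
  have Uz: "insert v U \<inter> insert z (X z) = U \<inter> insert z (X z)" if "z \<in> el.rest (Suc d)" for z
    using nov[OF that] by blast
  show "td_inv d A'" if a: "A 13 (v * P + S0) \<noteq> 0" "A' 15 = (A 15)(v := 1)"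
      "A' 14 = (A 14)(v := Bit_Operations.or S0 (2 ^ col v))"
  proof -
    have "el.expand d (insert v U) = el.expand (n - 1) {s}" using U(1) ch a(1) v by simp
    moreover have "A' 14 z < P \<and> dec z (A' 14 z) = insert v U \<inter> insert z (X z)" if z: "z \<in> el.rest d" for z
    proof (cases "z = v")
      case True
      then show ?thesis using sm(2,4) dp U0 a(3) by simp
    next
      case False
      then have "z \<in> el.rest (Suc d)" using z rs(1) by blast
      then show ?thesis using U(4) Uz a(3) False by simp
    qed
    ultimately show ?thesis using U(2,3) rs(1) a(2) unfolding td_inv_def
      by (intro exI[of _ "insert v U"]) auto
  qed
  show "td_inv d A'" if a: "A 13 (v * P + S0) = 0" "A' 15 = A 15" "A' 14 = (A 14)(v := S0)"
  proof -
    have "el.expand d U = el.expand (n - 1) {s}" using U(1) ch a(1) v by simp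
    moreover have "A' 14 z < P \<and> dec z (A' 14 z) = U \<inter> insert z (X z)" if z: "z \<in> el.rest d" for z
    proof (cases "z = v")
      case True
      then show ?thesis using sm(1,3) dp U0 a(3) by simp
    next
      case False
      then have "z \<in> el.rest (Suc d)" using z rs(1) by blast
      then show ?thesis using U(4) a(3) False by simp
    qed
    ultimately show ?thesis using U(2,3) rs(1) a(2) unfolding td_inv_def
      by (intro exI[of _ U]) auto
  qed
qed

lemma hd_vs: "hd vs = s"
  using vs0 el.ne by (simp add: hd_conv_nth)

lemma X_s: "X s = {}"
  using el.X_earlier[of 0] vs0 el.ne by simp

lemma rest_last: "el.rest (n - 1) = {s}"
  using s_less hd_vs el.ne unfolding el.rest_def eln by (cases vs) auto

lemma dec_s: "dec s (Suc 0) = {s}"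
  unfolding dec_def X_s by (auto simp: col_s bit_Suc_0_iff)

lemma wp_top_down:
  assumes g: "dglob R A" and r: "R 51 = n - 1" and inv: "elim_inv (n - 1) A" and z: "A 15 = (\<lambda>_. 0)"
  shows "wp top_down (\<lambda>t R' A'. t \<le> n * 9 + 6 \<and> (\<forall>x. A' 15 x = of_bool (x \<in>
     (if fst (el.Tb (n - 1) s {s}) then el.expand (n - 1) {s} else {}))) \<and> agree top_down R A R' A') R A"
proof -
  note dg = g[unfolded dglob_def]
  have "1 < (2::nat) ^ K" by (rule one_less_power) (auto simp: K_def)
  then have P1: "Suc 0 < P" unfolding P_def by simp
  have rp: "rep A s 1 (el.Tb (n - 1) s)" using inv rest_last P1 unfolding elim_inv_def by simp
  have i1: "s * P + 1 < 2 ^ wd" "s * P < 2 ^ wd" using idx3_less[OF s_less, of 1 0] P1 unfolding K_def by auto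
  have root: "A 11 (Suc (s * P)) = 0 \<longleftrightarrow> fst (el.Tb (n - 1) s {s})"
    using rp unfolding rep_def by (simp add: dec_s)
  let ?A = "A(14 := (A 14)(s := 1), 15 := (A 15)(s := 1))"
  have loop: "wp top_down_loop (\<lambda>t R' A'. t \<le> n * 9 + 2 \<and> (\<forall>x. A' 15 x = of_bool (x \<in> el.expand (n - 1) {s}))) R ?A"
    unfolding top_down_loop_def
  proof (rule wp_For_conseq[where T = 7 and I = "\<lambda>i R' A'. td_inv (n - 1 - i) A'"], goal_cases)
    case 5
    have "dec s 1 = {s} \<inter> insert s (X s)" using dec_s by simp
    then have a14: "?A 14 s < P \<and> dec s (?A 14 s) = {s} \<inter> insert s (X s)" using P1 by simp
    have a15: "?A 15 x = of_bool (x \<in> {s})" for x using z by simp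
    have "td_inv (n - 1) ?A" unfolding td_inv_def rest_last
    proof (rule exI[of _ "{s}"], intro conjI refl)
      show "\<forall>z\<in>{s}. ?A 14 z < P \<and> dec z (?A 14 z) = {s} \<inter> insert z (X z)" using a14 by blast
    qed (use a15 in blast)+
    then show ?case by (simp only: diff_zero)
  next
    case (6 i R' A')
    have i: "i < n - 1" using 6(1) r by simp
    \<comment> \<open>Vertices are visited in discovery order, starting after \<open>s\<close>.
      Round \<open>i\<close> handles the vertex with number \<open>i + 2\<close>, which was
      eliminated in round \<open>n - 2 - i\<close>.\<close>
    define d where "d = n - 2 - i"
    have d: "Suc d < n" "n - 1 - i = Suc d" "n - 1 - Suc i = d" "n - d = i + 2" using i unfolding d_def by auto
    have g': "dglob R ?A" using g unfolding dglob_def by simp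
    have dg2: "dglob R' A'" by (rule dglob_agree[OF g' 6(3)]) auto
    note dg' = dg2[unfolded dglob_def]
    define v where "v = el.nxt d"
    note np = nxt_props[OF d(1), folded v_def]
    have "A' 13 = A 13" "A' 11 = A 11" "A' 12 = A 12" using agree_A[OF 6(3)] by auto
    then have ei: "elim_inv (n - 1) A'" using inv unfolding elim_inv_def rep_def by simp
    note st = td_step[OF d(1) v_def 6(2)[unfolded d(2)] ei]
    define S0 where "S0 = Bit_Operations.and (A' 14 (par v)) (mk v)"
    have l: "v * P + S0 < 2 ^ wd" "v * P < 2 ^ wd" using idx3_less[OF np(1) st(2), of 0] unfolding S0_def K_def by auto
    have c2: "2 ^ col v < (2::nat) ^ wd"
      using P_less(1) col_less[OF np(1)] power_strict_increasing[of "col v" K "2::nat"] unfolding P_def by simp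
    have o: "ord (Suc (Suc i)) = v" using np(6) d(4) by simp
    have i2: "Suc (Suc i) < 2 ^ wd" using i n_less_word(2) by auto
    show ?case
    proof (cases "A' 13 (v * P + S0) = 0")
      case True
      then show ?thesis using st(4)[folded S0_def] d(3) l i2 6(4) by (simp add: dg' o S0_def[symmetric])
    next
      case False
      then show ?thesis using st(3)[folded S0_def] d(3) l i2 c2 6(4) by (simp add: dg' o S0_def[symmetric])
    qed
  next
    case (7 t R' A')
    have "td_inv 0 A'" using 7(2) r by simp
    then have "\<forall>x. A' 15 x = of_bool (x \<in> el.expand (n - 1) {s})" unfolding td_inv_def by auto
    then show ?case using 7(1) r by simp
  qed (use r n_less_word in auto)
  have "wp top_down (\<lambda>t R' A'. t \<le> n * 9 + 6 \<and> (\<forall>x. A' 15 x = of_bool (x \<in>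
     (if fst (el.Tb (n - 1) s {s}) then el.expand (n - 1) {s} else {})))) R A"
  proof (cases "fst (el.Tb (n - 1) s {s})")
    case True
    then show ?thesis unfolding top_down_def using root i1
      apply (simp add: dg[simplified])
      apply (rule wp_mono[OF loop[simplified]])
      by simp
  next
    case False
    then show ?thesis unfolding top_down_def using root i1 z by (simp add: dg[simplified])
  qed
  then show ?thesis by (rule wp_agree_mono) simp
qed

end

section \<open>From the search of the tree to a coloured elimination order\<close>

locale instance_td = instance_input +
  fixes F :: "nat set set set"
  assumes td: "tree_decomposition {..<n} (undirected (set es)) (set (map set bs)) F"
    and F_def: "F = set (map (\<lambda>(i, j). {set (bs ! i), set (bs ! j)}) ts)"
    and bs_inj: "distinct (map set bs)"
    and ts_distinct: "distinct (map (\<lambda>(i, j). {i, j}) ts)"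
begin

lemma bag_inj: "i < length bs \<Longrightarrow> j < length bs \<Longrightarrow> set (bs ! i) = set (bs ! j) \<Longrightarrow> i = j"
  using bs_inj nth_eq_iff_index_eq[of "map set bs" i j] by simp

lemma adj_iff: "(i, j) \<in> adj \<longleftrightarrow> (i, j) \<in> set ts \<or> (j, i) \<in> set ts"
proof
  assume "(i, j) \<in> adj"
  then obtain p where p: "p < 2 * length ts" "own p = i" "partner p = j" unfolding adj_def by auto
  obtain e where "e < length ts" "(i, j) = ts ! e \<or> (j, i) = ts ! e" using own_partner(4)[OF p(1)] p by auto
  then show "(i, j) \<in> set ts \<or> (j, i) \<in> set ts" using nth_mem[of e ts] by metis
next
  assume "(i, j) \<in> set ts \<or> (j, i) \<in> set ts"
  then show "(i, j) \<in> adj" using own_partner_ex unfolding adj_def by blast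
qed

lemma adj_F: "(i, j) \<in> adj \<Longrightarrow> {set (bs ! i), set (bs ! j)} \<in> F"
  unfolding adj_iff F_def by (force simp: insert_commute)

lemma bs_ne: "0 < length bs"
  using td unfolding tree_decomposition_def is_tree_def by auto

text \<open>Bags are distinct, so a bag determines its position and adjacency of positions mirrors
  \<open>F\<close>. Closure under adjacency then spreads over the connected tree, and the queue is a
  search order of all bags.\<close>

lemma bfs_complete:
  assumes q: "bfs_list qs" and cl: "\<forall>i\<in>set qs. \<forall>j. (i, j) \<in> adj \<longrightarrow> j \<in> set qs"
  shows "set qs = {..<length bs}" "length qs = length bs" "rip (map (\<lambda>i. set (bs ! i)) qs)"
proof -
  let ?b = "\<lambda>i. set (bs ! i)"
  have sub: "set qs \<subseteq> {..<length bs}" and q0: "0 \<in> set qs"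
    using q nth_mem[of 0 qs] unfolding bfs_list_def by auto
  have conn: "connected_graph (set (map set bs)) F"
    using td unfolding tree_decomposition_def is_tree_def by blast
  have all: "i \<in> set qs" if i: "i < length bs" for i
  proof -
    have "(?b 0, ?b i) \<in> {(a, b). a \<in> set (map set bs) \<and> b \<in> set (map set bs) \<and> {a, b} \<in> F}\<^sup>*"
      using conn i bs_ne unfolding connected_graph_def by auto
    then have "\<exists>j\<in>set qs. ?b i = ?b j"
    proof (induction rule: rtrancl_induct)
      case (step b c)
      then obtain j where j: "j \<in> set qs" "b = ?b j" by blast
      obtain x y where xy: "(x, y) \<in> set ts" "{b, c} = {?b x, ?b y}" using step(2) unfolding F_def by auto
      have lt: "j < length bs" "x < length bs" "y < length bs" using sub j ts_less[OF xy(1)] by auto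
      consider "b = ?b x" "c = ?b y" | "b = ?b y" "c = ?b x" using xy(2) by (auto simp: doubleton_eq_iff)
      then show ?case
      proof cases
        case 1
        then have "j = x" using bag_inj lt j by simp
        then have "y \<in> set qs" using cl j(1) xy(1) adj_iff by blast
        then show ?thesis using 1 by blast
      next
        case 2
        then have "j = y" using bag_inj lt j by simp
        then have "x \<in> set qs" using cl j(1) xy(1) adj_iff by blast
        then show ?thesis using 2 by blast
      qed
    qed (use q0 in blast)
    then obtain j where "j \<in> set qs" "?b i = ?b j" by blast
    then show ?thesis using bag_inj[of i j] i sub by auto
  qed
  then show qs: "set qs = {..<length bs}" using sub by auto
  have dq: "distinct qs" using q unfolding bfs_list_def by blast
  then show l: "length qs = length bs" using qs distinct_card by fastforce
  have "inj_on ?b (set qs)" using bag_inj qs by (auto simp: inj_on_def)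
  then have "distinct (map ?b qs)" using dq by (simp add: distinct_map)
  moreover have "\<exists>p<i. {map ?b qs ! p, map ?b qs ! i} \<in> F" if i: "i < length (map ?b qs)" "0 < i" for i
  proof -
    obtain p where "p < i" "(qs ! p, qs ! i) \<in> adj" using q i unfolding bfs_list_def by auto
    then show ?thesis using i adj_F by (intro exI[of _ p]) simp
  qed
  ultimately have so: "search_order F (map ?b qs)" unfolding search_order_def by blast
  have "(!) bs ` {..<length bs} = set bs" using nth_image[of "length bs" bs] by (simp add: lessThan_atLeast0)
  moreover have "?b ` {..<length bs} = set ` ((!) bs ` {..<length bs})" by (simp add: image_image)
  ultimately have "set (map ?b qs) = set (map set bs)" by (simp only: list.set_map qs)
  then show "rip (map ?b qs)" using tree_decomposition_rip[OF td so] by simp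
qed

lemma bags_cover: "\<Union>(set (map set bs)) = {..<n}"
  using td unfolding tree_decomposition_def by blast

end

locale discovered = instance_td +
  fixes qs :: "nat list" and Sn :: "nat set" and m :: nat and ix col mk par ord :: "nat \<Rightarrow> nat"
  assumes q: "set qs = {..<length bs}" "length qs = length bs" "rip (map (\<lambda>i. set (bs ! i)) qs)"
    and Sn: "Sn = insert s (\<Union>i<length bs. set (bs ! (qs ! i)))"
    and dinv: "dinv (\<lambda>i. set (bs ! (qs ! i))) (length bs) Sn m ix col mk par ord"
begin

definition \<beta> :: "nat \<Rightarrow> nat set" where "\<beta> i = set (bs ! (qs ! i))"

lemma Sn_eq: "Sn = {..<n}"
proof -
  have "(\<Union>i<length bs. set (bs ! (qs ! i))) = \<Union>((\<lambda>i. set (bs ! i)) ` set qs)"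
    using q(2) by (force simp: in_set_conv_nth)
  also have "\<dots> = \<Union>(set (map set bs))" unfolding q(1) by (force simp: in_set_conv_nth)
  finally show ?thesis using s_less bags_cover unfolding Sn by auto
qed

lemma D:
  "ix s = 1" "col s = 0" "ord 1 = s" "\<And>v. 0 < ix v \<longleftrightarrow> v < n"
  "\<And>v. v < n \<Longrightarrow> ix v \<le> m \<and> ord (ix v) = v \<and> col v < K"
  "\<And>i. 1 \<le> i \<Longrightarrow> i \<le> m \<Longrightarrow> ord i < n \<and> ix (ord i) = i"
  "\<And>v. v < n \<Longrightarrow> v \<noteq> s \<Longrightarrow> good \<beta> (length bs) ix col mk par v"
  using dinv unfolding dinv_def Sn_eq \<beta>_def[abs_def] by auto

lemma m_eq: "m = n"
proof -
  have "bij_betw ord {1..m} {..<n}"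
  proof (rule bij_betw_byWitness[where f' = ix])
    show "\<forall>a\<in>{1..m}. ix (ord a) = a" "ord ` {1..m} \<subseteq> {..<n}" using D(6) by auto
    show "\<forall>a'\<in>{..<n}. ord (ix a') = a'" using D(5) by auto
    have "1 \<le> ix v" if "v < n" for v using D(4)[of v] that by simp
    then show "ix ` {..<n} \<subseteq> {1..m}" using D(5) by auto
  qed
  from bij_betw_same_card[OF this] show ?thesis by simp
qed

definition goodf :: "nat \<Rightarrow> nat \<Rightarrow> bool" where
  "goodf v f \<longleftrightarrow> f < length bs \<and> v \<in> \<beta> f \<and> (\<forall>i<f. \<forall>w\<in>\<beta> i. 0 < ix w \<and> ix w < ix v) \<and>
     (\<forall>c. bit (mk v) c \<longleftrightarrow> c \<in> col ` earlier ix (insert s (\<beta> f)) v) \<and>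
     col v \<notin> col ` earlier ix (insert s (\<beta> f)) v \<and>
     par v \<in> earlier ix (insert s (\<beta> f)) v \<and>
     (\<forall>w\<in>earlier ix (insert s (\<beta> f)) v. ix w \<le> ix (par v))"

definition f :: "nat \<Rightarrow> nat" where "f v = (SOME f. goodf v f)"

lemma goodf: "v < n \<Longrightarrow> v \<noteq> s \<Longrightarrow> goodf v (f v)"
  using D(7)[of v] someI_ex[of "goodf v"] unfolding f_def goodf_def good_def by blast

text \<open>All earlier members of the topmost bag count as neighbours, joined by an edge or not: in
  the graph with fill-in edges every bag is a clique.\<close>

definition X :: "nat \<Rightarrow> nat set" where
  "X v = (if v = s then {} else earlier ix (insert s (\<beta> (f v))) v)"

definition vs :: "nat list" where
  "vs = map ord [1..<Suc n]"

lemma \<beta>_less: "i < length bs \<Longrightarrow> x \<in> \<beta> i \<Longrightarrow> x < n"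
  using bs_less[of "bs ! (qs ! i)"] q nth_mem[of i qs] unfolding \<beta>_def by force

lemma ix_inj: "u < n \<Longrightarrow> v < n \<Longrightarrow> ix u = ix v \<Longrightarrow> u = v"
  using D(5) by metis

text \<open>The topmost bag of \<open>u\<close> cannot come after that of \<open>v\<close>, as
  \<open>v\<close> would then have been discovered before \<open>u\<close>. So the running
  intersection property carries \<open>u\<close> from the common bag into the topmost bag of
  \<open>v\<close>; the vertex \<open>s\<close> is there by definition.\<close>

lemma in_X:
  assumes i: "i < length bs" "u \<in> insert s (\<beta> i)" "v \<in> insert s (\<beta> i)" and lt: "ix u < ix v"
  shows "u \<in> X v"
proof -
  have n: "u < n" "v < n" using i \<beta>_less s_less by auto
  have vs: "v \<noteq> s" using lt D(4)[of u] n(1) D(1) by auto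
  have u0: "0 < ix u" using D(4) n by simp
  note gv = goodf[OF n(2) vs, unfolded goodf_def]
  show ?thesis
  proof (cases "u = s")
    case True
    then show ?thesis using vs lt u0 unfolding X_def earlier_def by simp
  next
    case False
    note gu = goodf[OF n(1) False, unfolded goodf_def]
    have le: "f u \<le> f v"
    proof (rule ccontr)
      assume "\<not> f u \<le> f v"
      then have "ix v < ix u" using gu gv by (meson not_le)
      then show False using lt by simp
    qed
    have nth: "map (\<lambda>i. set (bs ! i)) qs ! j = \<beta> j" if "j < length bs" for j
      using that q(2) unfolding \<beta>_def by simp
    have "u \<in> map (\<lambda>i. set (bs ! i)) qs ! f v"
    proof (rule rip_first[OF q(3)])
      show "v \<notin> map (\<lambda>i. set (bs ! i)) qs ! j" if j: "j < f v" for j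
      proof -
        have "j < length bs" using j gv by simp
        then show ?thesis using nth[of j] gv j by (metis less_irrefl)
      qed
      show "i < length (map (\<lambda>i. set (bs ! i)) qs)" "f u < length (map (\<lambda>i. set (bs ! i)) qs)"
        using i gu q(2) by auto
      show "u \<in> map (\<lambda>i. set (bs ! i)) qs ! i" "v \<in> map (\<lambda>i. set (bs ! i)) qs ! i"
        using i nth[of i] False vs by auto
      show "u \<in> map (\<lambda>i. set (bs ! i)) qs ! f u" "v \<in> map (\<lambda>i. set (bs ! i)) qs ! f v"
        using gu gv nth by auto
    qed (rule le)
    then have "u \<in> \<beta> (f v)" using nth gv by simp
    then show ?thesis using vs lt u0 unfolding X_def earlier_def by simp
  qed
qed

text \<open>Both vertices lie in the topmost bag of \<open>v\<close>, extended by \<open>s\<close>.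
  The inclusion of \<open>X\<close> in the bag of the parent and the injectivity of the colours both
  come from here.\<close>

lemma X_pair:
  assumes v: "v < n" and ab: "a \<in> insert v (X v)" "b \<in> insert v (X v)" and lt: "ix a < ix b"
  shows "a \<in> X b"
proof (cases "v = s")
  case True
  then show ?thesis using ab lt unfolding X_def by simp
next
  case False
  have "f v < length bs" "insert v (X v) \<subseteq> insert s (\<beta> (f v))"
    using goodf[OF v False] False unfolding X_def goodf_def earlier_def by auto
  then show ?thesis using in_X[of "f v" a b] ab lt by blast
qed

lemma X_less': "v < n \<Longrightarrow> x \<in> X v \<Longrightarrow> x < n \<and> ix x < ix v"
  using \<beta>_less[of "f v" x] goodf[of v] s_less unfolding X_def goodf_def earlier_def
  by (auto split: if_splits)

text \<open>Reversed, the discovery order is a perfect elimination order of the graph with fill-in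
  edges. The parent is the latest of the earlier neighbours; the others precede it and share a bag
  with it, so they are earlier neighbours of the parent as well.\<close>

lemma elimination: "elimination (set es) vs X par"
proof
  have nth: "vs ! i = ord (Suc i)" if "i < n" for i using that unfolding vs_def by (simp del: upt_Suc)
  have len: "length vs = n" unfolding vs_def by simp
  have ixn: "ix (vs ! i) = Suc i" "vs ! i < n" if "i < n" for i
    using D(6)[of "Suc i"] that nth[OF that] unfolding m_eq by auto
  have set: "set vs = {..<n}"
  proof -
    have "v \<in> set vs" if "v < n" for v
    proof -
      have "ix v - 1 < n" "Suc (ix v - 1) = ix v" using D(4)[of v] D(5)[OF that] that unfolding m_eq by auto
      then have "vs ! (ix v - 1) = v" using nth D(5)[OF that] by simp
      then show ?thesis using \<open>ix v - 1 < n\<close> len nth_mem by metis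
    qed
    moreover have "v < n" if "v \<in> set vs" for v using that ixn len by (auto simp: in_set_conv_nth)
    ultimately show ?thesis by auto
  qed
  show "distinct vs" using ixn len unfolding distinct_conv_nth by (metis Suc_inject)
  show "vs \<noteq> []" using len s_less by auto
  show "X (vs ! i) \<subseteq> set (take i vs)" if "i < length vs" for i
  proof
    fix x assume x: "x \<in> X (vs ! i)"
    have i: "i < n" using that len by simp
    have xn: "x < n" "ix x < Suc i" using X_less'[OF ixn(2)[OF i] x] ixn(1)[OF i] by auto
    obtain j where j: "ix x = Suc j" using D(4)[of x] xn(1) by (metis gr0_implies_Suc)
    then have "vs ! j = x" "j < i" using nth[of j] xn i D(5)[OF xn(1)] by auto
    then show "x \<in> set (take i vs)" using i len by (metis in_set_conv_nth length_take min.absorb4 nth_take)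
  qed
  have par: "par (vs ! i) \<in> X (vs ! i) \<and> X (vs ! i) \<subseteq> insert (par (vs ! i)) (X (par (vs ! i)))" if i: "i < length vs" "0 < i" for i
  proof -
    let ?v = "vs ! i"
    have v: "?v < n" "?v \<noteq> s" using i len ixn[of i] D(1) by auto
    note gv = goodf[OF v, unfolded goodf_def]
    have p: "par ?v \<in> X ?v" using gv v unfolding X_def by simp
    have "x \<in> X (par ?v)" if x: "x \<in> X ?v" "x \<noteq> par ?v" for x
    proof (rule X_pair[OF v(1)])
      have "ix x \<le> ix (par ?v)" using gv x v unfolding X_def by simp
      moreover have "ix x \<noteq> ix (par ?v)" using x p X_less'[OF v(1)] ix_inj by blast
      ultimately show "ix x < ix (par ?v)" by simp
    qed (use x p in auto)
    then show ?thesis using p by blast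
  qed
  show "par (vs ! i) \<in> X (vs ! i)" "X (vs ! i) \<subseteq> insert (par (vs ! i)) (X (par (vs ! i)))"
    if "i < length vs" "0 < i" for i using par[OF that] by auto
  show "set es \<subseteq> set vs \<times> set vs" using es_less set by auto
  show "u \<in> X v \<or> v \<in> X u" if uv: "(u, v) \<in> set es" "u \<noteq> v" for u v
  proof -
    have n: "u < n" "v < n" using es_less[OF uv(1)] by auto
    have "{u, v} \<in> undirected (set es)" unfolding undirected_def using uv(1) by blast
    then obtain b where b: "b \<in> set bs" "{u, v} \<subseteq> set b" using td unfolding tree_decomposition_def by auto
    obtain j where j: "j < length bs" "bs ! j = b" using b(1) by (auto simp: in_set_conv_nth)
    then obtain i where i: "i < length bs" "qs ! i = j" using q by (metis in_set_conv_nth lessThan_iff)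
    have bi: "u \<in> insert s (\<beta> i)" "v \<in> insert s (\<beta> i)" using b j i unfolding \<beta>_def by auto
    have "ix u \<noteq> ix v" using ix_inj n uv(2) by blast
    then consider "ix u < ix v" | "ix v < ix u" by linarith
    then show ?thesis using in_X[OF i(1)] bi by cases auto
  qed
qed

lemma coloured_elimination:
  assumes P: "2 ^ K \<le> Z ^ 3"
  shows "coloured_elimination wd L n s pr es bs ts inp Z vs X par ix col mk ord (2 ^ K)"
proof -
  interpret el: elimination "set es" "{u. u < n \<and> pr u}" vs X par by (rule elimination)
  have nth: "vs ! i = ord (Suc i)" if "i < n" for i using that unfolding vs_def by (simp del: upt_Suc)
  show ?thesis
  proof unfold_locales
    have "set vs = ord ` {1..n}" unfolding vs_def by (auto simp: image_iff)
    also have "\<dots> = {..<n}"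
    proof
      show "ord ` {1..n} \<subseteq> {..<n}" using D(6) m_eq by auto
      show "{..<n} \<subseteq> ord ` {1..n}"
      proof
        fix v assume "v \<in> {..<n}"
        then have "ix v \<in> {1..n}" "ord (ix v) = v" using D(4)[of v] D(5)[of v] m_eq by auto
        then show "v \<in> ord ` {1..n}" by (metis imageI)
      qed
    qed
    finally show "set vs = {..<n}" .
    show "vs ! 0 = s" using nth[of 0] s_less D(3) by simp
    show "ord (Suc i) = vs ! i" "ix (vs ! i) = Suc i" if "i < n" for i
      using nth[OF that] D(6)[of "Suc i"] that m_eq by auto
    show "bit (mk v) c \<longleftrightarrow> c \<in> col ` X v" if "v < n" "v \<noteq> s" for v c
      using goodf[OF that] that unfolding goodf_def X_def by simp
    show "col v < K" if "v < n" for v using D(5)[OF that] by simp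
    show "inj_on col (insert v (X v))" if v: "v < n" for v
    proof (rule inj_onI, rule ccontr)
      fix a b assume ab: "a \<in> insert v (X v)" "b \<in> insert v (X v)" "col a = col b" "a \<noteq> b"
      have n: "a < n" "b < n" using ab X_less'[OF v] v by auto
      \<comment> \<open>Of two members with the same colour, the later one would have received a
        colour that was already taken by an earlier neighbour.\<close>
      have neq: False if "a \<in> X b" "col a = col b" "b < n" for a b
      proof (cases "b = s")
        case False
        have "col a \<in> col ` X b" by (rule imageI[OF that(1)])
        then show ?thesis using goodf[OF that(3) False] that(2) False unfolding goodf_def X_def by simp
      qed (use that in \<open>simp add: X_def\<close>)
      have "ix a \<noteq> ix b" using ix_inj n ab(4) by blast
      then consider "ix a < ix b" | "ix b < ix a" by linarith
      then show False using X_pair[OF v] ab neq n by cases metis+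
    qed
  qed (use D P in auto)
qed

end

section \<open>Naive algorithm by repeated backward search and pruning\<close>

text \<open>The naive algorithm is used for \<open>n\<^sup>2 < 2 ^ k\<close>, where masks may not fit into words. It takes time
  \<open>O(n\<^sup>3 k)\<close>, which is \<open>O(n 2\<^sup>k k)\<close> in this case.\<close>

definition reach_pass :: stm where
  "reach_pass = For 83 2 (84 ::= Ld 0 (V 5 [+] N 2 [*] V 83) ;; 85 ::= Ld 0 (V 5 [+] N 2 [*] V 83 [+] N 1) ;;
     Cond (Ld 15 (V 84) [and] Ld 16 (V 85)) (Sto 16 (V 84) (N 1)) Skip)"

definition prune_pass :: stm where
  "prune_pass = For 83 2 (84 ::= Ld 0 (V 5 [+] N 2 [*] V 83) ;; 85 ::= Ld 0 (V 5 [+] N 2 [*] V 83 [+] N 1) ;;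
     Cond (Ld 0 (N 5 [+] V 84)) (Cond (Ld 15 (V 85)) Skip (Sto 15 (V 84) (N 0))) Skip)"

definition naive_round :: stm where
  "naive_round = (For 80 0 (Sto 16 (V 80) (N 0)) ;; Sto 16 (V 1) (Ld 15 (V 1)) ;;
     For 82 0 reach_pass ;; For 80 0 (Sto 15 (V 80) (Ld 16 (V 80))) ;; prune_pass)"

definition naive :: stm where
  "naive = (For 80 0 (Sto 15 (V 80) (N 1)) ;; For 81 0 naive_round)"

lemma wr_naive: "wr reach_pass = {83,84,85,97}" "wa reach_pass = {16}" "wr prune_pass = {83,84,85,97}" "wa prune_pass = {15}"
  "wr naive_round = {80,82,83,84,85,97}" "wa naive_round = {15,16}"
  by (auto simp: reach_pass_def prune_pass_def naive_round_def)

lemma and_of_bool: "Bit_Operations.and (of_bool a) (of_bool b) = (of_bool (a \<and> b) :: nat)"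
  by (cases a; cases b) auto

context instance_input
begin

definition ind :: "nat set \<Rightarrow> nat \<Rightarrow> nat" where
  "ind Q u = of_bool (u \<in> Q)"

definition as_closed :: "nat set \<Rightarrow> bool" where
  "as_closed C \<longleftrightarrow> C \<subseteq> {..<n} \<and> (\<forall>q\<in>C. s \<in> C \<and> (q, s) \<in> (set es \<inter> C \<times> C)\<^sup>*) \<and>
     (\<forall>u v. (u, v) \<in> set es \<longrightarrow> u \<in> C \<longrightarrow> pr u \<longrightarrow> v \<in> C)"

text \<open>Soundness of a backward search from \<open>s\<close> inside \<open>Q\<close>, whereas
  \<open>stable\<close> is its completion. Together they make \<open>r\<close> the set of vertices
  that reach \<open>s\<close> within \<open>Q\<close>.\<close>

definition reaching :: "nat set \<Rightarrow> nat set \<Rightarrow> bool" where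
  "reaching Q r \<longleftrightarrow> r \<subseteq> Q \<and> (s \<in> Q \<longrightarrow> s \<in> r) \<and> (\<forall>q\<in>r. s \<in> r \<and> (q, s) \<in> (set es \<inter> r \<times> r)\<^sup>*)"

definition stable :: "nat set \<Rightarrow> nat set \<Rightarrow> bool" where
  "stable Q r \<longleftrightarrow> (\<forall>u v. (u, v) \<in> set es \<longrightarrow> u \<in> Q \<longrightarrow> v \<in> r \<longrightarrow> u \<in> r)"

lemma reaching_insert:
  assumes "reaching Q r" "(u, v) \<in> set es" "u \<in> Q" "v \<in> r"
  shows "reaching Q (insert u r)"
proof -
  have m: "(set es \<inter> r \<times> r)\<^sup>* \<subseteq> (set es \<inter> insert u r \<times> insert u r)\<^sup>*" by (rule rtrancl_mono) auto
  have "(u, v) \<in> set es \<inter> insert u r \<times> insert u r" "(v, s) \<in> (set es \<inter> insert u r \<times> insert u r)\<^sup>*"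
    using assms m unfolding reaching_def by auto
  then have "(u, s) \<in> (set es \<inter> insert u r \<times> insert u r)\<^sup>*" by (rule converse_rtrancl_into_rtrancl)
  then show ?thesis using assms m unfolding reaching_def by blast
qed

text \<open>Walking back along a path of \<open>C\<close> from \<open>s\<close> to \<open>q\<close>
  never leaves \<open>r\<close>. So replacing \<open>Q\<close> by \<open>r\<close> loses no closed
  set.\<close>

lemma stable_closed:
  assumes "stable Q r" "reaching Q r" "as_closed C" "C \<subseteq> Q"
  shows "C \<subseteq> r"
proof
  fix q assume q: "q \<in> C"
  have sr: "s \<in> r" using assms q unfolding as_closed_def reaching_def by blast
  have "(q, s) \<in> (set es \<inter> C \<times> C)\<^sup>*" using assms(3) q unfolding as_closed_def by blast
  then show "q \<in> r"
  proof (induction rule: converse_rtrancl_induct)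
    case (step y z)
    then show ?case using assms(1,4) unfolding stable_def by blast
  qed (rule sr)
qed

definition nglob :: "regs \<Rightarrow> arrs \<Rightarrow> bool" where
  "nglob R A \<longleftrightarrow> R 0 = n \<and> R 1 = s \<and> R 2 = length es \<and> R 5 = eb \<and> A 0 = In"

lemma nglob_agree:
  "nglob R A \<Longrightarrow> agree c R A R' A' \<Longrightarrow> wr c \<inter> {0,1,2,5} = {} \<Longrightarrow> 0 \<notin> wa c \<Longrightarrow> nglob R' A'"
  unfolding nglob_def agree_def by auto

lemma edge_access:
  assumes "e < length es"
  shows "In (eb + 2 * e) = fst (es ! e)" "In (Suc (eb + 2 * e)) = snd (es ! e)"
    "Suc (eb + 2 * e) < L" "Suc (eb + 2 * e) < 2 ^ wd" "fst (es ! e) < n" "snd (es ! e) < n" "2 * e < 2 ^ wd"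
    "es ! e \<in> set es"
proof -
  have "Suc (eb + 2 * e) < tb" using Z_ge(8) assms by simp
  then show "Suc (eb + 2 * e) < L" "Suc (eb + 2 * e) < 2 ^ wd" "2 * e < 2 ^ wd"
    using length_inp Z_ge small1[of "Suc (eb + 2 * e)"] by auto
  show "fst (es ! e) < n" "snd (es ! e) < n" "es ! e \<in> set es"
    using es_less[of "fst (es ! e)" "snd (es ! e)"] assms by auto
qed (use In_es assms in auto)

lemma small_ones: "length es < 2 ^ wd" "n < 2 ^ wd"
  using Z_ge small1 by auto

lemma pr_access: "u < n \<Longrightarrow> In (5 + u) = of_bool (pr u) \<and> 5 + u < L \<and> 5 + u < 2 ^ wd"
  using In_pr length_inp Z_ge small1[of "5 + u"] by (auto simp: tb_def off_def eb_def)

lemma wp_reach_pass: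
  assumes g: "nglob R A" and Q: "A 15 = ind Q" and r: "A 16 = ind r" "reaching Q r"
  shows "wp reach_pass (\<lambda>t R' A'. t \<le> length es * 6 + 2 \<and> agree reach_pass R A R' A' \<and>
    (\<exists>r'. A' 16 = ind r' \<and> reaching Q r' \<and> r \<subseteq> r' \<and> (r' = r \<longrightarrow> stable Q r))) R A"
proof -
  \<comment> \<open>Edges handled so far are compared with the initial set \<open>r\<close>, not
    with the growing \<open>r'\<close>. This is monotone in \<open>r'\<close>, and it amounts to
    stability exactly when the pass has added nothing.\<close>
  define J where "J f e \<longleftrightarrow> (\<exists>r'. f = ind r' \<and> reaching Q r' \<and> r \<subseteq> r' \<and>
    (\<forall>e'<e. fst (es ! e') \<in> Q \<longrightarrow> snd (es ! e') \<in> r \<longrightarrow> fst (es ! e') \<in> r'))" for f e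
  show ?thesis
    unfolding reach_pass_def
  proof (rule wp_For_conseq[where T = 4 and I = "\<lambda>e R' A'. J (A' 16) e"], goal_cases)
    case 5
    then show ?case using r unfolding J_def by auto
  next
    case (6 e R' A')
    have e: "e < length es" using 6(1) g unfolding nglob_def by simp
    have dg: "nglob R' A'" by (rule nglob_agree[OF g 6(3)]) auto
    note dg' = dg[unfolded nglob_def]
    obtain r' where r': "A' 16 = ind r'" "reaching Q r'" "r \<subseteq> r'"
      "\<forall>e'<e. fst (es ! e') \<in> Q \<longrightarrow> snd (es ! e') \<in> r \<longrightarrow> fst (es ! e') \<in> r'" using 6(2) unfolding J_def by blast
    have A15: "A' 15 = ind Q" using agree_A[OF 6(3), of 15] Q by simp
    define u v where "u = fst (es ! e)" and "v = snd (es ! e)"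
    note ea = edge_access[OF e, folded u_def v_def]
    have uv: "(u, v) \<in> set es" using ea(8) unfolding u_def v_def by simp
    show ?case
    proof (cases "u \<in> Q \<and> v \<in> r'")
      case True
      have "(ind r')(u := 1) = ind (insert u r')" unfolding ind_def by auto
      then have "J ((A' 16)(u := Suc 0)) (Suc e)"
        unfolding J_def using r' True reaching_insert[OF r'(2) uv]
        by (intro exI[of _ "insert u r'"]) (auto simp: less_Suc_eq u_def v_def)
      then show ?thesis
        using ea True by (simp add: dg' 6(4) A15 r'(1) ind_def and_of_bool)
    next
      case False
      then have "J (A' 16) (Suc e)"
        unfolding J_def using r' by (intro exI[of _ r']) (auto simp: less_Suc_eq u_def v_def)
      then show ?thesis
        using ea False by (simp add: dg' 6(4) A15 r'(1) ind_def[of _ u] ind_def[of _ v] and_of_bool)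
    qed
  next
    case (7 t R' A')
    have R2: "R 2 = length es" using g unfolding nglob_def by simp
    obtain r' where r': "A' 16 = ind r'" "reaching Q r'" "r \<subseteq> r'"
      "\<forall>e'<length es. fst (es ! e') \<in> Q \<longrightarrow> snd (es ! e') \<in> r \<longrightarrow> fst (es ! e') \<in> r'"
      using 7(2) unfolding R2 J_def by blast
    have "stable Q r" if "r' = r"
      unfolding stable_def
    proof (intro allI impI)
      fix u v assume uv: "(u, v) \<in> set es" "u \<in> Q" "v \<in> r"
      then obtain e where "e < length es" "es ! e = (u, v)" by (auto simp: in_set_conv_nth)
      then show "u \<in> r" using r'(4) uv that by force
    qed
    then show ?case using 7(1,3) r' R2 by (auto simp: reach_pass_def)
  qed (use g small_ones in \<open>auto simp: nglob_def\<close>)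
qed

lemma wp_prune_pass:
  assumes g: "nglob R A" and Q: "A 15 = ind Q"
  shows "wp prune_pass (\<lambda>t R' A'. t \<le> length es * 7 + 2 \<and> agree prune_pass R A R' A' \<and>
    (\<exists>Q'. A' 15 = ind Q' \<and> Q' \<subseteq> Q \<and> (\<forall>C. as_closed C \<longrightarrow> C \<subseteq> Q \<longrightarrow> C \<subseteq> Q') \<and>
      (Q' = Q \<longrightarrow> (\<forall>u v. (u, v) \<in> set es \<longrightarrow> u \<in> Q \<longrightarrow> pr u \<longrightarrow> v \<in> Q)))) R A"
proof -
  \<comment> \<open>Targets are compared with the initial \<open>Q\<close>, since the current
    \<open>Q'\<close> may still lose them. If nothing is removed, this becomes the local condition
    for \<open>Q\<close>.\<close>
  define J where "J f e \<longleftrightarrow> (\<exists>Q'. f = ind Q' \<and> Q' \<subseteq> Q \<and> (\<forall>C. as_closed C \<longrightarrow> C \<subseteq> Q \<longrightarrow> C \<subseteq> Q') \<and>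
    (\<forall>e'<e. fst (es ! e') \<in> Q' \<longrightarrow> pr (fst (es ! e')) \<longrightarrow> snd (es ! e') \<in> Q))" for f e
  show ?thesis
    unfolding prune_pass_def
  proof (rule wp_For_conseq[where T = 5 and I = "\<lambda>e R' A'. J (A' 15) e"], goal_cases)
    case 5
    then show ?case using Q unfolding J_def by auto
  next
    case (6 e R' A')
    have e: "e < length es" using 6(1) g unfolding nglob_def by simp
    have dg: "nglob R' A'" by (rule nglob_agree[OF g 6(3)]) auto
    note dg' = dg[unfolded nglob_def]
    obtain Q' where Q': "A' 15 = ind Q'" "Q' \<subseteq> Q" "\<forall>C. as_closed C \<longrightarrow> C \<subseteq> Q \<longrightarrow> C \<subseteq> Q'"
      "\<forall>e'<e. fst (es ! e') \<in> Q' \<longrightarrow> pr (fst (es ! e')) \<longrightarrow> snd (es ! e') \<in> Q" using 6(2) unfolding J_def by blast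
    define u v where "u = fst (es ! e)" and "v = snd (es ! e)"
    note ea = edge_access[OF e, folded u_def v_def]
    note pa = pr_access[OF ea(5)]
    have uv: "(u, v) \<in> set es" using ea(8) unfolding u_def v_def by simp
    show ?case
    proof (cases "pr u \<and> v \<notin> Q'")
      case True
      have "(ind Q')(u := 0) = ind (Q' - {u})" unfolding ind_def by auto
      moreover have "C \<subseteq> Q' - {u}" if "as_closed C" "C \<subseteq> Q" for C
        using Q'(3) that True uv unfolding as_closed_def by blast
      ultimately have "J ((A' 15)(u := 0)) (Suc e)"
        unfolding J_def using Q' True by (intro exI[of _ "Q' - {u}"]) (auto simp: less_Suc_eq u_def v_def)
      then show ?thesis
        using ea pa True by (simp add: dg' 6(4) Q'(1) ind_def)
    next
      case False
      then have "J (A' 15) (Suc e)"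
        unfolding J_def using Q' by (intro exI[of _ Q']) (auto simp: less_Suc_eq u_def v_def)
      then show ?thesis
        using ea pa False by (simp add: dg' 6(4) Q'(1) ind_def[of _ u] ind_def[of _ v])
    qed
  next
    case (7 t R' A')
    have R2: "R 2 = length es" using g unfolding nglob_def by simp
    obtain Q' where Q': "A' 15 = ind Q'" "Q' \<subseteq> Q" "\<forall>C. as_closed C \<longrightarrow> C \<subseteq> Q \<longrightarrow> C \<subseteq> Q'"
      "\<forall>e'<length es. fst (es ! e') \<in> Q' \<longrightarrow> pr (fst (es ! e')) \<longrightarrow> snd (es ! e') \<in> Q"
      using 7(2) unfolding R2 J_def by blast
    have "\<forall>u v. (u, v) \<in> set es \<longrightarrow> u \<in> Q \<longrightarrow> pr u \<longrightarrow> v \<in> Q" if "Q' = Q"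
    proof (intro allI impI)
      fix u v assume uv: "(u, v) \<in> set es" "u \<in> Q" "pr u"
      then obtain e where "e < length es" "es ! e = (u, v)" by (auto simp: in_set_conv_nth)
      then show "v \<in> Q" using Q'(4) uv that by force
    qed
    then show ?case using 7(1,3) Q' R2 by (auto simp: prune_pass_def)
  qed (use g small_ones in \<open>auto simp: nglob_def\<close>)
qed


lemma wp_zero:
  assumes "R 0 = n" and z: "\<forall>u\<ge>n. A 16 u = 0"
  shows "wp (For 80 0 (Sto 16 (V 80) (N 0))) (\<lambda>t R' A'. t \<le> n * 3 + 2 \<and> A' 16 = ind {} \<and>
      agree (For 80 0 (Sto 16 (V 80) (N 0))) R A R' A') R A"
proof (rule wp_For_conseq[where T = 1 and I = "\<lambda>j R' A'. (\<forall>u<j. A' 16 u = 0) \<and> (\<forall>u\<ge>n. A' 16 u = 0)"], goal_cases)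
  case (7 t R' A')
  then have "A' 16 u = 0" for u using assms(1) by (cases "u < n") auto
  then show ?case using 7 assms(1) unfolding ind_def by auto
qed (use small_ones assms in \<open>auto simp: less_Suc_eq\<close>)

lemma wp_copy:
  assumes "R 0 = n" and q: "A 15 = ind Q" "A 16 = ind r" "Q \<subseteq> {..<n}" "r \<subseteq> {..<n}"
  shows "wp (For 80 0 (Sto 15 (V 80) (Ld 16 (V 80)))) (\<lambda>t R' A'. t \<le> n * 3 + 2 \<and> A' 15 = ind r \<and>
      agree (For 80 0 (Sto 15 (V 80) (Ld 16 (V 80)))) R A R' A') R A"
proof (rule wp_For_conseq[where T = 1 and I = "\<lambda>j R' A'. \<forall>u. A' 15 u = (if u < j then ind r u else ind Q u)"], goal_cases)
  case (6 j R' A')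
  have "A' 16 = ind r" using agree_A[OF 6(3), of 16] q by simp
  then show ?case using 6(2,4) by (simp add: less_Suc_eq)
next
  case (7 t R' A')
  then have "A' 15 u = ind r u" for u using assms(1) q(3,4) by (cases "u < n") (auto simp: ind_def)
  then show ?case using 7 assms(1) by auto
qed (use small_ones assms in auto)

lemma wp_reach_passes:
  assumes g: "nglob R A" and Q: "A 15 = ind Q" "Q \<subseteq> {..<n}" and r: "A 16 = ind r" "reaching Q r"
  shows "wp (For 82 0 reach_pass) (\<lambda>t R' A'. t \<le> n * (length es * 6 + 4) + 2 \<and> agree (For 82 0 reach_pass) R A R' A' \<and>
    (\<exists>r'. A' 16 = ind r' \<and> reaching Q r' \<and> stable Q r')) R A"
proof -
  \<comment> \<open>A pass that does not find stability adds at least one vertex, so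
    \<open>n\<close> passes suffice.\<close>
  define J where "J f j \<longleftrightarrow> (\<exists>r'. f = ind r' \<and> reaching Q r' \<and> (stable Q r' \<or> j \<le> card r'))" for f j
  have fin: "finite r' \<and> card r' \<le> n" if "reaching Q r'" for r'
    using that Q(2) card_mono[of "{..<n}" r'] finite_subset[of r' "{..<n}"] unfolding reaching_def by auto
  show ?thesis
  proof (rule wp_For_conseq[where T = "length es * 6 + 2" and I = "\<lambda>j R' A'. J (A' 16) j"], goal_cases)
    case 5
    show ?case unfolding J_def using r by auto
  next
    case (6 j R' A')
    have dg: "nglob R' A'" by (rule nglob_agree[OF g 6(3)]) (auto simp: wr_naive)
    have A15: "A' 15 = ind Q" using agree_A[OF 6(3), of 15] Q by (simp add: wr_naive)
    obtain r1 where r1: "A' 16 = ind r1" "reaching Q r1" "stable Q r1 \<or> j \<le> card r1" using 6(2) unfolding J_def by blast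
    show ?case
    proof (rule wp_mono[OF wp_reach_pass[OF dg A15 r1(1,2)]], goal_cases)
      case (1 t R2 A2)
      then obtain r2 where r2: "A2 16 = ind r2" "reaching Q r2" "r1 \<subseteq> r2" "r2 = r1 \<longrightarrow> stable Q r1" by blast
      have "stable Q r2 \<or> Suc j \<le> card r2"
      proof (cases "stable Q r1")
        case True
        have "r2 \<subseteq> r1"
        proof
          fix x assume x: "x \<in> r2"
          then have sr: "s \<in> r1" "(x, s) \<in> (set es \<inter> r2 \<times> r2)\<^sup>*" using r2(2) r1(2) unfolding reaching_def by blast+
          from sr(2) show "x \<in> r1"
          proof (induction rule: converse_rtrancl_induct)
            case (step y z)
            then show ?case using True r2(2) unfolding stable_def reaching_def by blast
          qed (rule sr(1))
        qed
        then show ?thesis using True r2(3) by (metis subset_antisym)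
      next
        case False
        then have "r1 \<subset> r2" using r2 by blast
        then have "card r1 < card r2" using fin[OF r2(2)] psubset_card_mono by blast
        then show ?thesis using r1(3) False by simp
      qed
      then have "J (A2 16) (Suc j)" unfolding J_def using r2 by blast
      then show ?case using 1 by simp
    qed
  next
    case (7 t R' A')
    have R0: "R 0 = n" using g unfolding nglob_def by simp
    obtain r1 where r1: "A' 16 = ind r1" "reaching Q r1" "stable Q r1 \<or> n \<le> card r1" using 7(2) unfolding J_def R0 by blast
    have "stable Q r1"
    proof (cases "stable Q r1")
      case False
      then have "card r1 = card {..<n}" using r1 fin[OF r1(2)] by simp
      moreover have "r1 \<subseteq> {..<n}" using r1(2) Q(2) unfolding reaching_def by blast
      ultimately have "r1 = {..<n}" by (simp add: card_subset_eq)
      then show ?thesis using Q(2) unfolding stable_def by blast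
    qed
    moreover have "length es * 6 + 2 + 2 = length es * 6 + 4" by simp
    ultimately show ?case using 7(1,3) r1 unfolding R0 by metis
  qed (use g small_ones in \<open>auto simp: nglob_def wr_naive\<close>)
qed

lemma wp_naive_round:
  assumes g: "nglob R A" and Q: "A 15 = ind Q" "Q \<subseteq> {..<n}" and z: "\<forall>u\<ge>n. A 16 u = 0"
  shows "wp naive_round (\<lambda>t R' A'. t \<le> n * (length es * 6 + 10) + length es * 7 + 9 \<and> (\<forall>u\<ge>n. A' 16 u = 0) \<and>
    (\<exists>Q'. A' 15 = ind Q' \<and> Q' \<subseteq> Q \<and> (\<forall>C. as_closed C \<longrightarrow> C \<subseteq> Q \<longrightarrow> C \<subseteq> Q') \<and> (Q' = Q \<longrightarrow> as_closed Q))) R A"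
proof -
  note dg = g[unfolded nglob_def]
  have R0: "R 0 = n" using dg by simp
  show ?thesis unfolding naive_round_def wp_Sq
  proof (rule wp_mono[OF wp_zero[where R = R and A = A, OF R0 z]], goal_cases)
    case (1 t1 R1 A1)
    then have a1: "agree (For 80 0 (Sto 16 (V 80) (N 0))) R A R1 A1" "A1 16 = ind {}" by auto
    have g1: "nglob R1 A1" by (rule nglob_agree[OF g a1(1)]) auto
    have A15: "A1 15 = ind Q" using agree_A[OF a1(1), of 15] Q by simp
    define r0 where "r0 = (if s \<in> Q then {s} else {})"
    let ?A = "A1(16 := (A1 16)(s := A1 15 s))"
    have r0: "?A 16 = ind r0" "reaching Q r0" unfolding a1(2) A15 r0_def ind_def reaching_def by auto
    have g1': "nglob R1 ?A" using g1 unfolding nglob_def by simp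
    have A15': "?A 15 = ind Q" using A15 by simp
    have s1: "R1 (Suc 0) = s" using g1 unfolding nglob_def by simp
    show ?case
      apply (simp add: s1)
      apply (rule wp_mono[OF wp_reach_passes[OF g1' A15' Q(2) r0]])
    proof (goal_cases)
      case (1 t2 R2 A2)
      then obtain r where r: "A2 16 = ind r" "reaching Q r" "stable Q r" and
        a2: "agree (For 82 0 reach_pass) R1 ?A R2 A2" by blast
      have g2: "nglob R2 A2" by (rule nglob_agree[OF g1' a2]) (auto simp: wr_naive)
      have A15: "A2 15 = ind Q" using agree_A[OF a2, of 15] A15' by (simp add: wr_naive)
      have rn: "r \<subseteq> {..<n}" "r \<subseteq> Q" using r(2) Q(2) unfolding reaching_def by auto
      have R2: "R2 0 = n" using g2 unfolding nglob_def by simp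
      note t2 = 1
      show ?case
      proof (rule wp_mono[OF wp_copy[where R = R2 and A = A2, OF R2 A15 r(1) Q(2) rn(1)]], goal_cases)
        case (1 t3 R3 A3)
        then have a3: "agree (For 80 0 (Sto 15 (V 80) (Ld 16 (V 80)))) R2 A2 R3 A3" "A3 15 = ind r" by auto
        have g3: "nglob R3 A3" by (rule nglob_agree[OF g2 a3(1)]) auto
        have A16: "A3 16 = ind r" using agree_A[OF a3(1), of 16] r by simp
        note t3 = 1
        show ?case
        proof (rule wp_mono[OF wp_prune_pass[OF g3 a3(2)]], goal_cases)
          case (1 t4 R4 A4)
          then obtain Q' where Q': "A4 15 = ind Q'" "Q' \<subseteq> r" "\<forall>C. as_closed C \<longrightarrow> C \<subseteq> r \<longrightarrow> C \<subseteq> Q'"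
            "Q' = r \<longrightarrow> (\<forall>u v. (u, v) \<in> set es \<longrightarrow> u \<in> r \<longrightarrow> pr u \<longrightarrow> v \<in> r)"
            and a4: "agree prune_pass R3 A3 R4 A4" by blast
          have "A4 16 u = 0" if "n \<le> u" for u
            using agree_A[OF a4, of 16] A16 rn that by (auto simp: wr_naive ind_def)
          moreover have "C \<subseteq> Q'" if "as_closed C" "C \<subseteq> Q" for C
            using Q'(3) stable_closed[OF r(3,2) that] that by blast
          moreover have "as_closed Q" if "Q' = Q"
          proof -
            have "r = Q" "Q' = r" using that Q'(2) rn by auto
            then show ?thesis using Q'(4) r(2) Q(2) unfolding as_closed_def reaching_def by blast
          qed
          moreover have "t1 + (1 + (t2 + (t3 + t4))) \<le> n * (length es * 6 + 10) + length es * 7 + 9"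
            using 1 t2 t3 \<open>t1 \<le> n * 3 + 2 \<and> _\<close> by (simp add: algebra_simps)
          moreover have "Q' \<subseteq> Q" using Q'(2) rn by blast
          ultimately show ?case using Q'(1) by (auto simp: algebra_simps)
        qed
      qed
    qed
  qed
qed

lemma as_closed_empty: "as_closed {}"
  unfolding as_closed_def by blast

lemma wp_naive:
  assumes g: "nglob R A" and z: "A 15 = (\<lambda>_. 0)" "A 16 = (\<lambda>_. 0)"
  shows "wp naive (\<lambda>t R' A'. t \<le> n * (n * (length es * 6 + 10) + length es * 7 + 14) + 4 \<and>
    (\<exists>Q. A' 15 = ind Q \<and> as_closed Q \<and> (\<forall>C. as_closed C \<longrightarrow> C \<subseteq> Q)) \<and> agree naive R A R' A') R A"
proof -
  have R0: "R 0 = n" using g unfolding nglob_def by simp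
  \<comment> \<open>A round that changes nothing certifies that the set is closed; any other round
    removes a vertex. After \<open>n\<close> rounds the set is closed or empty, and the empty set is
    closed too.\<close>
  define J where "J A' j \<longleftrightarrow> (\<forall>u\<ge>n. A' 16 u = 0) \<and> (\<exists>Q. A' 15 = ind Q \<and> Q \<subseteq> {..<n} \<and> (\<forall>C. as_closed C \<longrightarrow> C \<subseteq> Q) \<and>
    (as_closed Q \<or> card Q + j \<le> n))" for A' :: arrs and j
  have ones: "wp (For 80 0 (Sto 15 (V 80) (N 1))) (\<lambda>t R' A'. t \<le> n * 3 + 2 \<and> A' 15 = ind {..<n} \<and>
      agree (For 80 0 (Sto 15 (V 80) (N 1))) R A R' A') R A"
  proof (rule wp_For_conseq[where T = 1 and I = "\<lambda>j R' A'. \<forall>u. A' 15 u = of_bool (u < j)"], goal_cases)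
    case (7 t R' A')
    then show ?case using R0 by (auto simp: ind_def)
  qed (use small_ones R0 z in auto)
  have "wp naive (\<lambda>t R' A'. t \<le> n * (n * (length es * 6 + 10) + length es * 7 + 14) + 4 \<and>
    (\<exists>Q. A' 15 = ind Q \<and> as_closed Q \<and> (\<forall>C. as_closed C \<longrightarrow> C \<subseteq> Q))) R A"
    unfolding naive_def wp_Sq
  proof (rule wp_mono[OF ones], goal_cases)
    case (1 t1 R1 A1)
    then have a1: "agree (For 80 0 (Sto 15 (V 80) (N 1))) R A R1 A1" "A1 15 = ind {..<n}" "t1 \<le> n * 3 + 2" by auto
    have g1: "nglob R1 A1" by (rule nglob_agree[OF g a1(1)]) auto
    have A16: "A1 16 = (\<lambda>_. 0)" using agree_A[OF a1(1), of 16] z by simp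
    have R10: "R1 0 = n" using g1 unfolding nglob_def by simp
    show ?case
    proof (rule wp_For_conseq[where T = "n * (length es * 6 + 10) + length es * 7 + 9" and I = "\<lambda>j R' A'. J A' j"], goal_cases)
      case 5
      show ?case unfolding J_def using A16 a1(2) by (auto simp: as_closed_def intro!: exI[of _ "{..<n}"])
    next
      case (6 j R' A')
      have dg: "nglob R' A'" by (rule nglob_agree[OF g1 6(3)]) (auto simp: wr_naive)
      obtain Q where Q: "A' 15 = ind Q" "Q \<subseteq> {..<n}" "\<forall>C. as_closed C \<longrightarrow> C \<subseteq> Q" "as_closed Q \<or> card Q + j \<le> n"
        and z: "\<forall>u\<ge>n. A' 16 u = 0" using 6(2) unfolding J_def by blast
      show ?case
      proof (rule wp_mono[OF wp_naive_round[OF dg Q(1,2) z]], goal_cases)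
        case (1 t R2 A2)
        then obtain Q' where Q': "A2 15 = ind Q'" "Q' \<subseteq> Q" "\<forall>C. as_closed C \<longrightarrow> C \<subseteq> Q \<longrightarrow> C \<subseteq> Q'" "Q' = Q \<longrightarrow> as_closed Q" by blast
        have "as_closed Q' \<or> card Q' + Suc j \<le> n"
        proof (cases "Q' = Q")
          case False
          then have "card Q' < card Q" using Q'(2) Q(2) psubset_card_mono[of Q Q'] finite_subset[of Q "{..<n}"] by auto
          moreover have "\<not> as_closed Q" using False Q' by blast
          ultimately show ?thesis using Q(4) by simp
        qed (use Q' in simp)
        moreover have "\<forall>C. as_closed C \<longrightarrow> C \<subseteq> Q'" using Q(3) Q'(3) by blast
        moreover have "Q' \<subseteq> {..<n}" using Q'(2) Q(2) by blast
        moreover have "\<forall>u\<ge>n. A2 16 u = 0" using 1 by blast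
        ultimately have "J A2 (Suc j)" using Q'(1) unfolding J_def by blast
        then show ?case using 1 by simp
      qed
    next
      case (7 t R' A')
      obtain Q where Q: "A' 15 = ind Q" "Q \<subseteq> {..<n}" "\<forall>C. as_closed C \<longrightarrow> C \<subseteq> Q" "as_closed Q \<or> card Q + n \<le> n"
        using 7(2) unfolding J_def R10 by blast
      have "as_closed Q"
      proof (cases "as_closed Q")
        case False
        then have "Q = {}" using Q(2,4) finite_subset[of Q "{..<n}"] by simp
        then show ?thesis using as_closed_empty by simp
      qed simp
      moreover have "t1 + t \<le> n * (n * (length es * 6 + 10) + length es * 7 + 14) + 4"
        using 7(1) a1(3) R10 by (simp add: algebra_simps)
      ultimately show ?case using Q by blast
    qed (use R10 small_ones in \<open>auto simp: wr_naive\<close>)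
  qed
  then show ?thesis by (rule wp_agree_mono) simp
qed

end

section \<open>Combination of the two algorithms and their running times\<close>

definition dp :: stm where
  "dp = (10 ::= V 7 [+] N 1 ;; 9 ::= (N 1 [shl] V 10) ;; adjacency ;; bfs ;; discover ;;
     init_tables ;; eliminate ;; top_down)"

text \<open>Shifting \<open>n * n\<close> right by the width gives 0 iff
  \<open>n * n < 2 ^ k\<close>. The test avoids computing \<open>2 ^ k\<close>, which might not fit
  into a word.\<close>

definition reach_stm :: stm where
  "reach_stm = (header ;; Cond ((V 0 [*] V 0) [shr] (V 7 [-] N 1)) dp naive ;;
     For 96 0 (Sto 0 (V 96) (Ld 15 (V 96))))"

lemma wr_phases: "wr adjacency = {20,21,22}" "wa adjacency = {2,3}" "wr bfs = {23,24,25,26,97}" "wa bfs = {4,5}"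
  "wr discover = {30,31,32,33,34,35,36,37,38,39,97}" "wa discover = {6,7,8,9,10}"
  "wr init_tables = {40,41,42,43,44,45,46,47,48,49,97}" "wa init_tables = {11,12}"
  "wr eliminate = {50,51,52,53,54,55,56,57,58,59,60,61,62,63,64,65,97}" "wa eliminate = {11,12,13}"
  by (auto simp: adjacency_def bfs_def bfs_loop_def bfs_inner_def discover_def discover_loop_def scan_seen_def scan_new_def free_colour_def
      init_tables_def wr_init_row eliminate_def wr_eliminate_subset)

context instance_td
begin

text \<open>Some bag contains \<open>s\<close>. Therefore \<open>kk - 1\<close>, the width, is not
  affected by truncated subtraction.\<close>

lemma kk_pos: "0 < kk"
proof -
  obtain b where b: "b \<in> set bs" "s \<in> set b" using bags_cover s_less by auto
  then have "1 \<le> length b" using length_pos_if_in_set[OF b(2)] by linarith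
  then show ?thesis using bag_le[OF b(1)] by linarith
qed

lemma card_bag: "b \<in> set (map set bs) \<Longrightarrow> card b \<le> kk"
  using bag_le by (auto intro: le_trans[OF card_length])

lemma nb_bound: "length bs \<le> n * 2 ^ kk + 1"
  using card_bags[OF td _ card_bag] distinct_card[OF bs_inj] by simp

lemma es_bound: "length es \<le> 2 * n * kk"
proof -
  have "set es \<subseteq> {..<n} \<times> {..<n}" using es_less by auto
  then show ?thesis using card_edges[OF td _ _ card_bag] distinct_card[OF es_distinct] by simp
qed

text \<open>Distinct bags make the map from pairs of positions to tree edges injective, so the
  listed pairs are as many as the edges of the tree.\<close>

lemma nt_bound: "length ts \<le> length bs"
proof -
  let ?S = "set (map (\<lambda>(i, j). {i, j}) ts)"
  have F: "F = (\<lambda>e. (\<lambda>i. set (bs ! i)) ` e) ` ?S" unfolding F_def by (simp add: image_image case_prod_beta)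
  have "inj_on (\<lambda>i. set (bs ! i)) {..<length bs}" using bag_inj by (auto simp: inj_on_def)
  then have "inj_on (\<lambda>e. (\<lambda>i. set (bs ! i)) ` e) (Pow {..<length bs})" by (rule inj_on_image_Pow)
  moreover have "?S \<subseteq> Pow {..<length bs}" using ts_less by auto
  ultimately have "inj_on (\<lambda>e. (\<lambda>i. set (bs ! i)) ` e) ?S" by (rule inj_on_subset)
  then have "card F = card ?S" unfolding F by (rule card_image)
  also have "\<dots> = length ts" using distinct_card[OF ts_distinct] by simp
  finally show ?thesis using card_tree_edges[of "set (map set bs)" F] td distinct_card[OF bs_inj]
    unfolding tree_decomposition_def by simp
qed

lemma wp_dp:
  assumes g: "glob R A" and z: "\<And>a. 2 \<le> a \<Longrightarrow> A a = (\<lambda>_. 0)" and P: "2 ^ K \<le> Z ^ 3"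
    and G: "edges G = set es" "verts G = {..<n}" "prob G = {u. u < n \<and> pr u}"
  shows "wp dp (\<lambda>t R' A'. t \<le> 24 * length ts + 4 * length bs + length bs * (kk * (2 * K + 21) + 11) +
     length es * (2 ^ K * 7 + 14) + n * (2 ^ K * (K * 8 + 17) + 17) + 30 \<and>
    (\<forall>x. A' 15 x = of_bool (x \<in> almost_sure_reach G s)) \<and> agree dp R A R' A') R A"
proof -
  define R0 where "R0 = R(10 := K, 9 := 2 ^ K)"
  have g0: "glob R0 A" using g unfolding glob_def R0_def by simp
  have Pw: "2 ^ K < (2::nat) ^ wd"
  proof -
    have "Z ^ 3 < Z ^ 4" using Z_ge(1) by (intro power_strict_increasing) auto
    then show ?thesis using P by (intro small[of _ 4]) auto
  qed
  have r7: "R 7 = kk" using g unfolding glob_def kk_def by simp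
  have body: "wp (adjacency ;; bfs ;; discover ;; init_tables ;; eliminate ;; top_down)
    (\<lambda>t R' A'. t + 2 \<le> 24 * length ts + 4 * length bs + length bs * (kk * (2 * K + 21) + 11) +
     length es * (2 ^ K * 7 + 14) + n * (2 ^ K * (K * 8 + 17) + 17) + 30 \<and>
    (\<forall>x. A' 15 x = of_bool (x \<in> almost_sure_reach G s))) R0 A"
    unfolding wp_Sq
  proof (rule wp_mono[OF wp_adjacency[OF g0 z]], simp, goal_cases)
    case (1 t1 R1 A1)
    then have a1: "agree adjacency R0 A R1 A1" and h1: "\<forall>b. A1 2 b = prev b (2 * length ts)"
      "\<forall>p<2 * length ts. A1 3 (Suc p) = prev (own p) p" by auto
    have g1: "glob R1 A1" by (rule glob_agree[OF g0 a1]) (auto simp: wr_phases)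
    have z1: "A1 a = (\<lambda>_. 0)" if "4 \<le> a" for a using agree_A[OF a1, of a] z[of a] that by (simp add: wr_phases)
    have r1: "R1 9 = 2 ^ K" "R1 10 = K" using agree_R[OF a1] by (auto simp: wr_phases R0_def)
    show ?case
    proof (rule wp_mono[OF wp_bfs[OF g1 h1 z1 z1 bs_ne]], simp, simp, goal_cases)
      case (1 t2 R2 A2)
      then obtain qs where qs: "bfs_list qs" "\<forall>i<length qs. A2 4 i = qs ! i"
        "\<forall>i\<in>set qs. \<forall>j. (i, j) \<in> adj \<longrightarrow> j \<in> set qs" and a2: "agree bfs R1 A1 R2 A2" by blast
      note q = bfs_complete[OF qs(1,3)]
      have g2: "glob R2 A2" by (rule glob_agree[OF g1 a2]) (auto simp: wr_phases)
      have z2: "A2 a = (\<lambda>_. 0)" if "6 \<le> a" for a using agree_A[OF a2, of a] z1[of a] that by (simp add: wr_phases)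
      have r2: "R2 9 = 2 ^ K" "R2 10 = K" using agree_R[OF a2] r1 by (auto simp: wr_phases)
      note t2 = 1
      show ?case
      proof (rule wp_mono[OF wp_discover[OF g2 q(2) _ qs(2) z2 z2 Pw]], goal_cases)
        case (4 t3 R3 A3)
        define Sn where "Sn = insert s (\<Union>i<length bs. set (bs ! (qs ! i)))"
        have ds: "dstate qs (length bs) Sn R3 A3" and a3: "agree discover R2 A2 R3 A3" using 4 unfolding Sn_def by auto
        interpret d: discovered wd L n s pr es bs ts inp Z F qs Sn "R3 38" "A3 6" "A3 7" "A3 8" "A3 9" "A3 10"
          by unfold_locales (use q Sn_def ds in \<open>auto simp: dstate_def\<close>)
        interpret ce: coloured_elimination wd L n s pr es bs ts inp Z d.vs d.X "A3 9" "A3 6" "A3 7" "A3 8" "A3 10" "2 ^ K"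
          by (rule d.coloured_elimination[OF P])
        have g3: "glob R3 A3" by (rule glob_agree[OF g2 a3]) (auto simp: wr_phases)
        have z3: "A3 a = (\<lambda>_. 0)" if "11 \<le> a" for a using agree_A[OF a3, of a] z2[of a] that by (simp add: wr_phases)
        have r3: "R3 9 = 2 ^ K" "R3 10 = K" using agree_R[OF a3] r2 by (auto simp: wr_phases)
        have dg3: "ce.dglob R3 A3" using g3 r3 unfolding glob_def ce.dglob_def by simp
        note t3 = 4
        show ?case
        proof (rule wp_mono[OF ce.wp_init_tables[OF dg3 z3 z3]], simp, simp, goal_cases)
          case (1 t4 R4 A4)
          then have a4: "agree init_tables R3 A3 R4 A4" and rep: "\<forall>z<n. \<forall>S<2 ^ K. ce.rep A4 z S (ce.el.Tb 0 z)" by auto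
          have dg4: "ce.dglob R4 A4" by (rule ce.dglob_agree[OF dg3 a4]) (auto simp: wr_phases)
          have z4: "A4 a = (\<lambda>_. 0)" if "13 \<le> a" for a using agree_A[OF a4, of a] z3[of a] that by (simp add: wr_phases)
          note t4 = 1
          show ?case
          proof (rule wp_mono[OF ce.wp_eliminate[OF dg4 rep z4]], simp, goal_cases)
            case (1 t5 R5 A5)
            then have a5: "agree eliminate R4 A4 R5 A5" and h5: "ce.elim_inv (n - 1) A5" "R5 51 = n - 1" by auto
            have dg5: "ce.dglob R5 A5" by (rule ce.dglob_agree[OF dg4 a5]) (auto simp: wr_phases)
            have z5: "A5 15 = (\<lambda>_. 0)" using agree_A[OF a5, of 15] z4[of 15] by (simp add: wr_phases)
            have reach: "almost_sure_reach G s = (if fst (ce.el.Tb (n - 1) s {s}) then ce.el.expand (n - 1) {s} else {})"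
              using ce.el.almost_sure_reach_eq[of G] G ce.set_vs ce.hd_vs by simp
            note t5 = 1
            show ?case
            proof (rule wp_mono[OF ce.wp_top_down[OF dg5 h5(2,1) z5]], goal_cases)
              case (1 t6 R6 A6)
              have "t1 \<le> 10 * length ts + 3" "t2 \<le> 14 * length ts + 4 * length bs + 4"
                "t3 \<le> length bs * (kk * (2 * K + 21) + 11) + 5" "t4 \<le> length es * (2 ^ K * 7 + 14) + 2"
                "t5 \<le> n * (2 ^ K * (K * 8 + 17) + 8) + 3" "t6 \<le> n * 9 + 6"
                using \<open>t1 \<le> _ \<and> _\<close> t2 t3 t4 t5 1 by auto
              moreover have "n * (2 ^ K * (K * 8 + 17) + 17) = n * (2 ^ K * (K * 8 + 17) + 8) + n * 9"
                by (simp add: algebra_simps)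
              ultimately have "t1 + (t2 + (t3 + (t4 + (t5 + t6)))) + 2 \<le> 24 * length ts + 4 * length bs + length bs * (kk * (2 * K + 21) + 11) +
                length es * (2 ^ K * 7 + 14) + n * (2 ^ K * (K * 8 + 17) + 17) + 30" by linarith
              then show ?case using 1 unfolding reach by blast
            qed
          qed
        qed
      qed (use q in auto)
    qed
  qed
  have "kk + 1 < 2 ^ wd" using K_less(2) unfolding K_def by simp
  then have "wp dp (\<lambda>t R' A'. t \<le> 24 * length ts + 4 * length bs + length bs * (kk * (2 * K + 21) + 11) +
     length es * (2 ^ K * 7 + 14) + n * (2 ^ K * (K * 8 + 17) + 17) + 30 \<and>
    (\<forall>x. A' 15 x = of_bool (x \<in> almost_sure_reach G s))) R A"
    unfolding dp_def
    apply (subst wp_Sq, subst wp_Asg, subst wp_Sq, subst wp_Asg)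
    using Pw body by (auto simp: r7 K_def R0_def elim!: wp_mono)
  then show ?thesis by (rule wp_agree_mono) simp
qed

lemma as_closed_iff:
  assumes G: "edges G = set es" "verts G = {..<n}" "prob G = {u. u < n \<and> pr u}"
  shows "as_closed Q \<longleftrightarrow> almost_sure_closed G s Q"
  unfolding as_closed_def almost_sure_closed_def G by blast

text \<open>Only the discovery phase needs the square; the other phases are linear in the width. The
  maximum with 1 keeps the bound positive for width 0, and 2000 is a round constant that serves both
  algorithms.\<close>

definition time_bound :: nat where
  "time_bound = 2000 * (n * 2 ^ (kk - 1) * (max 1 (kk - 1)) ^ 2)"

lemma time_dp:
  "7 * length bs + 12 + 1 + (24 * length ts + 4 * length bs + length bs * (kk * (2 * K + 21) + 11) +
     length es * (2 ^ K * 7 + 14) + n * (2 ^ K * (K * 8 + 17) + 17) + 30) + (n * 3 + 2) \<le> time_bound"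
proof -
  define k y x where "k = kk - 1" and "y = max 1 k" and "x = (2::nat) ^ k"
  have kk: "kk = Suc k" using kk_pos unfolding k_def by simp
  have kky: "kk \<le> 2 * y" "K \<le> 3 * y" "1 \<le> y" unfolding K_def kk y_def by auto
  have x: "1 \<le> x" "2 ^ kk = 2 * x" "2 ^ K = 4 * x" unfolding x_def K_def kk by auto
  define W where "W = n * x * y ^ 2"
  have yy: "y \<le> y ^ 2" using kky by (simp add: power2_eq_square)
  have n1: "1 \<le> n" using s_less by simp
  have nx: "1 \<le> n * x" using n1 x(1) by (metis mult_le_mono mult_1)
  have nxW: "n * x \<le> W" unfolding W_def using kky(3) by simp
  have nW: "n \<le> W" using nxW x(1) by (metis mult_le_mono2 mult.right_neutral le_trans)
  have nxyW: "n * x * y \<le> W" unfolding W_def using yy by (rule mult_le_mono2)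
  have nb: "length bs \<le> 3 * (n * x)" proof -
    have "n * (2 * x) = 2 * (n * x)" by simp
    then show ?thesis using nb_bound nx unfolding x(2) by linarith
  qed
  have nt: "length ts \<le> 3 * (n * x)" using nt_bound nb by linarith
  have "kk * (2 * K + 21) \<le> (2 * y) * (27 * y)" using kky by (intro mult_le_mono) auto
  moreover have "(2 * y) * (27 * y) = 54 * y ^ 2" by (simp add: power2_eq_square)
  ultimately have "kk * (2 * K + 21) + 11 \<le> 65 * y ^ 2" using kky(3) yy by linarith
  then have "length bs * (kk * (2 * K + 21) + 11) \<le> (3 * (n * x)) * (65 * y ^ 2)" using nb by (intro mult_le_mono)
  then have b1: "length bs * (kk * (2 * K + 21) + 11) \<le> 195 * W" unfolding W_def by simp
  have "length es \<le> 2 * n * (2 * y)" using es_bound kky(1) by (meson le_trans mult_le_mono2)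
  moreover have "2 ^ K * 7 + 14 \<le> 42 * x" unfolding x(3) using x(1) by simp
  ultimately have "length es * (2 ^ K * 7 + 14) \<le> (2 * n * (2 * y)) * (42 * x)" by (rule mult_le_mono)
  also have "\<dots> = 168 * (n * x * y)" by simp
  finally have b2: "length es * (2 ^ K * 7 + 14) \<le> 168 * W" using nxyW by linarith
  have "K * 8 + 17 \<le> 41 * y" using kky by simp
  then have "2 ^ K * (K * 8 + 17) \<le> (4 * x) * (41 * y)" unfolding x(3) by (rule mult_le_mono2)
  then have "2 ^ K * (K * 8 + 17) + 17 \<le> 164 * (x * y) + 17" by simp
  also have "\<dots> \<le> 181 * (x * y)" using x(1) kky(3) by simp
  finally have "n * (2 ^ K * (K * 8 + 17) + 17) \<le> n * (181 * (x * y))" by (rule mult_le_mono2)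
  also have "\<dots> = 181 * (n * x * y)" by simp
  finally have b3: "n * (2 ^ K * (K * 8 + 17) + 17) \<le> 181 * W" using nxyW by linarith
  have "7 * length bs + 12 + 1 + (24 * length ts + 4 * length bs + length bs * (kk * (2 * K + 21) + 11) +
     length es * (2 ^ K * 7 + 14) + n * (2 ^ K * (K * 8 + 17) + 17) + 30) + (n * 3 + 2) \<le> 2000 * W"
    using nb nt b1 b2 b3 nW nxW nx by linarith
  then show ?thesis unfolding time_bound_def W_def x_def y_def k_def by simp
qed

lemma time_naive:
  assumes "n * n < 2 ^ (kk - 1)"
  shows "7 * length bs + 12 + 1 + (n * (n * (length es * 6 + 10) + length es * 7 + 14) + 4) + (n * 3 + 2) \<le> time_bound"
proof -
  define k y x where "k = kk - 1" and "y = max 1 k" and "x = (2::nat) ^ k"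
  have kk: "kk = Suc k" using kk_pos unfolding k_def by simp
  have kky: "kk \<le> 2 * y" "1 \<le> y" unfolding kk y_def by auto
  have x: "1 \<le> x" "2 ^ kk = 2 * x" "n * n \<le> x" using assms unfolding x_def kk by auto
  define W where "W = n * x * y ^ 2"
  have yy: "y \<le> y ^ 2" using kky by (simp add: power2_eq_square)
  have n1: "1 \<le> n" using s_less by simp
  have nx: "1 \<le> n * x" using n1 x(1) by (metis mult_le_mono mult_1)
  have nxW: "n * x \<le> W" unfolding W_def using kky(2) by simp
  have nW: "n \<le> W" using nxW x(1) by (metis mult_le_mono2 mult.right_neutral le_trans)
  have nxyW: "n * x * y \<le> W" unfolding W_def using yy by (rule mult_le_mono2)
  have nb: "length bs \<le> 3 * (n * x)" proof -
    have "n * (2 * x) = 2 * (n * x)" by simp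
    then show ?thesis using nb_bound nx unfolding x(2) by linarith
  qed
  have m: "length es \<le> 4 * (n * y)" using es_bound kky(1) mult_le_mono2[of kk "2 * y" "2 * n"] by linarith
  have ny: "1 \<le> n * y" using n1 kky(2) by (metis mult_le_mono mult_1)
  have "length es * 6 + 10 \<le> 34 * (n * y)" using m ny by linarith
  then have a: "n * (length es * 6 + 10) \<le> n * (34 * (n * y))" by (rule mult_le_mono2)
  have "length es * 7 + 14 \<le> 42 * (n * y)" using m ny by linarith
  also have "\<dots> \<le> n * (42 * (n * y))" using n1 by simp
  finally have "n * (length es * 6 + 10) + length es * 7 + 14 \<le> n * (34 * (n * y)) + n * (42 * (n * y))"
    using a by linarith
  also have "\<dots> = 76 * (n * n * y)" by simp
  \<comment> \<open>The case assumption trades \<open>n * n\<close> for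
    \<open>2 ^ k\<close>.\<close>
  also have "\<dots> \<le> 76 * (x * y)" using x(3) by simp
  finally have "n * (n * (length es * 6 + 10) + length es * 7 + 14) \<le> n * (76 * (x * y))" by (rule mult_le_mono2)
  also have "\<dots> = 76 * (n * x * y)" by simp
  finally have b: "n * (n * (length es * 6 + 10) + length es * 7 + 14) \<le> 76 * W" using nxyW by linarith
  have "7 * length bs + 12 + 1 + (n * (n * (length es * 6 + 10) + length es * 7 + 14) + 4) + (n * 3 + 2) \<le> 2000 * W"
    using nb b nW nxW nx by linarith
  then show ?thesis unfolding time_bound_def W_def x_def y_def k_def by simp
qed

lemma wp_reach_stm:
  assumes A: "A 0 = In" "\<And>a. 0 < a \<Longrightarrow> A a = (\<lambda>_. 0)"
    and G: "edges G = set es" "verts G = {..<n}" "prob G = {u. u < n \<and> pr u}"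
  shows "wp reach_stm (\<lambda>t R' A'. t \<le> time_bound \<and> (\<forall>i<n. A' 0 i = of_bool (i \<in> almost_sure_reach G s))) R A"
proof -
  let ?out = "For 96 0 (Sto 0 (V 96) (Ld 15 (V 96)))"
  have out: "wp ?out (\<lambda>t R' A'. t \<le> n * 3 + 2 \<and> (\<forall>i<n. A' 0 i = of_bool (i \<in> almost_sure_reach G s))) R1 A1"
    if h: "R1 0 = n" "\<forall>x. A1 15 x = of_bool (x \<in> almost_sure_reach G s)" for R1 A1
  proof (rule wp_For_conseq[where T = 1 and I = "\<lambda>j R' A'. \<forall>i<j. A' 0 i = of_bool (i \<in> almost_sure_reach G s)"], goal_cases)
    case (6 j R' A')
    have "A' 15 = A1 15" using agree_A[OF 6(3), of 15] by simp
    moreover have "j < L" using 6(1) h(1) length_inp Z_ge(3) by (simp add: tb_def off_def eb_def)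
    ultimately show ?case using 6(2,4) h(2) by (auto simp: less_Suc_eq)
  qed (use h small_ones in auto)
  have n_sq: "n * n < 2 ^ wd" using small2[of "n * n"] Z_ge(1) by (simp add: mult_strict_mono')
  show ?thesis unfolding reach_stm_def wp_Sq
  proof (rule wp_mono[OF wp_header[where A = A and R = R, OF A(1)]], goal_cases)
    case (1 t1 R1 A1)
    then have g: "glob R1 A1" and z: "A1 a = (\<lambda>_. 0)" if "2 \<le> a" for a using A(2)[of a] that by auto
    then have g: "glob R1 A1" using 1 by blast
    have r: "R1 0 = n" "R1 7 = kk" using g unfolding glob_def kk_def by auto
    show ?case
    proof (cases "drop_bit (kk - 1) (n * n) = 0")
      case False
      then have "2 ^ (kk - 1) \<le> n * n" by (metis drop_bit_eq_div div_less not_le)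
      \<comment> \<open>\<open>K\<close> exceeds the width \<open>kk - 1\<close> by 2, hence the
        factor 4, which is absorbed by one more factor \<open>Z\<close>.\<close>
      then have "2 ^ K \<le> 4 * (n * n)" unfolding K_def using kk_pos by (cases kk) auto
      also have "\<dots> \<le> Z * (Z * Z)" using Z_ge(1) by (intro mult_le_mono) auto
      finally have P: "2 ^ K \<le> Z ^ 3" by (simp add: power3_eq_cube mult.assoc)
      have w: "wp dp (\<lambda>t R' A'. wp ?out (\<lambda>t' R'' A''. t1 + (1 + t + t') \<le> time_bound \<and>
          (\<forall>i<n. A'' 0 i = of_bool (i \<in> almost_sure_reach G s))) R' A') R1 A1"
      proof (rule wp_mono[OF wp_dp[OF g z P G]], simp, goal_cases)
        case (1 t2 R2 A2)
        have "R2 0 = n" using 1 r agree_R[of dp R1 A1 R2 A2 0] by (simp add: dp_def wr_phases top_down_def wr_top_down_loop)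
        then show ?case
          by (intro wp_mono[OF out]) (use 1 \<open>t1 \<le> _ \<and> _\<close> time_dp in auto)
      qed
      show ?thesis using w False n_sq by (simp add: r)
    next
      case True
      then have lt: "n * n < 2 ^ (kk - 1)" by (simp add: drop_bit_eq_div div_eq_0_iff)
      have ng: "nglob R1 A1" using g unfolding glob_def nglob_def by simp
      have w: "wp naive (\<lambda>t R' A'. wp ?out (\<lambda>t' R'' A''. t1 + (1 + t + t') \<le> time_bound \<and>
          (\<forall>i<n. A'' 0 i = of_bool (i \<in> almost_sure_reach G s))) R' A') R1 A1"
      proof (rule wp_mono[OF wp_naive[OF ng z z]], simp, simp, goal_cases)
        case (1 t2 R2 A2)
        then obtain Q where Q: "A2 15 = ind Q" "as_closed Q" "\<forall>C. as_closed C \<longrightarrow> C \<subseteq> Q" by blast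
        have "almost_sure_reach G s = Q"
          by (rule closed_maximal_reach) (use Q as_closed_iff[OF G] in auto)
        then have "\<forall>x. A2 15 x = of_bool (x \<in> almost_sure_reach G s)" using Q(1) unfolding ind_def by simp
        moreover have "R2 0 = n" using 1 r agree_R[of naive R1 A1 R2 A2 0] by (simp add: naive_def wr_naive)
        ultimately show ?case
          by (intro wp_mono[OF out]) (use 1 \<open>t1 \<le> _ \<and> _\<close> time_naive[OF lt] in auto)
      qed
      show ?thesis using w True n_sq by (simp add: r)
    qed
  qed
qed

end

section \<open>The machine program\<close>

definition xwp :: "nat \<Rightarrow> com \<Rightarrow> (nat \<Rightarrow> state \<Rightarrow> bool) \<Rightarrow> state \<Rightarrow> bool" where
  "xwp w c Q \<sigma> \<longleftrightarrow> (\<exists>t \<tau>. exec w c \<sigma> t \<tau> \<and> Q t \<tau>)"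

lemma xwp_Const: "Q 1 (R(x := take_bit w a), M) \<Longrightarrow> xwp w (Const x a) Q (R, M)"
  and xwp_Op: "Q 1 (R(x := take_bit w (eval_binop f (R y) (R z))), M) \<Longrightarrow> xwp w (Op f x y z) Q (R, M)"
  and xwp_Load: "Q 1 (R(x := M (R y)), M) \<Longrightarrow> xwp w (Load x y) Q (R, M)"
  unfolding xwp_def using exec.Const exec.Op exec.Load by blast+

lemma xwp_Seq: "xwp w c1 (\<lambda>t1. xwp w c2 (\<lambda>t2. Q (t1 + t2))) \<sigma> \<Longrightarrow> xwp w (Seq c1 c2) Q \<sigma>"
  unfolding xwp_def using exec.Seq by blast

text \<open>Stores \<open>(n + m + b + t + 5)\<^sup>2\<close> in register 98, where \<open>n\<close>, \<open>m\<close>, \<open>b\<close> and \<open>t\<close> are the numbers of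
  vertices, edges, bags and tree edges. This bounds the length of the input.\<close>

definition prelude :: com where
  "prelude = Seq (Load 100 100) (Seq (Const 101 2) (Seq (Load 101 101) (Seq (Const 102 3) (Seq (Load 102 102)
     (Seq (Const 103 4) (Seq (Load 103 103) (Seq (Op Add 100 100 101) (Seq (Op Add 100 100 102)
     (Seq (Op Add 100 100 103) (Seq (Const 101 5) (Seq (Op Add 100 100 101) (Op Mul 98 100 100))))))))))))"

lemma exec_prelude:
  assumes x: "x = M 0 + M 2 + M 3 + M 4 + 5" and b: "x * x < 2 ^ w"
  shows "\<exists>t R. exec w prelude ((\<lambda>_. 0), M) t (R, M) \<and> t \<le> 13 \<and> (\<forall>y<98. R y = 0) \<and> R 98 = x * x"
proof -
  have "x \<le> x * x" using x by simp
  then have xw: "x < 2 ^ w" using b by (rule le_less_trans)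
  have tb: "take_bit w a = a" if "a \<le> x" for a using that xw by (intro take_bit_nat_eq_self) simp
  have s1: "take_bit w 2 = (2::nat)" "take_bit w 3 = (3::nat)" "take_bit w 4 = (4::nat)" "take_bit w 5 = (5::nat)"
    "take_bit w (M 0 + M 2) = M 0 + M 2" "take_bit w (M 0 + M 2 + M 3) = M 0 + M 2 + M 3"
    "take_bit w (M 0 + M 2 + M 3 + M 4) = M 0 + M 2 + M 3 + M 4"
    by (rule tb; simp add: x)+
  have s2: "take_bit w (M 0 + M 2 + M 3 + M 4 + 5) = x" using tb[OF le_refl] unfolding x .
  have s3: "take_bit w (x * x) = x * x" using b by (rule take_bit_nat_eq_self)
  have "2 \<le> w"
  proof (rule ccontr)
    assume "\<not> 2 \<le> w"
    then have "2 ^ w \<le> (2::nat) ^ 2" by (intro power_increasing) auto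
    then show False using xw x by simp
  qed
  note s = s1 s2 s3 this
  have "xwp w prelude (\<lambda>t (R, M'). M' = M \<and> t \<le> 13 \<and> (\<forall>y<98. R y = 0) \<and> R 98 = x * x) ((\<lambda>_. 0), M)"
    unfolding prelude_def
    by (intro xwp_Seq xwp_Const xwp_Op xwp_Load) (simp add: s)
  then show ?thesis unfolding xwp_def by auto
qed

definition reach_program :: com where
  "reach_program = Seq prelude (cstm reach_stm)"

lemma wfs_reach_stm: "wfs reach_stm"
  by (simp add: reach_stm_def header_def header_loop_def For_def dp_def naive_def adjacency_def bfs_def bfs_loop_def
      bfs_inner_def discover_def discover_loop_def scan_seen_def scan_new_def free_colour_def init_tables_def
      init_row_def eliminate_def eliminate_subset_def push_row_def top_down_def top_down_loop_def
      naive_round_def reach_pass_def prune_pass_def)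

context instance_td
begin

text \<open>Needed for the initial state of the simulation, where all array contents must be below
  \<open>2 ^ wd\<close>.\<close>

lemma inp_entries: "x \<in> set inp \<Longrightarrow> x < Z"
proof -
  assume "x \<in> set inp"
  then consider "x \<in> {n, s, length es, length bs, length ts}" | "x \<in> of_bool ` UNIV" | "x \<in> set (flatten_pairs es)"
    | b where "b \<in> set bs" "x = length b \<or> x \<in> set b" | "x \<in> set (flatten_pairs ts)"
    unfolding inp_def by auto
  then show ?thesis
  proof cases
    case 1
    then show ?thesis using Z_ge s_less by auto
  next
    case 2
    then show ?thesis using Z_ge(1) by auto
  next
    case 3
    then show ?thesis using es_less Z_ge(1) unfolding flatten_pairs_def by fastforce
  next
    case (4 b)
    obtain j where "j < length bs" "bs ! j = b" using 4(1) by (auto simp: in_set_conv_nth)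
    then have "length b < Z" using off_less[of j] Z_ge(7) by simp
    moreover have "x < Z" if "x \<in> set b" using bs_less[OF 4(1)] that Z_ge(1) by auto
    ultimately show ?thesis using 4(2) by blast
  next
    case 5
    then show ?thesis using ts_less Z_ge(5) unfolding flatten_pairs_def by fastforce
  qed
qed

lemma exec_reach_stm:
  assumes w: "w = wd + 6" and Lw: "L \<le> 2 ^ wd" and R: "\<And>y. y < 98 \<Longrightarrow> R y = 0" "R 98 = L"
    and M: "\<And>i. M i = (if i < length inp then inp ! i else 0)"
    and G: "edges G = set es" "verts G = {..<n}" "prob G = {u. u < n \<and> pr u}"
  shows "\<exists>t R' M'. exec w (cstm reach_stm) (R, M) t (R', M') \<and> t \<le> scost reach_stm * time_bound \<and>
    (\<forall>i<n. M' i = of_bool (i \<in> almost_sure_reach G s))"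
proof -
  interpret sim_machine wd L w by unfold_locales (use w Lw in auto)
  let ?A = "(\<lambda>c. if c = 0 then In else (\<lambda>_. 0))"
  have In_less: "In i < 2 ^ wd" for i
  proof (cases "i < length inp")
    case True
    then show ?thesis using inp_entries[of "inp ! i"] small1 unfolding In_def by simp
  qed (simp add: In_def)
  \<comment> \<open>The input ends before \<open>L\<close>, so all arrays but the input start out as
    zero; the tables, visited flags and adjacency heads rely on this.\<close>
  have "M (L + 32 * i + c) = 0" for i c using inp_L unfolding M by simp
  then have s: "sim (\<lambda>_. 0) ?A R M"
    unfolding sim_def using R M In_less by (auto simp: In_def)
  obtain t R1 A1 where 1: "run reach_stm (\<lambda>_. 0) ?A t R1 A1" "t \<le> time_bound" "\<forall>i<n. A1 0 i = of_bool (i \<in> almost_sure_reach G s)"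
    using wp_reach_stm[of ?A G "\<lambda>_. 0"] G unfolding wp_def by auto
  obtain t' R' M' where 2: "exec w (cstm reach_stm) (R, M) t' (R', M')" "t' \<le> scost reach_stm * t" "sim R1 A1 R' M'"
    using exec_cstm[OF 1(1) s wfs_reach_stm le_refl] by blast
  have "M' i = of_bool (i \<in> almost_sure_reach G s)" if "i < n" for i
  proof -
    have "i < L" using that length_inp inp_L by (simp add: tb_def off_def eb_def)
    then show ?thesis using 2(3) 1(3) that unfolding sim_def by auto
  qed
  moreover have "t' \<le> scost reach_stm * time_bound" using 2(2) 1(2) by (meson le_trans mult_le_mono2)
  ultimately show ?thesis using 2(1) by blast
qed

lemma kk_width: "td_width (set (map set bs)) = kk - 1"
proof -
  have "card ` set (map set bs) = length ` set bs"
    using bs_distinct by (auto simp: image_iff distinct_card)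
  moreover have "set bs \<noteq> {}" using bs_ne by auto
  ultimately show ?thesis unfolding td_width_def kk_def mx_def by simp
qed

end

theorem theorem2:
  shows "\<exists>(P :: com) (c :: real) (d :: nat).
    \<forall>(G :: nat mdp) (s :: nat) (B :: nat set set) (F :: nat set set set)
      (n :: nat) (k :: nat) (xs :: nat list) (w :: nat).
      is_mdp G \<longrightarrow> n = card (verts G) \<longrightarrow> s \<in> verts G \<longrightarrow>
      tree_decomposition (verts G) (undirected (edges G)) B F \<longrightarrow> k = td_width B \<longrightarrow>
      encodes_instance xs G s B F \<longrightarrow> (length xs + 2) ^ d \<le> 2 ^ w \<longrightarrow>
      (\<exists>t R M. exec w P (init_state xs) t (R, M) \<and>
        real t \<le> c * (real n * 2 ^ k * real (max 1 k) powr 2.38) \<and>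
        (\<forall>i<n. M i = of_bool (i \<in> almost_sure_reach G s)))"
proof (rule exI[of _ reach_program], rule exI[of _ "real (13 + scost reach_stm * 2000)"], rule exI[of _ 26],
    intro allI impI)
  fix G :: "nat mdp" and s :: nat and B F and n k :: nat and xs :: "nat list" and w :: nat
  assume mdp: "is_mdp G" and n: "n = card (verts G)" and s: "s \<in> verts G"
    and td: "tree_decomposition (verts G) (undirected (edges G)) B F" and k: "k = td_width B"
    and enc: "encodes_instance xs G s B F" and w: "(length xs + 2) ^ 26 \<le> 2 ^ w"
  obtain n' es bs ts where e: "verts G = {..<n'}" "distinct es" "set es = edges G"
    "\<forall>b\<in>set bs. distinct b" "distinct (map set bs)" "set (map set bs) = B"
    "\<forall>(i, j)\<in>set ts. i < length bs \<and> j < length bs" "distinct (map (\<lambda>(i, j). {i, j}) ts)"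
    "set (map (\<lambda>(i, j). {set (bs ! i), set (bs ! j)}) ts) = F"
    and xs: "xs = [n', s, length es, length bs, length ts] @ map (\<lambda>u. of_bool (u \<in> prob G)) [0..<n']
       @ flatten_pairs es @ concat (map (\<lambda>b. length b # b) bs) @ flatten_pairs ts"
    using enc unfolding encodes_instance_def by blast
  have [simp]: "n' = n" using n e(1) by simp
  define Z where "Z = length xs + 2"
  have Z2: "2 \<le> Z" unfolding Z_def by simp
  have "(2::nat) ^ 26 \<le> Z ^ 26" using Z2 by (rule power_mono) simp
  then have "(2::nat) ^ 26 \<le> 2 ^ w" using w unfolding Z_def by simp
  then have w26: "26 \<le> w" by (rule power_le_imp_le_exp[rotated]) simp
  \<comment> \<open>The exponent 26 splits as 20 + 6: \<open>Z ^ 20\<close> is the range required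
    for source values, and \<open>Z ^ 6\<close>, at least \<open>2 ^ 6\<close>, pays for the six
    address bits.\<close>
  define wd where "wd = w - 6"
  have wd: "w = wd + 6" "0 < wd" using w26 unfolding wd_def by auto
  have "Z ^ 20 * 2 ^ 6 \<le> Z ^ 20 * Z ^ 6" using Z2 by (intro mult_le_mono2 power_mono) auto
  also have "\<dots> = Z ^ 26" by (simp add: power_add[symmetric])
  also have "\<dots> \<le> 2 ^ wd * 2 ^ 6" using w unfolding Z_def wd(1) by (simp add: power_add)
  finally have ZW: "Z ^ 20 \<le> 2 ^ wd" by simp
  define x where "x = n + length es + length bs + length ts + 5"
  \<comment> \<open>The header does not contain the input length, but \<open>L\<close> has to be
    known in constant time. Each bag has at most \<open>n\<close> vertices, so the bags occupy at
    most \<open>length bs * (n + 1)\<close> cells, and a square suffices.\<close>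
  define L where "L = x * x"
  have lb: "lists_off bs (length bs) \<le> length bs * (n + 1)"
  proof -
    have "length b \<le> n" if "b \<in> set bs" for b
    proof -
      have "set b \<subseteq> {..<n}" using td that e(1,6) unfolding tree_decomposition_def by auto
      then have "card (set b) \<le> n" using card_mono[of "{..<n}" "set b"] by simp
      then show ?thesis using e(4) that by (simp add: distinct_card)
    qed
    then have "\<forall>b\<in>set bs. length b \<le> n" by blast
    then show ?thesis unfolding lists_off_def by (induction bs) auto
  qed
  have lx: "length xs = 5 + n + 2 * length es + lists_off bs (length bs) + 2 * length ts"
    unfolding xs by (simp add: length_lists)
  have lbs: "length bs \<le> lists_off bs (length bs)" unfolding lists_off_def by (induction bs) auto
  have xL: "length xs \<le> L"
  proof -
    have "5 + n + 2 * length es + length bs * (n + 1) + 2 * length ts \<le> x * x"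
      unfolding x_def by (simp add: algebra_simps)
    then show ?thesis using lb lx unfolding L_def by linarith
  qed
  have xZ: "x \<le> Z" using lx lbs unfolding x_def Z_def by simp
  have "L \<le> Z * Z" unfolding L_def using xZ by (rule mult_le_mono[OF _ ]) (rule xZ)
  also have "Z * Z = Z ^ 2" by (simp add: power2_eq_square)
  also have "Z ^ 2 \<le> Z ^ 20" using Z2 by (intro power_increasing) auto
  finally have LW: "L \<le> 2 ^ wd" using ZW by simp
  interpret instance_td wd L n s "\<lambda>u. u \<in> prob G" es bs ts xs Z F
  proof unfold_locales
    show "xs = [n, s, length es, length bs, length ts] @ map (\<lambda>u. of_bool (u \<in> prob G)) [0..<n]
       @ flatten_pairs es @ concat (map (\<lambda>b. length b # b) bs) @ flatten_pairs ts" using xs by simp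
    show "s < n" using s e(1) by simp
    show "u < n \<and> v < n" if "(u, v) \<in> set es" for u v
      using mdp that e(1,3) unfolding is_mdp_def by auto
    show "set b \<subseteq> {..<n}" if "b \<in> set bs" for b
      using td that e(1,6) unfolding tree_decomposition_def by auto
    show "tree_decomposition {..<n} (undirected (set es)) (set (map set bs)) F" using td e(1,3,6) by simp
  qed (use e wd ZW xL Z_def in auto)
  have G: "edges G = set es" "verts G = {..<n}" "prob G = {u. u < n \<and> u \<in> prob G}"
    using mdp e(1,3) unfolding is_mdp_def by auto
  let ?M = "\<lambda>i. if i < length xs then xs ! i else 0"
  have M: "?M 0 = n" "?M 2 = length es" "?M 3 = length bs" "?M 4 = length ts"
    unfolding In_def[symmetric] by auto
  have "L < 2 ^ w" using LW unfolding wd(1) by (simp add: power_add) (use zero_less_power[of "2::nat" wd] in linarith)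
  then obtain t1 R1 where 1: "exec w prelude ((\<lambda>_. 0), ?M) t1 (R1, ?M)" "t1 \<le> 13" "\<forall>y<98. R1 y = 0" "R1 98 = L"
    using exec_prelude[of x ?M w] M unfolding L_def x_def by auto
  obtain t2 R2 M2 where 2: "exec w (cstm reach_stm) (R1, ?M) t2 (R2, M2)" "t2 \<le> scost reach_stm * time_bound"
    "\<forall>i<n. M2 i = of_bool (i \<in> almost_sure_reach G s)"
    using exec_reach_stm[where R = R1 and M = ?M and G = G and w = w, OF wd(1) LW _ 1(4) refl G] 1(3) by blast
  have ex: "exec w reach_program (init_state xs) (t1 + t2) (R2, M2)"
    unfolding reach_program_def init_state_def using exec.Seq[OF 1(1) 2(1)] .
  define W where "W = n * 2 ^ k * (max 1 k) ^ 2"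
  have kk: "k = kk - 1" using k kk_width e(6) by simp
  \<comment> \<open>Lets the multiplicative constant absorb the 13 steps of the prelude.\<close>
  have "1 \<le> W" unfolding W_def using s_less by (simp add: Suc_leI)
  then have t12: "t1 + t2 \<le> 13 * W + scost reach_stm * (2000 * W)"
    using 1(2) 2(2) unfolding time_bound_def kk[symmetric] W_def[symmetric] by linarith
  have "real (max 1 k) ^ 2 = real (max 1 k) powr 2" by simp
  also have "\<dots> \<le> real (max 1 k) powr 2.38" by (rule powr_mono) auto
  finally have "real n * 2 ^ k * real (max 1 k) ^ 2 \<le> real n * 2 ^ k * real (max 1 k) powr 2.38"
    by (rule mult_left_mono) simp
  then have W: "real W \<le> real n * 2 ^ k * real (max 1 k) powr 2.38" unfolding W_def by simp
  have "t1 + t2 \<le> (13 + scost reach_stm * 2000) * W" using t12 by (simp add: algebra_simps)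
  then have "real (t1 + t2) \<le> real (13 + scost reach_stm * 2000) * real W"
    unfolding of_nat_mult[symmetric] by (rule of_nat_mono)
  also have "\<dots> \<le> real (13 + scost reach_stm * 2000) * (real n * 2 ^ k * real (max 1 k) powr 2.38)"
    by (rule mult_left_mono[OF W]) simp
  finally show "\<exists>t R M. exec w reach_program (init_state xs) t (R, M) \<and>
        real t \<le> real (13 + scost reach_stm * 2000) * (real n * 2 ^ k * real (max 1 k) powr 2.38) \<and>
        (\<forall>i<n. M i = of_bool (i \<in> almost_sure_reach G s))"
    using ex 2(3) by blast
qed

end
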